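(* Let $R$ be a commutative unital ring, $a \in R$, and let $n \in \mathbb{N}$ be even. Consider the Temperley--Lieb algebra $\mathcal{TL}_n(a)$ on $n$ strands and its trivial module $\mathds{1}$. Let $M = \{1, 3, \dots, n-1\}$ and let $\operatorname{Cup}(M)$ be the left ideal of $\mathcal{TL}_n(a)$ generated by $\prod_{i \in M} U_i$. Then $H_0(\mathcal{TL}_n(a), \mathds{1}) = R$, $$H_\star(\mathcal{TL}_n(a), \mathds{1}) = 0 \text{ for } 0 < \star < \frac{n}{2},$$ and $$H_{\star + \frac{n}{2}}(\mathcal{TL}_n(a), \mathds{1}) \cong H_\star(\mathcal{TL}_n(a), \operatorname{Cup}(M)) \text{ for all } \star \geq 0$$ (as $R$-modules).
   Context: Let $R$ be a commutative unital ring, $a \in R$ and $n \in \mathbb{N}$. The Temperley--Lieb algebra $\mathcal{TL}_n(a)$ is the associative unital $R$-algebra with generators $U_1, \dots, U_{n-1}$ and relations: (1) $U_iU_j = U_jU_i$ if $|i-j| \geq 2$; (2) $U_iU_jU_i = U_i$ if $j = i \pm 1$; (3) $U_i^2 = aU_i$ for all $i$. In particular $\mathcal{TL}_0(a) = \mathcal{TL}_1(a) = R$. The trivial module $\mathds{1}$ is $R$ regarded as a (left or right) $\mathcal{TL}_n(a)$-module via the $R$-algebra augmentation $\epsilon: \mathcal{TL}_n(a) \to R$ sending every generator $U_i$ to $0$; equivalently $\mathds{1} = \mathcal{TL}_n(a)/\widehat{\mathcal{TL}}_n$, where $\widehat{\mathcal{TL}}_n$ is the two-sided ideal generated by $U_1,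 \dots, U_{n-1}$. For a left $\mathcal{TL}_n(a)$-module $N$, $H_\star(\mathcal{TL}_n(a), N) = \operatorname{Tor}^{\mathcal{TL}_n(a)}_\star(\mathds{1}, N)$, with $\mathds{1}$ the right trivial module. The generators $U_i$, $i \in M$, commute pairwise, so the product $\prod_{i \in M} U_i$ is well defined. $\operatorname{Cup}(M) = \mathcal{TL}_n(a) \cdot \prod_{i\in M} U_i$ is regarded as a left $\mathcal{TL}_n(a)$-module. *)

theory Defs
  imports "HOL-Algebra.QuotRing" "HOL-Algebra.Module" "HOL-Algebra.Free_Abelian_Groups"
begin

section \<open>Modules\<close>

text \<open>
  Modules over a not necessarily commutative ring \<open>A\<close> are represented by the library record
  \<^typ>\<open>('a, 'm) module\<close>.  For a right module, \<open>a \<odot>\<^bsub>M\<^esub> x\<close> stands for \<open>x \<cdot> a\<close>.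
  The multiplicative fields of the record then carry no meaning.
  An algebra over \<open>R\<close> is also a \<^typ>\<open>('r, 'a) module\<close>, this time with meaningful
  multiplicative fields.
\<close>

locale left_module = A?: ring A + M?: abelian_group M
  for A :: "('a, 'x) ring_scheme" (structure) and M :: "('a, 'm, 'y) module_scheme" (structure) +
  assumes smult_closed [simp, intro]:
      "\<lbrakk>a \<in> carrier A; x \<in> carrier M\<rbrakk> \<Longrightarrow> a \<odot>\<^bsub>M\<^esub> x \<in> carrier M"
    and smult_l_distr:
      "\<lbrakk>a \<in> carrier A; b \<in> carrier A; x \<in> carrier M\<rbrakk>
        \<Longrightarrow> (a \<oplus> b) \<odot>\<^bsub>M\<^esub> x = a \<odot>\<^bsub>M\<^esub> x \<oplus>\<^bsub>M\<^esub> b \<odot>\<^bsub>M\<^esub> x"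
    and smult_r_distr:
      "\<lbrakk>a \<in> carrier A; x \<in> carrier M; y \<in> carrier M\<rbrakk>
        \<Longrightarrow> a \<odot>\<^bsub>M\<^esub> (x \<oplus>\<^bsub>M\<^esub> y) = a \<odot>\<^bsub>M\<^esub> x \<oplus>\<^bsub>M\<^esub> a \<odot>\<^bsub>M\<^esub> y"
    and smult_assoc:
      "\<lbrakk>a \<in> carrier A; b \<in> carrier A; x \<in> carrier M\<rbrakk>
        \<Longrightarrow> (a \<otimes> b) \<odot>\<^bsub>M\<^esub> x = a \<odot>\<^bsub>M\<^esub> (b \<odot>\<^bsub>M\<^esub> x)"
    and smult_one [simp]: "x \<in> carrier M \<Longrightarrow> \<one> \<odot>\<^bsub>M\<^esub> x = x"

locale right_module = A?: ring A + M?: abelian_group M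
  for A :: "('a, 'x) ring_scheme" (structure) and M :: "('a, 'm, 'y) module_scheme" (structure) +
  assumes smult_closed [simp, intro]:
      "\<lbrakk>a \<in> carrier A; x \<in> carrier M\<rbrakk> \<Longrightarrow> a \<odot>\<^bsub>M\<^esub> x \<in> carrier M"
    and smult_l_distr:
      "\<lbrakk>a \<in> carrier A; b \<in> carrier A; x \<in> carrier M\<rbrakk>
        \<Longrightarrow> (a \<oplus> b) \<odot>\<^bsub>M\<^esub> x = a \<odot>\<^bsub>M\<^esub> x \<oplus>\<^bsub>M\<^esub> b \<odot>\<^bsub>M\<^esub> x"
    and smult_r_distr:
      "\<lbrakk>a \<in> carrier A; x \<in> carrier M; y \<in> carrier M\<rbrakk>
        \<Longrightarrow> a \<odot>\<^bsub>M\<^esub> (x \<oplus>\<^bsub>M\<^esub> y) = a \<odot>\<^bsub>M\<^esub> x \<oplus>\<^bsub>M\<^esub> a \<odot>\<^bsub>M\<^esub> y"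
    and smult_assoc:
      "\<lbrakk>a \<in> carrier A; b \<in> carrier A; x \<in> carrier M\<rbrakk>
        \<Longrightarrow> (a \<otimes> b) \<odot>\<^bsub>M\<^esub> x = b \<odot>\<^bsub>M\<^esub> (a \<odot>\<^bsub>M\<^esub> x)"
    and smult_one [simp]: "x \<in> carrier M \<Longrightarrow> \<one> \<odot>\<^bsub>M\<^esub> x = x"

definition self_module :: "('r, 'x) ring_scheme \<Rightarrow> ('r, 'r) module" where
  "self_module R = \<lparr>carrier = carrier R, monoid.mult = monoid.mult R, one = one R,
     ring.zero = ring.zero R, ring.add = ring.add R, smult = monoid.mult R\<rparr>"

definition module_isomorphic ::
    "('r, 'x) ring_scheme \<Rightarrow> ('r, 'm) module \<Rightarrow> ('r, 'k) module \<Rightarrow> bool" where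
  "module_isomorphic R M N \<longleftrightarrow>
     (\<exists>f. bij_betw f (carrier M) (carrier N) \<and>
        (\<forall>x\<in>carrier M. \<forall>y\<in>carrier M. f (x \<oplus>\<^bsub>M\<^esub> y) = f x \<oplus>\<^bsub>N\<^esub> f y) \<and>
        (\<forall>r\<in>carrier R. \<forall>x\<in>carrier M. f (r \<odot>\<^bsub>M\<^esub> x) = r \<odot>\<^bsub>N\<^esub> f x))"


section \<open>Tensor products over an algebra\<close>

definition tensor_relators ::
    "('r, 'a) module \<Rightarrow> ('a, 'm) module \<Rightarrow> ('a, 'k) module \<Rightarrow> ('m \<times> 'k \<Rightarrow>\<^sub>0 int) set" where
  "tensor_relators A L N =
     {frag_of (x \<oplus>\<^bsub>L\<^esub> x', y) - frag_of (x, y) - frag_of (x', y) | x x' y.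
        x \<in> carrier L \<and> x' \<in> carrier L \<and> y \<in> carrier N} \<union>
     {frag_of (x, y \<oplus>\<^bsub>N\<^esub> y') - frag_of (x, y) - frag_of (x, y') | x y y'.
        x \<in> carrier L \<and> y \<in> carrier N \<and> y' \<in> carrier N} \<union>
     {frag_of (a \<odot>\<^bsub>L\<^esub> x, y) - frag_of (x, a \<odot>\<^bsub>N\<^esub> y) | a x y.
        a \<in> carrier A \<and> x \<in> carrier L \<and> y \<in> carrier N}"

definition tensor_null ::
    "('r, 'a) module \<Rightarrow> ('a, 'm) module \<Rightarrow> ('a, 'k) module \<Rightarrow> ('m \<times> 'k \<Rightarrow>\<^sub>0 int) set" where
  "tensor_null A L N =
     generate (free_Abelian_group (carrier L \<times> carrier N)) (tensor_relators A L N)"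

text \<open>The map \<open>L \<otimes> N \<rightarrow> L' \<otimes> N'\<close> induced by \<open>f\<close> and \<open>g\<close>; the arguments are the target modules.\<close>

definition tensor_map ::
    "('r, 'a) module \<Rightarrow> ('a, 'm) module \<Rightarrow> ('a, 'k) module \<Rightarrow> ('l \<Rightarrow> 'm) \<Rightarrow> ('n \<Rightarrow> 'k)
      \<Rightarrow> ('l \<times> 'n \<Rightarrow>\<^sub>0 int) set \<Rightarrow> ('m \<times> 'k \<Rightarrow>\<^sub>0 int) set" where
  "tensor_map A L' N' f g X =
     (\<Union>z\<in>X. tensor_null A L' N' #>\<^bsub>free_Abelian_group (carrier L' \<times> carrier N')\<^esub>
              frag_extend (\<lambda>(x, y). frag_of (f x, g y)) z)"

text \<open>\<open>L \<otimes>\<^sub>A N\<close> for a right module \<open>L\<close> and a left module \<open>N\<close> over the \<open>R\<close>-algebra \<open>A\<close>;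
  \<open>R\<close> acts by \<open>r (x \<otimes> y) = x \<otimes> (r 1\<^sub>A) y\<close>.\<close>

definition tensor ::
    "('r, 'a) module \<Rightarrow> ('a, 'm) module \<Rightarrow> ('a, 'k) module \<Rightarrow> ('r, ('m \<times> 'k \<Rightarrow>\<^sub>0 int) set) module" where
  "tensor A L N =
     (let Q = free_Abelian_group (carrier L \<times> carrier N) Mod tensor_null A L N in
      \<lparr>carrier = carrier Q, monoid.mult = undefined, one = undefined,
       ring.zero = \<one>\<^bsub>Q\<^esub>, ring.add = monoid.mult Q,
       smult = (\<lambda>r. tensor_map A L N (\<lambda>x. x) (\<lambda>y. (r \<odot>\<^bsub>A\<^esub> \<one>\<^bsub>A\<^esub>) \<odot>\<^bsub>N\<^esub> y))\<rparr>)"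


section \<open>Homology of chain complexes of modules\<close>

text \<open>The differential \<open>d k\<close> maps \<open>C (k + 1)\<close> to \<open>C k\<close>.\<close>

definition cycles :: "(nat \<Rightarrow> ('r, 'c) module) \<Rightarrow> (nat \<Rightarrow> 'c \<Rightarrow> 'c) \<Rightarrow> nat \<Rightarrow> 'c set" where
  "cycles C d k = {x \<in> carrier (C k). \<forall>j. k = Suc j \<longrightarrow> d j x = \<zero>\<^bsub>C j\<^esub>}"

definition boundaries :: "(nat \<Rightarrow> ('r, 'c) module) \<Rightarrow> (nat \<Rightarrow> 'c \<Rightarrow> 'c) \<Rightarrow> nat \<Rightarrow> 'c set" where
  "boundaries C d k = d k ` carrier (C (Suc k))"

definition homology ::
    "(nat \<Rightarrow> ('r, 'c) module) \<Rightarrow> (nat \<Rightarrow> 'c \<Rightarrow> 'c) \<Rightarrow> nat \<Rightarrow> ('r, 'c set) module" where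
  "homology C d k =
     \<lparr>carrier = (\<lambda>x. boundaries C d k +>\<^bsub>C k\<^esub> x) ` cycles C d k,
      monoid.mult = undefined, one = undefined,
      ring.zero = boundaries C d k,
      ring.add = (\<lambda>X Y. X <+>\<^bsub>C k\<^esub> Y),
      smult = (\<lambda>r X. \<Union>x\<in>X. boundaries C d k +>\<^bsub>C k\<^esub> (r \<odot>\<^bsub>C k\<^esub> x))\<rparr>"


section \<open>The canonical free resolution\<close>

text \<open>The free right \<open>A\<close>-module with basis \<open>B\<close>.\<close>

definition free_rmod :: "('r, 'a) module \<Rightarrow> 'b set \<Rightarrow> ('a, 'b \<Rightarrow> 'a) module" where
  "free_rmod A B =
     \<lparr>carrier = {f. (\<forall>b. f b \<in> carrier A) \<and> finite {b. f b \<noteq> \<zero>\<^bsub>A\<^esub>} \<and> {b. f b \<noteq> \<zero>\<^bsub>A\<^esub>} \<subseteq> B},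
      monoid.mult = undefined, one = undefined,
      ring.zero = (\<lambda>b. \<zero>\<^bsub>A\<^esub>), ring.add = (\<lambda>f g b. f b \<oplus>\<^bsub>A\<^esub> g b),
      smult = (\<lambda>a f b. f b \<otimes>\<^bsub>A\<^esub> a)\<rparr>"

definition lin_ext ::
    "('r, 'a) module \<Rightarrow> ('a, 'm) module \<Rightarrow> ('b \<Rightarrow> 'm) \<Rightarrow> ('b \<Rightarrow> 'a) \<Rightarrow> 'm" where
  "lin_ext A P \<phi> f = (\<Oplus>\<^bsub>P\<^esub>b\<in>{b. f b \<noteq> \<zero>\<^bsub>A\<^esub>}. f b \<odot>\<^bsub>P\<^esub> \<phi> b)"

definition lin_comb :: "('r, 'a) module \<Rightarrow> ('a \<times> 'b) list \<Rightarrow> 'b \<Rightarrow> 'a" where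
  "lin_comb A xs = foldr (\<lambda>(a, b) f. f(b := a \<oplus>\<^bsub>A\<^esub> f b)) xs (\<lambda>b. \<zero>\<^bsub>A\<^esub>)"

text \<open>
  Every right module \<open>L\<close> has a free resolution \<open>\<dots> \<rightarrow> F\<^sub>1 \<rightarrow> F\<^sub>0 \<rightarrow> L \<rightarrow> 0\<close> in which \<open>F\<^sub>0\<close> has the
  elements of \<open>L\<close> as basis and \<open>F\<^sub>k\<^sub>+\<^sub>1\<close> has a basis covering the kernel of the map out
  of \<open>F\<^sub>k\<close>.  To keep all these bases within one type, a basis element of \<open>F\<^sub>k\<^sub>+\<^sub>1\<close> is given by a
  formal linear combination \<open>xs\<close> of basis elements of \<open>F\<^sub>k\<close> whose value lies in that kernel, and
  \<open>Syz xs\<close> is mapped to this value.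
\<close>

datatype ('a, 'm) syz = Gen 'm | Syz "('a \<times> ('a, 'm) syz) list"

definition res_aug ::
    "('r, 'a) module \<Rightarrow> ('a, 'm) module \<Rightarrow> (('a, 'm) syz \<Rightarrow> 'a) \<Rightarrow> 'm" where
  "res_aug A L = lin_ext A L (\<lambda>t. case t of Gen x \<Rightarrow> x | Syz xs \<Rightarrow> \<zero>\<^bsub>L\<^esub>)"

definition res_bd ::
    "('r, 'a) module \<Rightarrow> (('a, 'm) syz \<Rightarrow> 'a) \<Rightarrow> ('a, 'm) syz \<Rightarrow> 'a" where
  "res_bd A =
     lin_ext A (free_rmod A UNIV)
       (\<lambda>t. case t of Gen x \<Rightarrow> (\<lambda>b. \<zero>\<^bsub>A\<^esub>) | Syz xs \<Rightarrow> lin_comb A xs)"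

primrec res_basis :: "('r, 'a) module \<Rightarrow> ('a, 'm) module \<Rightarrow> nat \<Rightarrow> ('a, 'm) syz set" where
  "res_basis A L 0 = Gen ` carrier L"
| "res_basis A L (Suc k) =
     {Syz xs | xs. set xs \<subseteq> carrier A \<times> res_basis A L k \<and>
        (if k = 0 then res_aug A L (lin_comb A xs) = \<zero>\<^bsub>L\<^esub>
         else res_bd A (lin_comb A xs) = (\<lambda>b. \<zero>\<^bsub>A\<^esub>))}"

abbreviation res_mod ::
    "('r, 'a) module \<Rightarrow> ('a, 'm) module \<Rightarrow> nat \<Rightarrow> ('a, ('a, 'm) syz \<Rightarrow> 'a) module" where
  "res_mod A L k \<equiv> free_rmod A (res_basis A L k)"


section \<open>Tor\<close>

definition Tor_complex ::
    "('r, 'a) module \<Rightarrow> ('a, 'm) module \<Rightarrow> ('a, 'k) module \<Rightarrow> nat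
      \<Rightarrow> ('r, ((('a, 'm) syz \<Rightarrow> 'a) \<times> 'k \<Rightarrow>\<^sub>0 int) set) module" where
  "Tor_complex A L N k = tensor A (res_mod A L k) N"

definition Tor_bd ::
    "('r, 'a) module \<Rightarrow> ('a, 'm) module \<Rightarrow> ('a, 'k) module \<Rightarrow> nat
      \<Rightarrow> ((('a, 'm) syz \<Rightarrow> 'a) \<times> 'k \<Rightarrow>\<^sub>0 int) set \<Rightarrow> ((('a, 'm) syz \<Rightarrow> 'a) \<times> 'k \<Rightarrow>\<^sub>0 int) set" where
  "Tor_bd A L N k = tensor_map A (res_mod A L k) N (res_bd A) (\<lambda>y. y)"

text \<open>Up to isomorphism \<open>Tor\<close> does not depend on the projective resolution of \<open>L\<close>; the
  canonical free one is used (see \<open>res_exact_aug\<close> and \<open>res_exact\<close> below).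
  \<open>Tor A L N k\<close> is \<open>Tor\<^sup>A\<^sub>k(L, N)\<close> with its structure as a module over the ground ring of \<open>A\<close>.\<close>

definition Tor ::
    "('r, 'a) module \<Rightarrow> ('a, 'm) module \<Rightarrow> ('a, 'k) module \<Rightarrow> nat
      \<Rightarrow> ('r, ((('a, 'm) syz \<Rightarrow> 'a) \<times> 'k \<Rightarrow>\<^sub>0 int) set set) module" where
  "Tor A L N = homology (Tor_complex A L N) (Tor_bd A L N)"


section \<open>Temperley--Lieb algebras\<close>

text \<open>The free associative unital \<open>R\<close>-algebra on the letters \<open>S\<close>: finitely supported functions on
  words, multiplied by convolution along concatenation.\<close>

definition free_alg :: "('r, 'x) ring_scheme \<Rightarrow> 's set \<Rightarrow> ('r, 's list \<Rightarrow> 'r) module" where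
  "free_alg R S =
     \<lparr>carrier = {f. (\<forall>w. f w \<in> carrier R) \<and> finite {w. f w \<noteq> \<zero>\<^bsub>R\<^esub>} \<and> {w. f w \<noteq> \<zero>\<^bsub>R\<^esub>} \<subseteq> lists S},
      monoid.mult = (\<lambda>f g w. \<Oplus>\<^bsub>R\<^esub>k\<in>{..length w}. f (take k w) \<otimes>\<^bsub>R\<^esub> g (drop k w)),
      one = (\<lambda>w. if w = [] then \<one>\<^bsub>R\<^esub> else \<zero>\<^bsub>R\<^esub>),
      ring.zero = (\<lambda>w. \<zero>\<^bsub>R\<^esub>), ring.add = (\<lambda>f g w. f w \<oplus>\<^bsub>R\<^esub> g w),
      smult = (\<lambda>r f w. r \<otimes>\<^bsub>R\<^esub> f w)\<rparr>"

definition letter :: "('r, 'x) ring_scheme \<Rightarrow> 's \<Rightarrow> 's list \<Rightarrow> 'r" where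
  "letter R s = (\<lambda>w. if w = [s] then \<one>\<^bsub>R\<^esub> else \<zero>\<^bsub>R\<^esub>)"

definition quot_alg :: "('r, 'a) module \<Rightarrow> 'a set \<Rightarrow> ('r, 'a set) module" where
  "quot_alg A I =
     \<lparr>carrier = carrier (A Quot I), monoid.mult = monoid.mult (A Quot I), one = one (A Quot I),
      ring.zero = ring.zero (A Quot I), ring.add = ring.add (A Quot I),
      smult = (\<lambda>r X. (I +>\<^bsub>A\<^esub> (r \<odot>\<^bsub>A\<^esub> \<one>\<^bsub>A\<^esub>)) \<otimes>\<^bsub>A Quot I\<^esub> X)\<rparr>"

definition TL_relators :: "('r, 'x) ring_scheme \<Rightarrow> nat \<Rightarrow> 'r \<Rightarrow> (nat list \<Rightarrow> 'r) set" where
  "TL_relators R n a =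
     (let F = free_alg R {1..<n}; u = letter R in
      {u i \<otimes>\<^bsub>F\<^esub> u j \<ominus>\<^bsub>F\<^esub> u j \<otimes>\<^bsub>F\<^esub> u i | i j.
         i \<in> {1..<n} \<and> j \<in> {1..<n} \<and> (i + 2 \<le> j \<or> j + 2 \<le> i)} \<union>
      {u i \<otimes>\<^bsub>F\<^esub> u j \<otimes>\<^bsub>F\<^esub> u i \<ominus>\<^bsub>F\<^esub> u i | i j.
         i \<in> {1..<n} \<and> j \<in> {1..<n} \<and> (j = i + 1 \<or> i = j + 1)} \<union>
      {u i \<otimes>\<^bsub>F\<^esub> u i \<ominus>\<^bsub>F\<^esub> a \<odot>\<^bsub>F\<^esub> u i | i. i \<in> {1..<n}})"

definition TL_ideal :: "('r, 'x) ring_scheme \<Rightarrow> nat \<Rightarrow> 'r \<Rightarrow> (nat list \<Rightarrow> 'r) set" where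
  "TL_ideal R n a = Idl\<^bsub>free_alg R {1..<n}\<^esub> (TL_relators R n a)"

definition TL :: "('r, 'x) ring_scheme \<Rightarrow> nat \<Rightarrow> 'r \<Rightarrow> ('r, (nat list \<Rightarrow> 'r) set) module" where
  "TL R n a = quot_alg (free_alg R {1..<n}) (TL_ideal R n a)"

definition TL_gen :: "('r, 'x) ring_scheme \<Rightarrow> nat \<Rightarrow> 'r \<Rightarrow> nat \<Rightarrow> (nat list \<Rightarrow> 'r) set" where
  "TL_gen R n a i = TL_ideal R n a +>\<^bsub>free_alg R {1..<n}\<^esub> letter R i"

text \<open>The augmentation sends the class of a noncommutative polynomial to its constant
  coefficient.\<close>

definition TL_aug :: "(nat list \<Rightarrow> 'r) set \<Rightarrow> 'r" where
  "TL_aug X = the_elem ((\<lambda>f. f []) ` X)"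

text \<open>As \<open>R\<close> is commutative, this is both the left and the right trivial module.\<close>

definition TL_trivial :: "('r, 'x) ring_scheme \<Rightarrow> ((nat list \<Rightarrow> 'r) set, 'r) module" where
  "TL_trivial R =
     \<lparr>carrier = carrier R, monoid.mult = monoid.mult R, one = one R, ring.zero = ring.zero R, ring.add = ring.add R,
      smult = (\<lambda>X r. TL_aug X \<otimes>\<^bsub>R\<^esub> r)\<rparr>"

text \<open>For finite \<open>M\<close> this is the product of the \<open>U\<^sub>i\<close> with \<open>i \<in> M\<close>, in increasing order of \<open>i\<close>;
  the order is irrelevant if the \<open>U\<^sub>i\<close> commute pairwise.\<close>

definition TL_prod :: "('r, 'x) ring_scheme \<Rightarrow> nat \<Rightarrow> 'r \<Rightarrow> nat set \<Rightarrow> (nat list \<Rightarrow> 'r) set" where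
  "TL_prod R n a M =
     foldr (\<lambda>i X. TL_gen R n a i \<otimes>\<^bsub>TL R n a\<^esub> X) (sorted_list_of_set M) \<one>\<^bsub>TL R n a\<^esub>"

definition Cup ::
    "('r, 'x) ring_scheme \<Rightarrow> nat \<Rightarrow> 'r \<Rightarrow> nat set
      \<Rightarrow> ((nat list \<Rightarrow> 'r) set, (nat list \<Rightarrow> 'r) set) module" where
  "Cup R n a M =
     (let A = TL R n a in
      \<lparr>carrier = {x \<otimes>\<^bsub>A\<^esub> TL_prod R n a M | x. x \<in> carrier A},
       monoid.mult = undefined, one = undefined, ring.zero = ring.zero A, ring.add = ring.add A, smult = monoid.mult A\<rparr>)"

definition TL_homology ::
    "('r, 'x) ring_scheme \<Rightarrow> nat \<Rightarrow> 'r \<Rightarrow> ((nat list \<Rightarrow> 'r) set, 'k) module \<Rightarrow> nat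
      \<Rightarrow> ('r, (((((nat list \<Rightarrow> 'r) set, 'r) syz \<Rightarrow> (nat list \<Rightarrow> 'r) set) \<times> 'k) \<Rightarrow>\<^sub>0 int) set set) module" where
  "TL_homology R n a N = Tor (TL R n a) (TL_trivial R) N"

section \<open>Induced maps of tensor products\<close>

lemma tensor_relators_subset:
  assumes L: "right_module A L" and N: "left_module A N"
  shows "tensor_relators A L N \<subseteq> carrier (free_Abelian_group (carrier L \<times> carrier N))"
proof -
  interpret L: right_module A L by (rule L)
  interpret N: left_module A N by (rule N)
  let ?S = "carrier L \<times> carrier N"
  have d: "Poly_Mapping.keys (u - v) \<subseteq> ?S"
    if "Poly_Mapping.keys u \<subseteq> ?S" "Poly_Mapping.keys v \<subseteq> ?S" for u v :: "_ \<Rightarrow>\<^sub>0 int"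
    using that keys_diff[of u v] by blast
  show ?thesis
    unfolding tensor_relators_def
    by (intro subsetI, unfold carrier_free_Abelian_group_iff, elim UnE CollectE exE conjE; hypsubst; intro d)
      auto
qed

lemma tensor_null_normal:
  assumes L: "right_module A L" and N: "left_module A N"
  shows "tensor_null A L N \<lhd> free_Abelian_group (carrier L \<times> carrier N)"
proof -
  interpret G: comm_group "free_Abelian_group (carrier L \<times> carrier N)"
    by (rule abelian_free_Abelian_group)
  show ?thesis unfolding tensor_null_def
    by (rule G.subgroup_imp_normal[OF G.generate_is_subgroup[OF tensor_relators_subset[OF L N]]])
qed

text \<open>On representatives, \<open>tensor_map\<close> is \<open>f \<otimes> g\<close>.\<close>

lemma tensor_map_coset:
  assumes L: "right_module A L" and N: "left_module A N"
    and L': "right_module A L'" and N': "left_module A N'"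
    and f: "f \<in> carrier L \<rightarrow> carrier L'" and g: "g \<in> carrier N \<rightarrow> carrier N'"
    and f_add: "\<And>x y. x \<in> carrier L \<Longrightarrow> y \<in> carrier L \<Longrightarrow> f (x \<oplus>\<^bsub>L\<^esub> y) = f x \<oplus>\<^bsub>L'\<^esub> f y"
    and g_add: "\<And>x y. x \<in> carrier N \<Longrightarrow> y \<in> carrier N \<Longrightarrow> g (x \<oplus>\<^bsub>N\<^esub> y) = g x \<oplus>\<^bsub>N'\<^esub> g y"
    and f_smult: "\<And>a x. a \<in> carrier A \<Longrightarrow> x \<in> carrier L \<Longrightarrow> f (a \<odot>\<^bsub>L\<^esub> x) = a \<odot>\<^bsub>L'\<^esub> f x"
    and g_smult: "\<And>a x. a \<in> carrier A \<Longrightarrow> x \<in> carrier N \<Longrightarrow> g (a \<odot>\<^bsub>N\<^esub> x) = a \<odot>\<^bsub>N'\<^esub> g x"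
    and z: "z \<in> carrier (free_Abelian_group (carrier L \<times> carrier N))"
  shows "tensor_map A L' N' f g (tensor_null A L N #>\<^bsub>free_Abelian_group (carrier L \<times> carrier N)\<^esub> z) =
    tensor_null A L' N' #>\<^bsub>free_Abelian_group (carrier L' \<times> carrier N')\<^esub>
      frag_extend (\<lambda>(x, y). frag_of (f x, g y)) z"
proof -
  let ?G = "free_Abelian_group (carrier L \<times> carrier N)"
  let ?G' = "free_Abelian_group (carrier L' \<times> carrier N')"
  let ?h = "frag_extend (\<lambda>(x, y). frag_of (f x, g y))"
  interpret G: group ?G by simp
  interpret G': group ?G' by simp
  interpret K: normal "tensor_null A L N" ?G by (rule tensor_null_normal[OF L N])
  interpret K': normal "tensor_null A L' N'" ?G' by (rule tensor_null_normal[OF L' N'])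
  have h_closed: "?h c \<in> carrier ?G'" if "c \<in> carrier ?G" for c
  proof -
    have "Poly_Mapping.keys (?h c) \<subseteq> (\<Union>p\<in>Poly_Mapping.keys c. Poly_Mapping.keys ((\<lambda>(x, y). frag_of (f x, g y)) p))"
      by (rule keys_frag_extend)
    also have "\<dots> \<subseteq> carrier L' \<times> carrier N'"
      using that f g unfolding carrier_free_Abelian_group_iff by fastforce
    finally show ?thesis by (simp add: carrier_free_Abelian_group_iff)
  qed
  have h_rel: "?h c \<in> tensor_relators A L' N'" if "c \<in> tensor_relators A L N" for c
    using that
  proof (unfold tensor_relators_def, elim UnE CollectE exE conjE, goal_cases)
    case (1 x x' y)
    then show ?case
      by (intro UnI1 CollectI exI[of _ "f x"] exI[of _ "f x'"] exI[of _ "g y"])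
        (use f g in \<open>auto simp: frag_extend_diff f_add\<close>)
  next
    case (2 x y y')
    then show ?case
      by (intro UnI1 UnI2[of _ "{_. _}"] UnI2 CollectI exI[of _ "f x"] exI[of _ "g y"] exI[of _ "g y'"])
        (use f g in \<open>auto simp: frag_extend_diff g_add\<close>)
  next
    case (3 a x y)
    then show ?case
      by (intro UnI2 CollectI exI[of _ a] exI[of _ "f x"] exI[of _ "g y"])
        (use f g in \<open>auto simp: frag_extend_diff f_smult g_smult\<close>)
  qed
  have h_null: "?h c \<in> tensor_null A L' N'" if "c \<in> tensor_null A L N" for c
    using that unfolding tensor_null_def
  proof (induct rule: generate.induct)
    case one show ?case
      using generate.one[of ?G' "tensor_relators A L' N'"] by simp
  next
    case (incl c) then show ?case by (intro generate.incl h_rel)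
  next
    case (inv c)
    then have "c \<in> carrier ?G" using tensor_relators_subset[OF L N] by blast
    then have "?h (inv\<^bsub>?G\<^esub> c) = inv\<^bsub>?G'\<^esub> (?h c)"
      using h_closed by (simp add: frag_extend_minus)
    then show ?case using generate.inv[OF h_rel[OF inv]] by simp
  next
    case (eng c d)
    then show ?case using generate.eng by (fastforce simp: frag_extend_add)
  qed
  have coset: "tensor_null A L' N' #>\<^bsub>?G'\<^esub> ?h w = tensor_null A L' N' #>\<^bsub>?G'\<^esub> ?h z"
    if w: "w \<in> tensor_null A L N #>\<^bsub>?G\<^esub> z" for w
  proof -
    obtain k where k: "k \<in> tensor_null A L N" "w = k \<otimes>\<^bsub>?G\<^esub> z"
      using w by (auto simp: r_coset_def)
    then have "?h w = ?h k \<otimes>\<^bsub>?G'\<^esub> ?h z" by (simp add: frag_extend_add)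
    moreover have "tensor_null A L' N' #>\<^bsub>?G'\<^esub> ?h k = tensor_null A L' N'"
      by (rule K'.rcos_const[OF G'.group_axioms h_null[OF k(1)]])
    ultimately show ?thesis
      using G'.coset_mult_assoc[OF K'.subset K'.mem_carrier[OF h_null[OF k(1)]] h_closed[OF z]]
      by (simp only:)
  qed
  have "z \<in> tensor_null A L N #>\<^bsub>?G\<^esub> z" by (rule G.rcos_self[OF z K.subgroup_axioms])
  then show ?thesis unfolding tensor_map_def using coset by blast
qed


section \<open>Exactness of the canonical resolution\<close>

lemma (in abelian_group) double_eq_zero: "x \<in> carrier G \<Longrightarrow> x \<oplus> x = x \<Longrightarrow> x = \<zero>"
  using add.l_cancel_one by blast

lemma free_rmod_simps:
  "\<zero>\<^bsub>free_rmod A B\<^esub> = (\<lambda>b. \<zero>\<^bsub>A\<^esub>)"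
  "f \<oplus>\<^bsub>free_rmod A B\<^esub> g = (\<lambda>b. f b \<oplus>\<^bsub>A\<^esub> g b)"
  "a \<odot>\<^bsub>free_rmod A B\<^esub> f = (\<lambda>b. f b \<otimes>\<^bsub>A\<^esub> a)"
  by (simp_all add: free_rmod_def)

lemma free_rmod_mono: "B \<subseteq> B' \<Longrightarrow> carrier (free_rmod A B) \<subseteq> carrier (free_rmod A B')"
  by (auto simp: free_rmod_def)

lemma free_rmodD:
  assumes "f \<in> carrier (free_rmod A B)"
  shows "f b \<in> carrier A" "finite {b. f b \<noteq> \<zero>\<^bsub>A\<^esub>}" "{b. f b \<noteq> \<zero>\<^bsub>A\<^esub>} \<subseteq> B"
  using assms by (auto simp: free_rmod_def)

lemma free_rmodI:
  assumes "\<And>b. f b \<in> carrier A" "\<And>b. f b \<noteq> \<zero>\<^bsub>A\<^esub> \<Longrightarrow> b \<in> C" "finite C" "C \<subseteq> B"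
  shows "f \<in> carrier (free_rmod A B)"
proof -
  have "{b. f b \<noteq> \<zero>\<^bsub>A\<^esub>} \<subseteq> C" using assms(2) by auto
  moreover from this have "finite {b. f b \<noteq> \<zero>\<^bsub>A\<^esub>}" using assms(3) by (rule finite_subset)
  ultimately show ?thesis using assms(1,4) by (simp add: free_rmod_def subset_trans[OF _ assms(4)])
qed

context
  fixes A :: "('r, 'a) module"
  assumes A: "ring A"
begin

interpretation A: ring A by (rule A)

lemma free_rmod_right_module: "right_module A (free_rmod A B)"
proof -
  have "abelian_group (free_rmod A B)"
  proof (rule abelian_groupI)
    fix f g h assume f: "f \<in> carrier (free_rmod A B)" and g: "g \<in> carrier (free_rmod A B)"
      and h: "h \<in> carrier (free_rmod A B)"
    note D = free_rmodD[OF f] free_rmodD[OF g] free_rmodD[OF h]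
    show "f \<oplus>\<^bsub>free_rmod A B\<^esub> g \<in> carrier (free_rmod A B)"
      by (rule free_rmodI[where C = "{b. f b \<noteq> \<zero>\<^bsub>A\<^esub>} \<union> {b. g b \<noteq> \<zero>\<^bsub>A\<^esub>}"])
        (use D in \<open>auto simp: free_rmod_simps\<close>)
    show "f \<oplus>\<^bsub>free_rmod A B\<^esub> g \<oplus>\<^bsub>free_rmod A B\<^esub> h = f \<oplus>\<^bsub>free_rmod A B\<^esub> (g \<oplus>\<^bsub>free_rmod A B\<^esub> h)"
      using D by (simp add: free_rmod_simps A.a_assoc)
    show "f \<oplus>\<^bsub>free_rmod A B\<^esub> g = g \<oplus>\<^bsub>free_rmod A B\<^esub> f"
      using D by (simp add: free_rmod_simps A.a_comm)
    show "\<zero>\<^bsub>free_rmod A B\<^esub> \<oplus>\<^bsub>free_rmod A B\<^esub> f = f"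
      using D by (simp add: free_rmod_simps)
    have "(\<lambda>b. \<ominus>\<^bsub>A\<^esub> f b) \<in> carrier (free_rmod A B)"
      by (rule free_rmodI[where C = "{b. f b \<noteq> \<zero>\<^bsub>A\<^esub>}"]) (use D in auto)
    moreover have "(\<lambda>b. \<ominus>\<^bsub>A\<^esub> f b) \<oplus>\<^bsub>free_rmod A B\<^esub> f = \<zero>\<^bsub>free_rmod A B\<^esub>"
      using D by (simp add: free_rmod_simps A.l_neg)
    then show "\<exists>g\<in>carrier (free_rmod A B). g \<oplus>\<^bsub>free_rmod A B\<^esub> f = \<zero>\<^bsub>free_rmod A B\<^esub>" by (rule bexI[where x = "\<lambda>b. \<ominus>\<^bsub>A\<^esub> f b"]) fact
  next
    show "\<zero>\<^bsub>free_rmod A B\<^esub> \<in> carrier (free_rmod A B)" by (simp add: free_rmod_def)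
  qed
  then show ?thesis
  proof (rule right_module.intro[OF A], unfold_locales)
    fix a f assume a: "a \<in> carrier A" and f: "f \<in> carrier (free_rmod A B)"
    note D = free_rmodD[OF f]
    show "a \<odot>\<^bsub>free_rmod A B\<^esub> f \<in> carrier (free_rmod A B)"
      by (rule free_rmodI[where C = "{b. f b \<noteq> \<zero>\<^bsub>A\<^esub>}"])
        (use D a in \<open>auto simp: free_rmod_simps\<close>)
  qed (auto simp: free_rmod_simps free_rmodD(1) A.l_distr A.r_distr A.m_assoc)
qed

lemma lin_comb_closed:
  "set xs \<subseteq> carrier A \<times> B \<Longrightarrow> lin_comb A xs \<in> carrier (free_rmod A B)"
proof (induct xs)
  case Nil show ?case by (simp add: lin_comb_def free_rmod_def)
next
  case (Cons x xs)
  obtain a b where x: "x = (a, b)" by (cases x)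
  have IH: "lin_comb A xs \<in> carrier (free_rmod A B)" using Cons by simp
  have eq: "lin_comb A (x # xs) = (lin_comb A xs)(b := a \<oplus>\<^bsub>A\<^esub> lin_comb A xs b)"
    by (simp add: lin_comb_def x)
  show ?case unfolding eq
    by (rule free_rmodI[where C = "insert b {c. lin_comb A xs c \<noteq> \<zero>\<^bsub>A\<^esub>}"])
      (use free_rmodD[OF IH] Cons.prems x in \<open>auto split: if_splits\<close>)
qed

lemma lin_comb_map:
  "distinct bs \<Longrightarrow> (\<And>b. z b \<in> carrier A) \<Longrightarrow>
    lin_comb A (map (\<lambda>b. (z b, b)) bs) = (\<lambda>b. if b \<in> set bs then z b else \<zero>\<^bsub>A\<^esub>)"
  by (induct bs) (auto simp: lin_comb_def fun_eq_iff)

lemma ex_lin_comb: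
  assumes z: "z \<in> carrier (free_rmod A B)"
  obtains xs where "set xs \<subseteq> carrier A \<times> B" "lin_comb A xs = z"
proof -
  note D = free_rmodD[OF z]
  obtain bs where bs: "set bs = {b. z b \<noteq> \<zero>\<^bsub>A\<^esub>}" "distinct bs"
    using finite_distinct_list[OF D(2)] by auto
  show thesis
  proof
    show "set (map (\<lambda>b. (z b, b)) bs) \<subseteq> carrier A \<times> B" using bs D by auto
    show "lin_comb A (map (\<lambda>b. (z b, b)) bs) = z"
      using bs D by (simp add: lin_comb_map fun_eq_iff)
  qed
qed

context
  fixes P :: "('a, 'p) module" and \<phi> :: "'b \<Rightarrow> 'p" and B :: "'b set"
  assumes P: "right_module A P" and \<phi>: "\<And>b. b \<in> B \<Longrightarrow> \<phi> b \<in> carrier P"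
begin

interpretation P: right_module A P by (rule P)

lemma right_smult_zero_left: "x \<in> carrier P \<Longrightarrow> \<zero>\<^bsub>A\<^esub> \<odot>\<^bsub>P\<^esub> x = \<zero>\<^bsub>P\<^esub>"
  by (rule P.M.double_eq_zero) (simp, subst P.smult_l_distr[symmetric], simp_all)

lemma right_smult_zero_right: "a \<in> carrier A \<Longrightarrow> a \<odot>\<^bsub>P\<^esub> \<zero>\<^bsub>P\<^esub> = \<zero>\<^bsub>P\<^esub>"
  by (rule P.M.double_eq_zero) (simp, subst P.smult_r_distr[symmetric], simp_all)

context
  notes right_smult_zero_left [simp] right_smult_zero_right [simp]
begin

lemma lin_ext_superset:
  assumes f: "f \<in> carrier (free_rmod A B)" and C: "finite C" "{b. f b \<noteq> \<zero>\<^bsub>A\<^esub>} \<subseteq> C" "C \<subseteq> B"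
  shows "lin_ext A P \<phi> f = (\<Oplus>\<^bsub>P\<^esub>b\<in>C. f b \<odot>\<^bsub>P\<^esub> \<phi> b)"
  unfolding lin_ext_def
  by (rule P.M.add.finprod_mono_neutral_cong_left) (use C \<phi> free_rmodD(1)[OF f] in auto)

lemma lin_ext_closed:
  assumes f: "f \<in> carrier (free_rmod A B)"
  shows "lin_ext A P \<phi> f \<in> carrier P"
  unfolding lin_ext_def using free_rmodD[OF f] \<phi> by (auto intro!: P.M.finsum_closed)

lemma lin_ext_add:
  assumes f: "f \<in> carrier (free_rmod A B)" and g: "g \<in> carrier (free_rmod A B)"
  shows "lin_ext A P \<phi> (f \<oplus>\<^bsub>free_rmod A B\<^esub> g) = lin_ext A P \<phi> f \<oplus>\<^bsub>P\<^esub> lin_ext A P \<phi> g"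
proof -
  interpret F: right_module A "free_rmod A B" by (rule free_rmod_right_module)
  let ?C = "{b. f b \<noteq> \<zero>\<^bsub>A\<^esub>} \<union> {b. g b \<noteq> \<zero>\<^bsub>A\<^esub>}"
  note D = free_rmodD[OF f] free_rmodD[OF g]
  have C: "finite ?C" "?C \<subseteq> B" using D by auto
  have "lin_ext A P \<phi> (f \<oplus>\<^bsub>free_rmod A B\<^esub> g) = (\<Oplus>\<^bsub>P\<^esub>b\<in>?C. (f b \<oplus>\<^bsub>A\<^esub> g b) \<odot>\<^bsub>P\<^esub> \<phi> b)"
    by (subst lin_ext_superset[OF F.M.a_closed[OF f g] C(1) _ C(2)])
      (auto simp: free_rmod_simps)
  also have "\<dots> = (\<Oplus>\<^bsub>P\<^esub>b\<in>?C. f b \<odot>\<^bsub>P\<^esub> \<phi> b \<oplus>\<^bsub>P\<^esub> g b \<odot>\<^bsub>P\<^esub> \<phi> b)"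
    by (rule P.M.finsum_cong') (use C D \<phi> in \<open>auto simp: P.smult_l_distr subset_iff\<close>)
  also have "\<dots> = lin_ext A P \<phi> f \<oplus>\<^bsub>P\<^esub> lin_ext A P \<phi> g"
    unfolding lin_ext_superset[OF f C(1) Un_upper1 C(2)] lin_ext_superset[OF g C(1) Un_upper2 C(2)]
    by (rule P.M.finsum_addf) (use C D \<phi> in auto)
  finally show ?thesis .
qed

lemma lin_ext_smult:
  assumes f: "f \<in> carrier (free_rmod A B)" and a: "a \<in> carrier A"
  shows "lin_ext A P \<phi> (a \<odot>\<^bsub>free_rmod A B\<^esub> f) = a \<odot>\<^bsub>P\<^esub> lin_ext A P \<phi> f"
proof -
  interpret F: right_module A "free_rmod A B" by (rule free_rmod_right_module)
  let ?C = "{b. f b \<noteq> \<zero>\<^bsub>A\<^esub>}"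
  note D = free_rmodD[OF f]
  have sm: "a \<odot>\<^bsub>P\<^esub> (\<Oplus>\<^bsub>P\<^esub>b\<in>C. h b) = (\<Oplus>\<^bsub>P\<^esub>b\<in>C. a \<odot>\<^bsub>P\<^esub> h b)"
    if "finite C" "h \<in> C \<rightarrow> carrier P" for C :: "'b set" and h
    using that by (induct C) (auto simp: a P.smult_r_distr Pi_def)
  have "lin_ext A P \<phi> (a \<odot>\<^bsub>free_rmod A B\<^esub> f) = (\<Oplus>\<^bsub>P\<^esub>b\<in>?C. (f b \<otimes>\<^bsub>A\<^esub> a) \<odot>\<^bsub>P\<^esub> \<phi> b)"
    by (subst lin_ext_superset[OF F.smult_closed[OF a f] D(2) _ D(3)])
      (use a in \<open>auto simp: free_rmod_simps\<close>)
  also have "\<dots> = (\<Oplus>\<^bsub>P\<^esub>b\<in>?C. a \<odot>\<^bsub>P\<^esub> (f b \<odot>\<^bsub>P\<^esub> \<phi> b))"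
    by (rule P.M.finsum_cong') (use a D \<phi> in \<open>auto simp: P.smult_assoc subset_iff\<close>)
  also have "\<dots> = a \<odot>\<^bsub>P\<^esub> lin_ext A P \<phi> f"
    unfolding lin_ext_def by (rule sm[symmetric]) (use D \<phi> in auto)
  finally show ?thesis .
qed

lemma lin_ext_unit:
  assumes b: "b \<in> B"
  shows "(\<lambda>c. if c = b then \<one>\<^bsub>A\<^esub> else \<zero>\<^bsub>A\<^esub>) \<in> carrier (free_rmod A B)"
    and "lin_ext A P \<phi> (\<lambda>c. if c = b then \<one>\<^bsub>A\<^esub> else \<zero>\<^bsub>A\<^esub>) = \<phi> b"
proof -
  show *: "(\<lambda>c. if c = b then \<one>\<^bsub>A\<^esub> else \<zero>\<^bsub>A\<^esub>) \<in> carrier (free_rmod A B)"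
    by (rule free_rmodI[where C = "{b}"]) (use b in \<open>auto split: if_splits\<close>)
  show "lin_ext A P \<phi> (\<lambda>c. if c = b then \<one>\<^bsub>A\<^esub> else \<zero>\<^bsub>A\<^esub>) = \<phi> b"
    by (subst lin_ext_superset[OF *, of "{b}"]) (use b \<phi> in \<open>auto split: if_splits\<close>)
qed

lemma lin_ext_kill:
  assumes f: "f \<in> carrier (free_rmod A B)"
    and add: "\<And>x y. x \<in> carrier P \<Longrightarrow> y \<in> carrier P \<Longrightarrow> h (x \<oplus>\<^bsub>P\<^esub> y) = h x \<oplus>\<^bsub>Q\<^esub> h y"
    and sm: "\<And>a x. a \<in> carrier A \<Longrightarrow> x \<in> carrier P \<Longrightarrow> h (a \<odot>\<^bsub>P\<^esub> x) = a \<odot>\<^bsub>Q\<^esub> h x"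
    and cl: "\<And>x. x \<in> carrier P \<Longrightarrow> h x \<in> carrier Q"
    and Q: "right_module A Q"
    and z: "\<And>b. b \<in> B \<Longrightarrow> h (\<phi> b) = \<zero>\<^bsub>Q\<^esub>"
  shows "h (lin_ext A P \<phi> f) = \<zero>\<^bsub>Q\<^esub>"
proof -
  interpret Q: right_module A Q by (rule Q)
  have z0: "a \<odot>\<^bsub>Q\<^esub> \<zero>\<^bsub>Q\<^esub> = \<zero>\<^bsub>Q\<^esub>" if "a \<in> carrier A" for a
    by (rule Q.M.double_eq_zero) (simp add: that, subst Q.smult_r_distr[symmetric], simp_all add: that)
  have h0: "h \<zero>\<^bsub>P\<^esub> = \<zero>\<^bsub>Q\<^esub>"
    by (rule Q.M.double_eq_zero) (simp add: cl, subst add[symmetric], simp_all)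
  have "h (\<Oplus>\<^bsub>P\<^esub>b\<in>C. f b \<odot>\<^bsub>P\<^esub> \<phi> b) = \<zero>\<^bsub>Q\<^esub>" if "finite C" "C \<subseteq> B" for C
    using that
    by (induct C) (use free_rmodD[OF f] \<phi> in \<open>auto simp: h0 add sm z z0 Pi_def subset_iff\<close>)
  then show ?thesis unfolding lin_ext_def using free_rmodD[OF f] by simp
qed

end

end

end

lemma res_basis_Suc_Syz:
  assumes "t \<in> res_basis A L (Suc k)"
  obtains xs where "t = Syz xs" "set xs \<subseteq> carrier A \<times> res_basis A L k"
    "k = 0 \<Longrightarrow> res_aug A L (lin_comb A xs) = \<zero>\<^bsub>L\<^esub>"
    "k \<noteq> 0 \<Longrightarrow> res_bd A (lin_comb A xs) = (\<lambda>b. \<zero>\<^bsub>A\<^esub>)"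
  using assms by (auto split: if_splits)

context
  fixes A :: "('r, 'a) module" and L :: "('a, 'm) module"
  assumes L: "right_module A L"
begin

interpretation L: right_module A L by (rule L)
lemma res_ring: "ring A" by (rule L.A.ring_axioms)

lemma res_aug_vals: "t \<in> res_basis A L 0 \<Longrightarrow> (case t of Gen x \<Rightarrow> x | Syz xs \<Rightarrow> \<zero>\<^bsub>L\<^esub>) \<in> carrier L"
  by auto

lemma res_bd_vals: "t \<in> res_basis A L (Suc k) \<Longrightarrow>
    (case t of Gen x \<Rightarrow> (\<lambda>b. \<zero>\<^bsub>A\<^esub>) | Syz xs \<Rightarrow> lin_comb A xs) \<in> carrier (res_mod A L k)"
  by (elim res_basis_Suc_Syz) (auto intro: lin_comb_closed[OF res_ring])

lemma res_aug_surj: "res_aug A L ` carrier (res_mod A L 0) = carrier L"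
proof
  show "res_aug A L ` carrier (res_mod A L 0) \<subseteq> carrier L"
    unfolding res_aug_def by (intro image_subsetI lin_ext_closed[OF res_ring L, of "res_basis A L 0"]) auto
  show "carrier L \<subseteq> res_aug A L ` carrier (res_mod A L 0)"
  proof
    fix x assume x: "x \<in> carrier L"
    then have b: "Gen x \<in> res_basis A L 0" by simp
    show "x \<in> res_aug A L ` carrier (res_mod A L 0)"
      using lin_ext_unit[OF res_ring L _ b, of "\<lambda>t. case t of Gen x \<Rightarrow> x | Syz xs \<Rightarrow> \<zero>\<^bsub>L\<^esub>"]
      unfolding res_aug_def by (force simp: image_iff)
  qed
qed

lemma res_bd_restrict:
  assumes f: "f \<in> carrier (res_mod A L (Suc k))"
  shows "res_bd A f = lin_ext A (res_mod A L k) (\<lambda>t. case t of Gen x \<Rightarrow> (\<lambda>b. \<zero>\<^bsub>A\<^esub>) | Syz xs \<Rightarrow> lin_comb A xs) f"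
proof -
  let ?\<phi> = "\<lambda>t. case t of Gen x \<Rightarrow> (\<lambda>b. \<zero>\<^bsub>A\<^esub>) | Syz xs \<Rightarrow> lin_comb A xs"
  let ?F = "res_mod A L k" and ?U = "free_rmod A (UNIV :: ('a,'m) syz set)"
  interpret F: right_module A ?F by (rule free_rmod_right_module[OF res_ring])
  interpret U: right_module A ?U by (rule free_rmod_right_module[OF res_ring])
  note D = free_rmodD[OF f]
  have \<phi>: "?\<phi> t \<in> carrier ?F" if "t \<in> res_basis A L (Suc k)" for t
    using that by (elim res_basis_Suc_Syz) (auto intro: lin_comb_closed[OF res_ring])
  have cl: "f t \<odot>\<^bsub>?F\<^esub> ?\<phi> t \<in> carrier ?F" if "t \<in> res_basis A L (Suc k)" for t
    using D(1) \<phi>[OF that] by blast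
  have sub: "carrier ?F \<subseteq> carrier ?U" by (rule free_rmod_mono) simp
  have "(\<Oplus>\<^bsub>?U\<^esub>t\<in>C. f t \<odot>\<^bsub>?U\<^esub> ?\<phi> t) = (\<Oplus>\<^bsub>?F\<^esub>t\<in>C. f t \<odot>\<^bsub>?F\<^esub> ?\<phi> t)"
    if "finite C" "C \<subseteq> res_basis A L (Suc k)" for C
    using that
  proof (induct C)
    case empty then show ?case by (simp add: free_rmod_simps)
  next
    case (insert t C)
    have sm: "f t \<odot>\<^bsub>?U\<^esub> ?\<phi> t = f t \<odot>\<^bsub>?F\<^esub> ?\<phi> t" for t by (simp add: free_rmod_simps)
    have clF: "(\<lambda>t. f t \<odot>\<^bsub>?F\<^esub> ?\<phi> t) \<in> insert t C \<rightarrow> carrier ?F" using insert cl by blast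
    have clU: "(\<lambda>t. f t \<odot>\<^bsub>?U\<^esub> ?\<phi> t) \<in> insert t C \<rightarrow> carrier ?U"
      using clF sub unfolding sm by blast
    have "(\<Oplus>\<^bsub>?U\<^esub>t\<in>insert t C. f t \<odot>\<^bsub>?U\<^esub> ?\<phi> t) = f t \<odot>\<^bsub>?U\<^esub> ?\<phi> t \<oplus>\<^bsub>?U\<^esub> (\<Oplus>\<^bsub>?U\<^esub>t\<in>C. f t \<odot>\<^bsub>?U\<^esub> ?\<phi> t)"
      by (rule U.M.finsum_insert) (use insert clU in auto)
    also have "\<dots> = f t \<odot>\<^bsub>?F\<^esub> ?\<phi> t \<oplus>\<^bsub>?F\<^esub> (\<Oplus>\<^bsub>?F\<^esub>t\<in>C. f t \<odot>\<^bsub>?F\<^esub> ?\<phi> t)"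
      using insert by (simp add: free_rmod_simps)
    also have "\<dots> = (\<Oplus>\<^bsub>?F\<^esub>t\<in>insert t C. f t \<odot>\<^bsub>?F\<^esub> ?\<phi> t)"
      by (rule F.M.finsum_insert[symmetric]) (use insert clF in auto)
    finally show ?case .
  qed
  then show ?thesis unfolding res_bd_def lin_ext_def using D by simp
qed

lemma res_bd_closed:
  assumes f: "f \<in> carrier (res_mod A L (Suc k))"
  shows "res_bd A f \<in> carrier (res_mod A L k)"
  unfolding res_bd_restrict[OF f]
  by (rule lin_ext_closed[OF res_ring free_rmod_right_module[OF res_ring] _ f])
    (auto intro: lin_comb_closed[OF res_ring])

lemma Syz_hit:
  assumes z: "z \<in> carrier (res_mod A L k)"
    and k: "if k = 0 then res_aug A L z = \<zero>\<^bsub>L\<^esub> else res_bd A z = (\<lambda>b. \<zero>\<^bsub>A\<^esub>)"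
  shows "z \<in> res_bd A ` carrier (res_mod A L (Suc k))"
proof -
  obtain xs where xs: "set xs \<subseteq> carrier A \<times> res_basis A L k" "lin_comb A xs = z"
    by (rule ex_lin_comb[OF res_ring z])
  have b: "Syz xs \<in> res_basis A L (Suc k)" using xs k by auto
  let ?u = "\<lambda>c. if c = Syz xs then \<one>\<^bsub>A\<^esub> else \<zero>\<^bsub>A\<^esub>"
  let ?\<phi> = "\<lambda>t. case t of Gen x \<Rightarrow> (\<lambda>b. \<zero>\<^bsub>A\<^esub>) | Syz xs \<Rightarrow> lin_comb A xs"
  have \<phi>: "?\<phi> t \<in> carrier (res_mod A L k)" if "t \<in> res_basis A L (Suc k)" for t
    using that by (elim res_basis_Suc_Syz) (auto intro: lin_comb_closed[OF res_ring])
  note u = lin_ext_unit[OF res_ring free_rmod_right_module[OF res_ring] \<phi> b]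
  have "res_bd A ?u = z"
    using res_bd_restrict[OF u(1)] u(2) xs(2) by simp
  then show ?thesis using u(1) by force
qed

theorem res_exact_aug:
  "res_bd A ` carrier (res_mod A L (Suc 0)) = {f \<in> carrier (res_mod A L 0). res_aug A L f = \<zero>\<^bsub>L\<^esub>}"
proof
  show "{f \<in> carrier (res_mod A L 0). res_aug A L f = \<zero>\<^bsub>L\<^esub>} \<subseteq> res_bd A ` carrier (res_mod A L (Suc 0))"
    using Syz_hit[of _ 0] by auto
  have "res_aug A L (res_bd A f) = \<zero>\<^bsub>L\<^esub>" if f: "f \<in> carrier (res_mod A L (Suc 0))" for f
    unfolding res_bd_restrict[OF f]
  proof (rule lin_ext_kill[OF res_ring free_rmod_right_module[OF res_ring] res_bd_vals f _ _ _ L])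
    fix t assume "t \<in> res_basis A L (Suc 0)"
    then show "res_aug A L (case t of Gen x \<Rightarrow> (\<lambda>b. \<zero>\<^bsub>A\<^esub>) | Syz xs \<Rightarrow> lin_comb A xs) = \<zero>\<^bsub>L\<^esub>"
      by (elim res_basis_Suc_Syz) simp
  qed (simp_all only: res_aug_def lin_ext_closed[OF res_ring L res_aug_vals] lin_ext_add[OF res_ring L res_aug_vals]
      lin_ext_smult[OF res_ring L res_aug_vals])
  then show "res_bd A ` carrier (res_mod A L (Suc 0)) \<subseteq> {f \<in> carrier (res_mod A L 0). res_aug A L f = \<zero>\<^bsub>L\<^esub>}"
    using res_bd_closed by blast
qed

theorem res_exact:
  "res_bd A ` carrier (res_mod A L (Suc (Suc k))) =
    {f \<in> carrier (res_mod A L (Suc k)). res_bd A f = \<zero>\<^bsub>res_mod A L k\<^esub>}"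
proof
  show "{f \<in> carrier (res_mod A L (Suc k)). res_bd A f = \<zero>\<^bsub>res_mod A L k\<^esub>}
     \<subseteq> res_bd A ` carrier (res_mod A L (Suc (Suc k)))"
    using Syz_hit[of _ "Suc k"] by (auto simp: free_rmod_simps simp del: res_basis.simps)
  let ?\<phi> = "\<lambda>t. case t of Gen x \<Rightarrow> (\<lambda>b. \<zero>\<^bsub>A\<^esub>) | Syz xs \<Rightarrow> lin_comb A xs"
  have \<phi>: "?\<phi> t \<in> carrier (res_mod A L k)" if "t \<in> res_basis A L (Suc k)" for t k
    using that by (elim res_basis_Suc_Syz) (auto intro: lin_comb_closed[OF res_ring])
  have "res_bd A (res_bd A f) = \<zero>\<^bsub>res_mod A L k\<^esub>" if f: "f \<in> carrier (res_mod A L (Suc (Suc k)))" for f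
  proof -
    have F: "right_module A (free_rmod A B)" for B :: "('a, 'm) syz set"
      by (rule free_rmod_right_module[OF res_ring])
    interpret F1: right_module A "res_mod A L (Suc k)" by (rule F)
    show ?thesis
      unfolding res_bd_restrict[OF f]
    proof (rule lin_ext_kill[OF res_ring F \<phi> f _ _ _ F])
      show "res_bd A (f \<oplus>\<^bsub>res_mod A L (Suc k)\<^esub> g) = res_bd A f \<oplus>\<^bsub>res_mod A L k\<^esub> res_bd A g"
        if "f \<in> carrier (res_mod A L (Suc k))" "g \<in> carrier (res_mod A L (Suc k))" for f g
        unfolding res_bd_restrict[OF that(1)] res_bd_restrict[OF that(2)] res_bd_restrict[OF F1.M.a_closed[OF that]]
        by (rule lin_ext_add[OF res_ring F \<phi> that])
      show "res_bd A (a \<odot>\<^bsub>res_mod A L (Suc k)\<^esub> f) = a \<odot>\<^bsub>res_mod A L k\<^esub> res_bd A f"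
        if "a \<in> carrier A" "f \<in> carrier (res_mod A L (Suc k))" for f a
        unfolding res_bd_restrict[OF that(2)] res_bd_restrict[OF F1.smult_closed[OF that]]
        by (rule lin_ext_smult[OF res_ring F \<phi> that(2,1)])
      show "res_bd A f \<in> carrier (res_mod A L k)" if "f \<in> carrier (res_mod A L (Suc k))" for f
        using that by (rule res_bd_closed)
      show "res_bd A (?\<phi> t) = \<zero>\<^bsub>res_mod A L k\<^esub>" if "t \<in> res_basis A L (Suc (Suc k))" for t
        using that by (elim res_basis_Suc_Syz) (simp add: free_rmod_simps)
    qed
  qed
  then show "res_bd A ` carrier (res_mod A L (Suc (Suc k))) \<subseteq> {f \<in> carrier (res_mod A L (Suc k)). res_bd A f = \<zero>\<^bsub>res_mod A L k\<^esub>}"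
    using res_bd_closed by blast
qed

end


section \<open>Free algebras\<close>

lemma (in abelian_monoid) finsum_triangle:
  assumes F: "\<And>i j. F i j \<in> carrier G"
  shows "(\<Oplus>k\<in>{..n::nat}. \<Oplus>j\<in>{..k}. F j (k - j)) = (\<Oplus>j\<in>{..n}. \<Oplus>m\<in>{..n - j}. F j m)"
proof (induct n)
  case 0 show ?case by (simp add: F)
next
  case (Suc n)
  have "(\<Oplus>j\<in>{..n}. \<Oplus>m\<in>{..Suc n - j}. F j m) = (\<Oplus>j\<in>{..n}. F j (Suc n - j) \<oplus> (\<Oplus>m\<in>{..n - j}. F j m))"
    by (rule finsum_cong') (auto simp: Suc_diff_le F Pi_def)
  also have "\<dots> = (\<Oplus>j\<in>{..n}. F j (Suc n - j)) \<oplus> (\<Oplus>k\<in>{..n}. \<Oplus>j\<in>{..k}. F j (k - j))"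
    unfolding Suc by (rule finsum_addf) (auto intro!: finsum_closed F)
  finally have *: "(\<Oplus>j\<in>{..n}. \<Oplus>m\<in>{..Suc n - j}. F j m) = \<dots>" .
  have "(\<Oplus>j\<in>{..Suc n}. \<Oplus>m\<in>{..Suc n - j}. F j m) = F (Suc n) 0 \<oplus> (\<Oplus>j\<in>{..n}. \<Oplus>m\<in>{..Suc n - j}. F j m)"
    by (subst finsum_Suc) (auto simp: F Pi_def intro!: finsum_closed)
  also have "\<dots> = (F (Suc n) 0 \<oplus> (\<Oplus>j\<in>{..n}. F j (Suc n - j))) \<oplus> (\<Oplus>k\<in>{..n}. \<Oplus>j\<in>{..k}. F j (k - j))"
    unfolding * by (rule a_assoc[symmetric]) (auto intro!: finsum_closed F)
  also have "F (Suc n) 0 \<oplus> (\<Oplus>j\<in>{..n}. F j (Suc n - j)) = (\<Oplus>j\<in>{..Suc n}. F j (Suc n - j))"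
    by (subst finsum_Suc) (auto simp: F Pi_def)
  also have "\<dots> \<oplus> (\<Oplus>k\<in>{..n}. \<Oplus>j\<in>{..k}. F j (k - j)) = (\<Oplus>k\<in>{..Suc n}. \<Oplus>j\<in>{..k}. F j (k - j))"
    by (rule finsum_Suc[symmetric]) (auto intro!: finsum_closed F)
  finally show ?case by (rule sym)
qed

lemma free_alg_simps:
  "\<zero>\<^bsub>free_alg R S\<^esub> = (\<lambda>w. \<zero>\<^bsub>R\<^esub>)"
  "\<one>\<^bsub>free_alg R S\<^esub> = (\<lambda>w. if w = [] then \<one>\<^bsub>R\<^esub> else \<zero>\<^bsub>R\<^esub>)"
  "f \<oplus>\<^bsub>free_alg R S\<^esub> g = (\<lambda>w. f w \<oplus>\<^bsub>R\<^esub> g w)"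
  "f \<otimes>\<^bsub>free_alg R S\<^esub> g = (\<lambda>w. \<Oplus>\<^bsub>R\<^esub>k\<in>{..length w}. f (take k w) \<otimes>\<^bsub>R\<^esub> g (drop k w))"
  "r \<odot>\<^bsub>free_alg R S\<^esub> f = (\<lambda>w. r \<otimes>\<^bsub>R\<^esub> f w)"
  by (simp_all add: free_alg_def)

context ring begin

lemma free_alg_closed_val: "f \<in> carrier (free_alg R S) \<Longrightarrow> f w \<in> carrier R"
  by (simp add: free_alg_def)

lemma free_alg_fin: "f \<in> carrier (free_alg R S) \<Longrightarrow> finite {w. f w \<noteq> \<zero>}"
  by (simp add: free_alg_def)

lemma free_alg_letters: "f \<in> carrier (free_alg R S) \<Longrightarrow> f w \<noteq> \<zero> \<Longrightarrow> w \<in> lists S"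
  by (auto simp: free_alg_def)

lemma free_algI:
  assumes "\<And>w. f w \<in> carrier R" "\<And>w. f w \<noteq> \<zero> \<Longrightarrow> w \<in> W" "finite W" "W \<subseteq> lists S"
  shows "f \<in> carrier (free_alg R S)"
proof -
  have "{w. f w \<noteq> \<zero>} \<subseteq> W" using assms(2) by auto
  moreover from this have "finite {w. f w \<noteq> \<zero>}" using assms(3) by (rule finite_subset)
  ultimately show ?thesis using assms(1,4) by (simp add: free_alg_def subset_trans[OF _ assms(4)])
qed

lemma free_alg_mult_closed:
  assumes f: "f \<in> carrier (free_alg R S)" and g: "g \<in> carrier (free_alg R S)"
  shows "f \<otimes>\<^bsub>free_alg R S\<^esub> g \<in> carrier (free_alg R S)"
proof (rule free_algI)
  note [simp] = free_alg_closed_val[OF f] free_alg_closed_val[OF g]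
  let ?W = "(\<lambda>(u, v). u @ v) ` ({w. f w \<noteq> \<zero>} \<times> {w. g w \<noteq> \<zero>})"
  show "finite ?W" using f g by (simp add: free_alg_fin)
  show "?W \<subseteq> lists S" using f g by (auto dest!: free_alg_letters)
  show "(f \<otimes>\<^bsub>free_alg R S\<^esub> g) w \<in> carrier R" for w
    using f g by (auto simp: free_alg_simps intro!: finsum_closed)
  show "w \<in> ?W" if nz: "(f \<otimes>\<^bsub>free_alg R S\<^esub> g) w \<noteq> \<zero>" for w
  proof (rule ccontr)
    assume nw: "w \<notin> ?W"
    have "f (take k w) \<otimes> g (drop k w) = \<zero>" for k
    proof -
      have "f (take k w) = \<zero> \<or> g (drop k w) = \<zero>"
        using nw by (force simp: image_iff)
      then show ?thesis using f g by auto
    qed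
    then show False using nz by (simp add: free_alg_simps)
  qed
qed

lemma free_alg_abelian_group: "abelian_group (free_alg R S)"
proof (rule abelian_groupI)
  fix f g h assume f: "f \<in> carrier (free_alg R S)" and g: "g \<in> carrier (free_alg R S)"
    and h: "h \<in> carrier (free_alg R S)"
  note [simp] = free_alg_closed_val[OF f] free_alg_closed_val[OF g] free_alg_closed_val[OF h]
  show "f \<oplus>\<^bsub>free_alg R S\<^esub> g \<in> carrier (free_alg R S)"
    by (rule free_algI[where W = "{w. f w \<noteq> \<zero>} \<union> {w. g w \<noteq> \<zero>}"])
      (use f g in \<open>auto simp: free_alg_simps free_alg_fin dest: free_alg_letters\<close>)
  show "f \<oplus>\<^bsub>free_alg R S\<^esub> g \<oplus>\<^bsub>free_alg R S\<^esub> h = f \<oplus>\<^bsub>free_alg R S\<^esub> (g \<oplus>\<^bsub>free_alg R S\<^esub> h)"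
    using f g h by (simp add: free_alg_simps a_assoc)
  show "f \<oplus>\<^bsub>free_alg R S\<^esub> g = g \<oplus>\<^bsub>free_alg R S\<^esub> f"
    using f g by (simp add: free_alg_simps a_comm)
  show "\<zero>\<^bsub>free_alg R S\<^esub> \<oplus>\<^bsub>free_alg R S\<^esub> f = f" using f by (simp add: free_alg_simps)
  have "(\<lambda>w. \<ominus> f w) \<in> carrier (free_alg R S)"
    by (rule free_algI[where W = "{w. f w \<noteq> \<zero>}"])
      (use f in \<open>auto simp: free_alg_fin dest: free_alg_letters\<close>)
  moreover have "(\<lambda>w. \<ominus> f w) \<oplus>\<^bsub>free_alg R S\<^esub> f = \<zero>\<^bsub>free_alg R S\<^esub>"
    using f by (simp add: free_alg_simps l_neg)
  then show "\<exists>g\<in>carrier (free_alg R S). g \<oplus>\<^bsub>free_alg R S\<^esub> f = \<zero>\<^bsub>free_alg R S\<^esub>" by (rule bexI[where x = "\<lambda>w. \<ominus> f w"]) fact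
next
  show "\<zero>\<^bsub>free_alg R S\<^esub> \<in> carrier (free_alg R S)" by (simp add: free_alg_def)
qed

lemma free_alg_monoid: "monoid (free_alg R S)"
proof (rule monoidI)
  fix f g h assume f: "f \<in> carrier (free_alg R S)" and g: "g \<in> carrier (free_alg R S)"
    and h: "h \<in> carrier (free_alg R S)"
  note [simp] = free_alg_closed_val[OF f] free_alg_closed_val[OF g] free_alg_closed_val[OF h]
  show "f \<otimes>\<^bsub>free_alg R S\<^esub> g \<in> carrier (free_alg R S)" using f g by (rule free_alg_mult_closed)
  show "f \<otimes>\<^bsub>free_alg R S\<^esub> g \<otimes>\<^bsub>free_alg R S\<^esub> h = f \<otimes>\<^bsub>free_alg R S\<^esub> (g \<otimes>\<^bsub>free_alg R S\<^esub> h)"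
  proof
    fix w
    define F where "F j m = f (take j w) \<otimes> g (take m (drop j w)) \<otimes> h (drop (j + m) w)" for j m
    have F: "F i j \<in> carrier R" for i j using f g h by (simp add: F_def)
    have "(f \<otimes>\<^bsub>free_alg R S\<^esub> g \<otimes>\<^bsub>free_alg R S\<^esub> h) w
        = (\<Oplus>k\<in>{..length w}. \<Oplus>j\<in>{..k}. F j (k - j))"
      unfolding free_alg_simps
    proof (rule finsum_cong')
      fix k assume k: "k \<in> {..length w}"
      have "(\<Oplus>j\<in>{..length (take k w)}. f (take j (take k w)) \<otimes> g (drop j (take k w))) \<otimes> h (drop k w)
         = (\<Oplus>j\<in>{..k}. f (take j (take k w)) \<otimes> g (drop j (take k w)) \<otimes> h (drop k w))"
        using k f g h by (simp add: finsum_ldistr Pi_def min_absorb2)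
      also have "\<dots> = (\<Oplus>j\<in>{..k}. F j (k - j))"
        by (rule finsum_cong') (use f g h in \<open>auto simp: F_def min_absorb1 drop_take\<close>)
      finally show "(\<Oplus>j\<in>{..length (take k w)}. f (take j (take k w)) \<otimes> g (drop j (take k w))) \<otimes> h (drop k w) = (\<Oplus>j\<in>{..k}. F j (k - j))" .
    qed (auto intro!: finsum_closed F)
    also have "\<dots> = (\<Oplus>j\<in>{..length w}. \<Oplus>m\<in>{..length w - j}. F j m)"
      by (rule finsum_triangle) (rule F)
    also have "\<dots> = (f \<otimes>\<^bsub>free_alg R S\<^esub> (g \<otimes>\<^bsub>free_alg R S\<^esub> h)) w"
      unfolding free_alg_simps
    proof (rule finsum_cong')
      fix j assume j: "j \<in> {..length w}"
      show "(\<Oplus>m\<in>{..length w - j}. F j m) = f (take j w) \<otimes>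
         (\<Oplus>k\<in>{..length (drop j w)}. g (take k (drop j w)) \<otimes> h (drop k (drop j w)))"
        using f g h by (simp add: finsum_rdistr Pi_def F_def m_assoc add.commute)
    qed (use f g h in \<open>auto intro!: finsum_closed m_closed\<close>)
    finally show "(f \<otimes>\<^bsub>free_alg R S\<^esub> g \<otimes>\<^bsub>free_alg R S\<^esub> h) w = (f \<otimes>\<^bsub>free_alg R S\<^esub> (g \<otimes>\<^bsub>free_alg R S\<^esub> h)) w" .
  qed
  show "\<one>\<^bsub>free_alg R S\<^esub> \<otimes>\<^bsub>free_alg R S\<^esub> f = f"
  proof
    fix w
    have "(\<one>\<^bsub>free_alg R S\<^esub> \<otimes>\<^bsub>free_alg R S\<^esub> f) w = (\<Oplus>k\<in>{..length w}. if k = 0 then f w else \<zero>)"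
      unfolding free_alg_simps by (rule finsum_cong') (use f in auto)
    then show "(\<one>\<^bsub>free_alg R S\<^esub> \<otimes>\<^bsub>free_alg R S\<^esub> f) w = f w"
      using f add.finprod_singleton_swap[of 0 "{..length w}" "\<lambda>_. f w"] by simp
  qed
  show "f \<otimes>\<^bsub>free_alg R S\<^esub> \<one>\<^bsub>free_alg R S\<^esub> = f"
  proof
    fix w
    have "(f \<otimes>\<^bsub>free_alg R S\<^esub> \<one>\<^bsub>free_alg R S\<^esub>) w = (\<Oplus>k\<in>{..length w}. if length w = k then f w else \<zero>)"
      unfolding free_alg_simps by (rule finsum_cong') (use f in auto)
    then show "(f \<otimes>\<^bsub>free_alg R S\<^esub> \<one>\<^bsub>free_alg R S\<^esub>) w = f w"
      using f add.finprod_singleton[of "length w" "{..length w}" "\<lambda>_. f w"] by simp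
  qed
next
  show "\<one>\<^bsub>free_alg R S\<^esub> \<in> carrier (free_alg R S)"
    by (rule free_algI[where W = "{[]}"]) (auto simp: free_alg_simps split: if_splits)
qed

lemma free_alg_ring: "ring (free_alg R S)"
proof (rule ringI[OF free_alg_abelian_group free_alg_monoid])
  fix f g h assume f: "f \<in> carrier (free_alg R S)" and g: "g \<in> carrier (free_alg R S)"
    and h: "h \<in> carrier (free_alg R S)"
  note [simp] = free_alg_closed_val[OF f] free_alg_closed_val[OF g] free_alg_closed_val[OF h]
  show "(f \<oplus>\<^bsub>free_alg R S\<^esub> g) \<otimes>\<^bsub>free_alg R S\<^esub> h
      = f \<otimes>\<^bsub>free_alg R S\<^esub> h \<oplus>\<^bsub>free_alg R S\<^esub> g \<otimes>\<^bsub>free_alg R S\<^esub> h"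
    using f g h by (simp add: free_alg_simps l_distr finsum_addf Pi_def)
  show "h \<otimes>\<^bsub>free_alg R S\<^esub> (f \<oplus>\<^bsub>free_alg R S\<^esub> g)
      = h \<otimes>\<^bsub>free_alg R S\<^esub> f \<oplus>\<^bsub>free_alg R S\<^esub> h \<otimes>\<^bsub>free_alg R S\<^esub> g"
    using f g h by (simp add: free_alg_simps r_distr finsum_addf Pi_def)
qed

lemma letter_closed: "s \<in> S \<Longrightarrow> letter R s \<in> carrier (free_alg R S)"
  by (rule free_algI[where W = "{[s]}"]) (auto simp: letter_def split: if_splits)

lemma free_alg_const_coeff:
  "(\<lambda>f. f []) \<in> ring_hom (free_alg R S) R"
  by (rule ring_hom_memI) (simp_all add: free_alg_simps free_alg_closed_val)

end


section \<open>The Temperley--Lieb algebra, its augmentation and modules\<close>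

lemma quot_alg_simps:
  "carrier (quot_alg A I) = carrier (A Quot I)"
  "x \<otimes>\<^bsub>quot_alg A I\<^esub> y = x \<otimes>\<^bsub>A Quot I\<^esub> y" "\<one>\<^bsub>quot_alg A I\<^esub> = \<one>\<^bsub>A Quot I\<^esub>"
  "x \<oplus>\<^bsub>quot_alg A I\<^esub> y = x \<oplus>\<^bsub>A Quot I\<^esub> y" "\<zero>\<^bsub>quot_alg A I\<^esub> = \<zero>\<^bsub>A Quot I\<^esub>"
  by (simp_all add: quot_alg_def)

lemma ring_quot_alg: "ideal I A \<Longrightarrow> ring (quot_alg A I)"
proof -
  assume "ideal I A"
  then interpret Q: ring "A Quot I" by (rule ideal.quotient_is_ring)
  show ?thesis
  proof (rule ringI)
    show "abelian_group (quot_alg A I)"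
      by (rule abelian_groupI) (auto simp: quot_alg_simps Q.a_ac intro: Q.l_neg)
    show "monoid (quot_alg A I)"
      by (rule monoidI) (auto simp: quot_alg_simps Q.m_assoc)
  qed (auto simp: quot_alg_simps Q.l_distr Q.r_distr)
qed

context ring begin

lemma TL_relators_closed:
  assumes a: "a \<in> carrier R"
  shows "TL_relators R n a \<subseteq> carrier (free_alg R {1..<n})"
proof -
  interpret F: ring "free_alg R {1..<n}" by (rule free_alg_ring)
  have s: "a \<odot>\<^bsub>free_alg R {1..<n}\<^esub> letter R i \<in> carrier (free_alg R {1..<n})" if "i \<in> {1..<n}" for i
    by (rule free_algI[where W = "{[i]}"]) (use that a in \<open>auto simp: free_alg_simps letter_def split: if_splits\<close>)
  show ?thesis
    using s letter_closed[of _ "{1..<n}"] unfolding TL_relators_def Let_def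
    by (auto intro!: F.minus_closed F.m_closed simp del: One_nat_def)
qed

lemma TL_ideal_ideal: "a \<in> carrier R \<Longrightarrow> ideal (TL_ideal R n a) (free_alg R {1..<n})"
  unfolding TL_ideal_def by (rule ring.genideal_ideal[OF free_alg_ring TL_relators_closed])

lemma TL_ring: "a \<in> carrier R \<Longrightarrow> ring (TL R n a)"
  unfolding TL_def by (rule ring_quot_alg[OF TL_ideal_ideal])

lemma const_ideal: "ideal {f \<in> carrier (free_alg R S). f [] = \<zero>} (free_alg R S)"
proof -
  interpret h: ring_hom_ring "free_alg R S" R "\<lambda>f. f []"
    by (rule ring_hom_ringI2[OF free_alg_ring ring_axioms free_alg_const_coeff])
  have "a_kernel (free_alg R S) R (\<lambda>f. f []) = {f \<in> carrier (free_alg R S). f [] = \<zero>}"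
    unfolding a_kernel_def kernel_def by simp
  then show ?thesis using h.kernel_is_ideal by (rule subst)
qed

lemma TL_relator_const:
  assumes a: "a \<in> carrier R" and x: "x \<in> TL_relators R n a" shows "x [] = \<zero>"
proof -
  interpret F: ring "free_alg R {1..<n}" by (rule free_alg_ring)
  interpret h: ring_hom_ring "free_alg R {1..<n}" R "\<lambda>f. f []"
    by (rule ring_hom_ringI2[OF free_alg_ring ring_axioms free_alg_const_coeff])
  have s: "a \<odot>\<^bsub>free_alg R {1..<n}\<^esub> letter R i \<in> carrier (free_alg R {1..<n})" if "i \<in> {1..<n}" for i
    by (rule free_algI[where W = "{[i]}"]) (use that a in \<open>auto simp: free_alg_simps letter_def split: if_splits\<close>)
  have l: "letter R i [] = \<zero>" for i by (simp add: letter_def)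
  have sl: "(a \<odot>\<^bsub>free_alg R {1..<n}\<^esub> letter R i) [] = \<zero>" for i
    using a by (simp add: letter_def free_alg_simps)
  note c = letter_closed[of _ "{1..<n}"]
  note d = F.minus_eq
  from x show ?thesis
    unfolding TL_relators_def Let_def
    by (elim UnE CollectE exE conjE) (simp_all add: d c s l sl del: One_nat_def atLeastLessThan_iff)
qed

lemma TL_aug_coset:
  assumes a: "a \<in> carrier R" and f: "f \<in> carrier (free_alg R {1..<n})"
  shows "TL_aug (TL_ideal R n a +>\<^bsub>free_alg R {1..<n}\<^esub> f) = f []"
proof -
  interpret F: ring "free_alg R {1..<n}" by (rule free_alg_ring)
  interpret I: ideal "TL_ideal R n a" "free_alg R {1..<n}" by (rule TL_ideal_ideal[OF a])
  have sub: "TL_ideal R n a \<subseteq> {f \<in> carrier (free_alg R {1..<n}). f [] = \<zero>}"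
    unfolding TL_ideal_def
    by (rule F.genideal_minimal[OF const_ideal]) (use TL_relators_closed[OF a] TL_relator_const[OF a] in auto)
  have "(\<lambda>f. f []) ` (TL_ideal R n a +>\<^bsub>free_alg R {1..<n}\<^esub> f) = {f []}"
  proof (intro Set.set_eqI iffI)
    fix y assume "y \<in> (\<lambda>f. f []) ` (TL_ideal R n a +>\<^bsub>free_alg R {1..<n}\<^esub> f)"
    then obtain h where h: "h \<in> TL_ideal R n a" "y = (h \<oplus>\<^bsub>free_alg R {1..<n}\<^esub> f) []"
      unfolding a_r_coset_def' by blast
    have "h [] = \<zero>" using sub h(1) by blast
    then show "y \<in> {f []}"
      using h(2) free_alg_closed_val[OF f] by (simp add: free_alg_simps)
  next
    fix y assume "y \<in> {f []}"
    then show "y \<in> (\<lambda>f. f []) ` (TL_ideal R n a +>\<^bsub>free_alg R {1..<n}\<^esub> f)"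
      using I.a_rcos_self[OF f] by (auto intro: rev_image_eqI)
  qed
  then show ?thesis by (simp add: TL_aug_def)
qed

lemma TL_carrier_cases:
  assumes "X \<in> carrier (TL R n a)"
  obtains f where "f \<in> carrier (free_alg R {1..<n})" "X = TL_ideal R n a +>\<^bsub>free_alg R {1..<n}\<^esub> f"
  using assms by (auto simp: TL_def quot_alg_simps FactRing_simps)

lemma TL_aug_hom:
  assumes a: "a \<in> carrier R"
  shows "TL_aug \<in> ring_hom (TL R n a) R"
proof -
  interpret F: ring "free_alg R {1..<n}" by (rule free_alg_ring)
  interpret I: ideal "TL_ideal R n a" "free_alg R {1..<n}" by (rule TL_ideal_ideal[OF a])
  interpret q: ring_hom_ring "free_alg R {1..<n}" "free_alg R {1..<n} Quot TL_ideal R n a"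
      "(+>\<^bsub>free_alg R {1..<n}\<^esub>) (TL_ideal R n a)"
    by (rule I.rcos_ring_hom_ring)
  interpret h: ring_hom_ring "free_alg R {1..<n}" R "\<lambda>f. f []"
    by (rule ring_hom_ringI2[OF free_alg_ring ring_axioms free_alg_const_coeff])
  note aug = TL_aug_coset[OF a]
  show ?thesis
  proof (rule ring_hom_memI)
    fix X assume "X \<in> carrier (TL R n a)"
    then show "TL_aug X \<in> carrier R" by (elim TL_carrier_cases) (simp add: aug del: One_nat_def)
  next
    fix X Y assume "X \<in> carrier (TL R n a)" "Y \<in> carrier (TL R n a)"
    then obtain f g where f: "f \<in> carrier (free_alg R {1..<n})" "X = TL_ideal R n a +>\<^bsub>free_alg R {1..<n}\<^esub> f"
      and g: "g \<in> carrier (free_alg R {1..<n})" "Y = TL_ideal R n a +>\<^bsub>free_alg R {1..<n}\<^esub> g"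
      by (metis TL_carrier_cases)
    show "TL_aug (X \<otimes>\<^bsub>TL R n a\<^esub> Y) = TL_aug X \<otimes> TL_aug Y"
      unfolding TL_def quot_alg_simps f(2) g(2) q.hom_mult[OF f(1) g(1), symmetric]
        aug[OF f(1)] aug[OF g(1)] aug[OF F.m_closed[OF f(1) g(1)]]
      by (rule h.hom_mult[OF f(1) g(1)])
    show "TL_aug (X \<oplus>\<^bsub>TL R n a\<^esub> Y) = TL_aug X \<oplus> TL_aug Y"
      unfolding TL_def quot_alg_simps f(2) g(2) q.hom_add[OF f(1) g(1), symmetric]
        aug[OF f(1)] aug[OF g(1)] aug[OF F.a_closed[OF f(1) g(1)]]
      by (rule h.hom_add[OF f(1) g(1)])
  next
    show "TL_aug \<one>\<^bsub>TL R n a\<^esub> = \<one>"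
      unfolding TL_def quot_alg_simps q.hom_one[symmetric] aug[OF F.one_closed] by (rule h.hom_one)
  qed
qed

lemma TL_aug_gen: "a \<in> carrier R \<Longrightarrow> i \<in> {1..<n} \<Longrightarrow> TL_aug (TL_gen R n a i) = \<zero>"
  unfolding TL_gen_def by (subst TL_aug_coset[OF _ letter_closed]) (auto simp: letter_def)

end

lemma TL_trivial_module:
  assumes R: "cring R" and a: "a \<in> carrier R"
  shows "left_module (TL R n a) (TL_trivial R)" "right_module (TL R n a) (TL_trivial R)"
proof -
  interpret R: cring R by (rule R)
  interpret T: ring "TL R n a" by (rule R.TL_ring[OF a])
  interpret e: ring_hom_ring "TL R n a" R TL_aug
    by (rule ring_hom_ringI2[OF T.ring_axioms R.ring_axioms R.TL_aug_hom[OF a]])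
  have ag: "abelian_group (TL_trivial R)"
    by (rule abelian_groupI) (auto simp: TL_trivial_def R.a_ac intro: R.l_neg)
  show "left_module (TL R n a) (TL_trivial R)"
    using T.ring_axioms ag
    by (rule left_module.intro, unfold_locales) (auto simp: TL_trivial_def R.l_distr R.r_distr R.m_assoc)
  show "right_module (TL R n a) (TL_trivial R)"
    using T.ring_axioms ag
    by (rule right_module.intro, unfold_locales) (auto simp: TL_trivial_def R.l_distr R.r_distr R.m_ac)
qed

lemma Cup_left_module:
  assumes R: "cring R" and a: "a \<in> carrier R" and M: "M \<subseteq> {1..<n}"
  shows "left_module (TL R n a) (Cup R n a M)"
proof -
  interpret R: cring R by (rule R)
  interpret T: ring "TL R n a" by (rule R.TL_ring[OF a])
  interpret I: ideal "TL_ideal R n a" "free_alg R {1..<n}" by (rule R.TL_ideal_ideal[OF a])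
  have g: "TL_gen R n a i \<in> carrier (TL R n a)" if "i \<in> {1..<n}" for i
    using R.letter_closed[OF that] unfolding TL_gen_def TL_def quot_alg_simps FactRing_simps by auto
  have "foldr (\<lambda>i X. TL_gen R n a i \<otimes>\<^bsub>TL R n a\<^esub> X) xs \<one>\<^bsub>TL R n a\<^esub> \<in> carrier (TL R n a)"
    if "set xs \<subseteq> {1..<n}" for xs using that by (induct xs) (auto intro!: T.m_closed g)
  then have p: "TL_prod R n a M \<in> carrier (TL R n a)"
    unfolding TL_prod_def using M finite_subset[OF M] by auto
  have ag: "abelian_group (Cup R n a M)"
  proof (rule abelian_groupI)
    fix x assume "x \<in> carrier (Cup R n a M)"
    then obtain y where y: "y \<in> carrier (TL R n a)" "x = y \<otimes>\<^bsub>TL R n a\<^esub> TL_prod R n a M"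
      by (auto simp: Cup_def Let_def)
    show "\<exists>y\<in>carrier (Cup R n a M). y \<oplus>\<^bsub>Cup R n a M\<^esub> x = \<zero>\<^bsub>Cup R n a M\<^esub>"
      by (rule bexI[where x = "(\<ominus>\<^bsub>TL R n a\<^esub> y) \<otimes>\<^bsub>TL R n a\<^esub> TL_prod R n a M"])
        (use y p in \<open>simp_all add: Cup_def Let_def T.l_neg T.l_distr[symmetric] del: T.l_minus, blast\<close>)
  qed (auto simp: Cup_def Let_def p T.a_ac simp flip: T.l_distr intro: exI[of _ "\<zero>\<^bsub>TL R n a\<^esub>"])
  have sub: "carrier (Cup R n a M) \<subseteq> carrier (TL R n a)"
    using p by (auto simp: Cup_def Let_def)
  have ops: "x \<oplus>\<^bsub>Cup R n a M\<^esub> y = x \<oplus>\<^bsub>TL R n a\<^esub> y" "x \<odot>\<^bsub>Cup R n a M\<^esub> y = x \<otimes>\<^bsub>TL R n a\<^esub> y" for x y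
    by (simp_all add: Cup_def Let_def)
  show ?thesis
    using T.ring_axioms ag
  proof (rule left_module.intro, unfold_locales)
    fix b x assume b: "b \<in> carrier (TL R n a)" and "x \<in> carrier (Cup R n a M)"
    then obtain y where y: "y \<in> carrier (TL R n a)" "x = y \<otimes>\<^bsub>TL R n a\<^esub> TL_prod R n a M"
      by (auto simp: Cup_def Let_def)
    have "b \<otimes>\<^bsub>TL R n a\<^esub> x = (b \<otimes>\<^bsub>TL R n a\<^esub> y) \<otimes>\<^bsub>TL R n a\<^esub> TL_prod R n a M"
      using b y p by (simp add: T.m_assoc)
    then show "b \<odot>\<^bsub>Cup R n a M\<^esub> x \<in> carrier (Cup R n a M)"
      unfolding ops using T.m_closed[OF b y(1)] by (auto simp: Cup_def Let_def)
  qed (use sub in \<open>simp_all add: ops subset_iff T.l_distr T.r_distr T.m_assoc\<close>)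
qed

end

(*
  Write A for the algebra and U_M for the product of the U_i with i in M.  For a pair B <= Y of
  left ideals, Tor(1, Y/B) is computed by chains with values in Y modulo chains with values in B.
  Let M consist of pairwise distant letters, all of them >= k + 2, let Y = A U_M, and let S_k be
  the sum of the A U_i U_M with i <= k.  The key fact is

    A U_k U_M  meets  S_(k-1)  in the sum of the A U_i U_k U_M with i <= k - 2,

  so S_k is built from S_(k-1) by gluing on a pair of the same shape.  If some strand p >= k + 2 is
  not covered by M, then A U_M is generated by an idempotent on which the augmentation vanishes
  (if M is nonempty), and induction on k shows that Y/S_k has no Tor.  For M = {p+1, p+3, ..., n-1}
  with p even, the long exact sequence of S_(p-2) <= S_(p-1) <= Y therefore shifts degrees by one and
  replaces M by M with p - 1 added.  Starting from A/S_(n-1), the trivial module, n/2 such steps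
  lead to A U_M with M = {1, 3, ..., n-1}.

  For the key fact, A is graded by any invariant of words under the relations.  The invariant used
  is the lower half of the Temperley-Lieb diagram of a word: it tells which i carry a cup, and a word
  that cannot be shortened ends, up to commutations, in any set of letters at which it has cups.
*)
theory Submission
  imports Defs
begin

text \<open>No basis of \<open>A\<close> is ever used, nor its identification with the diagram
  algebra. Two facts about words stand in for them: the relations preserve the half diagram, so
  restricting a polynomial to the words with prescribed half diagrams respects the ideal of
  relations; and every word is a scalar multiple of a minimal one with the same half diagram. Closed
  loops leave no trace in a half diagram, so \<open>a\<close> may be arbitrary.

  The idempotents are found without inverting \<open>a\<close>. By U_i U_j U_i = U_i for neighbours
  i, j, it is enough to give each letter of M a suitable neighbouring letter, and an uncovered
  strand leaves room for such a choice. For M = {1, 3, ..., n-1} every strand is covered, and the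
  shifting ends.

  The exceptional spot is degree 0 of the first shift, where Y = A and Y/S_(n-2) has the trivial
  module as Tor_0. What holds there is weaker than vanishing: A U_(n-1) acts as zero on the trivial
  module, so the map induced by its inclusion is zero in degree 0, and this suffices for the
  connecting map to be onto.\<close>

section \<open>Half diagrams\<close>

text \<open>The lower half of a Temperley--Lieb diagram is encoded as an involution of the boundary points
  whose fixed points are the through strands; \<open>cupg j k\<close> is the effect of multiplying by the
  generator with a cup at \<open>{j, k}\<close>.\<close>

definition cupg :: "'a \<Rightarrow> 'a \<Rightarrow> ('a \<Rightarrow> 'a) \<Rightarrow> 'a \<Rightarrow> 'a" where
  "cupg j k \<sigma> x = (if x = j then k else if x = k then j
     else if \<sigma> x = j then (if \<sigma> k = k then x else \<sigma> k)
     else if \<sigma> x = k then (if \<sigma> j = j then x else \<sigma> j)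
     else \<sigma> x)"

text \<open>The three points are arbitrary and distinct, without any order, so that the one identity
  yields U_i U_j U_i = U_i for j = i + 1 and, after permuting the points, for j = i - 1.\<close>

lemma cupg_near:
  assumes inv: "\<And>x. \<sigma> (\<sigma> x) = x" and d: "i \<noteq> k" "i \<noteq> l" "k \<noteq> l"
  shows "cupg i k (cupg k l (cupg i k \<sigma>)) x = cupg i k \<sigma> x"
proof -
  have I: "\<sigma> u = v \<Longrightarrow> \<sigma> v = u" for u v using inv by metis
  show ?thesis
    using d I[of x i] I[of x k] I[of x l] I[of i k] I[of i l] I[of k l] inv[of i] inv[of k] inv[of l]
    unfolding cupg_def by (smt (verit))
qed

lemma cupg_far:
  assumes inv: "\<And>x. \<sigma> (\<sigma> x) = x" and d: "i \<noteq> j" "i \<noteq> k" "i \<noteq> l" "j \<noteq> k" "j \<noteq> l" "k \<noteq> l"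
  shows "cupg i k (cupg j l \<sigma>) x = cupg j l (cupg i k \<sigma>) x"
proof -
  have I: "\<sigma> u = v \<Longrightarrow> \<sigma> v = u" for u v using inv by metis
  show ?thesis
  proof (cases "x = i \<or> x = j \<or> x = k \<or> x = l")
    case True then show ?thesis using d unfolding cupg_def by (elim disjE) simp_all
  next
    case False
    consider "\<sigma> x = i" "\<sigma> i = x" | "\<sigma> x = j" "\<sigma> j = x" | "\<sigma> x = k" "\<sigma> k = x" | "\<sigma> x = l" "\<sigma> l = x" | "\<sigma> x \<notin> {i,j,k,l}"
      using inv[of x] by auto
    then show ?thesis using False d I[of i j] I[of i k] I[of i l] I[of j k] I[of j l] I[of k l] inv[of i] inv[of j] inv[of k] inv[of l]
      unfolding cupg_def insert_iff de_Morgan_disj empty_iff by cases (smt (verit))+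
  qed
qed

text \<open>Points range over all integers instead of 1, ..., n: there are no boundary cases, and
  the mirror image x -> 1 - x can be formed without reference to \<open>n\<close>.\<close>

abbreviation act :: "int \<Rightarrow> (int \<Rightarrow> int) \<Rightarrow> int \<Rightarrow> int" where
  "act j \<equiv> cupg j (j + 1)"

text \<open>Under an arc, arcs stay nested, and by the last conjunct no through strand starts
  there.\<close>

definition planar :: "(int \<Rightarrow> int) \<Rightarrow> bool" where
  "planar \<sigma> \<longleftrightarrow> (\<forall>x. \<sigma> (\<sigma> x) = x) \<and>
     (\<forall>x y. x < y \<and> y < \<sigma> x \<longrightarrow> x < \<sigma> y \<and> \<sigma> y < \<sigma> x \<and> \<sigma> y \<noteq> y)"

lemma planar_id: "planar (\<lambda>x. x)"
  by (simp add: planar_def)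

lemma planar_inv: "planar \<sigma> \<Longrightarrow> \<sigma> (\<sigma> x) = x"
  by (simp add: planar_def)

lemma planar_nest: "planar \<sigma> \<Longrightarrow> x < y \<Longrightarrow> y < \<sigma> x \<Longrightarrow> x < \<sigma> y \<and> \<sigma> y < \<sigma> x \<and> \<sigma> y \<noteq> y"
  by (simp add: planar_def)

lemma act_inv:
  assumes "planar \<sigma>" shows "act j \<sigma> (act j \<sigma> x) = x"
proof -
  note i = planar_inv[OF assms]
  have "\<sigma> x = \<sigma> y \<longleftrightarrow> x = y" for x y using i by metis
  then show ?thesis using i[of x] i[of j] i[of "j+1"] unfolding cupg_def
    by (smt (verit))
qed

text \<open>Away from \<open>j\<close> and \<open>j + 1\<close> only the partners of these two
  points change. If both have partners elsewhere, the two arcs merge into one; the cases are the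
  possible positions of these arcs relative to the new cup.\<close>

lemma planar_act:
  assumes P: "planar \<sigma>" shows "planar (act j \<sigma>)"
  unfolding planar_def
proof (intro conjI allI impI; (elim conjE)?)
  fix x show "act j \<sigma> (act j \<sigma> x) = x" by (rule act_inv[OF P])
next
  fix x y assume h: "x < y" "y < act j \<sigma> x"
  note i = planar_inv[OF P] and n = planar_nest[OF P]
  have x: "x \<noteq> j" "x \<noteq> j + 1" using h unfolding cupg_def by auto
  have I: "\<sigma> u = v \<Longrightarrow> \<sigma> v = u" for u v using i by metis
  have xc: "\<sigma> x \<noteq> j \<and> \<sigma> x \<noteq> j + 1 \<and> act j \<sigma> x = \<sigma> x
      \<or> \<sigma> j = x \<and> \<sigma> x = j \<and> \<sigma> (j + 1) \<noteq> j + 1 \<and> act j \<sigma> x = \<sigma> (j + 1)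
      \<or> \<sigma> (j + 1) = x \<and> \<sigma> x = j + 1 \<and> \<sigma> j \<noteq> j \<and> act j \<sigma> x = \<sigma> j"
    using h x i[of x] unfolding cupg_def by (auto split: if_splits)
  have yc: "y = j \<and> act j \<sigma> y = j + 1 \<or> y = j + 1 \<and> act j \<sigma> y = j
      \<or> y \<noteq> j \<and> y \<noteq> j + 1 \<and> \<sigma> y \<noteq> j \<and> \<sigma> y \<noteq> j + 1 \<and> act j \<sigma> y = \<sigma> y
      \<or> y \<noteq> j \<and> y \<noteq> j + 1 \<and> \<sigma> j = y \<and> \<sigma> y = j \<and> \<sigma> (j + 1) \<noteq> j + 1 \<and> act j \<sigma> y = \<sigma> (j + 1)
      \<or> y \<noteq> j \<and> y \<noteq> j + 1 \<and> \<sigma> j = y \<and> \<sigma> y = j \<and> \<sigma> (j + 1) = j + 1 \<and> act j \<sigma> y = y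
      \<or> y \<noteq> j \<and> y \<noteq> j + 1 \<and> \<sigma> (j + 1) = y \<and> \<sigma> y = j + 1 \<and> \<sigma> j \<noteq> j \<and> act j \<sigma> y = \<sigma> j
      \<or> y \<noteq> j \<and> y \<noteq> j + 1 \<and> \<sigma> (j + 1) = y \<and> \<sigma> y = j + 1 \<and> \<sigma> j = j \<and> act j \<sigma> y = y"
    using i[of y] unfolding cupg_def by auto
  from xc have *: "x < act j \<sigma> y \<and> act j \<sigma> y < act j \<sigma> x \<and> act j \<sigma> y \<noteq> y"
  proof (elim disjE conjE, goal_cases)
    case 1
    then show ?case
      using yc h x n[of x y] n[of x j] n[of x "j+1"] i[of j] i[of "j+1"] by smt
  next
    \<comment> \<open>Here \<open>x\<close> is the partner of \<open>j\<close>: two arcs side by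
      side become one arc that passes around the new cup.\<close>
    case 2
    then have "x < j \<and> j + 1 < \<sigma> (j + 1)"
      using h n[of x "\<sigma> (j + 1)"] n[of j "j + 1"] i[of "j + 1"] x by smt
    then show ?case
      using 2 yc h n[of x y] n[of "j + 1" y] i[of y] by smt
  next
    \<comment> \<open>Here \<open>x\<close> is the partner of \<open>j + 1\<close>: the two arcs are
      nested, both to the right or both to the left of the new cup.\<close>
    case 3
    then have "j + 1 < x \<or> x < j" using x by linarith
    then have "j + 1 < x \<and> x < \<sigma> j \<or> x < j \<and> x < \<sigma> j \<and> \<sigma> j < j"
      using 3 h n[of "j + 1" x] n[of "\<sigma> j" x] n[of j "j + 1"] n[of "j + 1" "\<sigma> j"] n[of j x]  i[of "j"] x by smt
    then show ?case
      using 3 yc h n[of x y] n[of "j" y] n[of x j] n[of "\<sigma> j" y] n[of j "j + 1"] n[of "j+1" y] n[of "j+1" "\<sigma> y"] n[of "\<sigma> j" "\<sigma> y"] i[of y] i[of j] by smt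
  qed
  show "x < act j \<sigma> y" "act j \<sigma> y < act j \<sigma> x" "act j \<sigma> y \<noteq> y" using * by auto
qed

lemma act_idem: "planar \<sigma> \<Longrightarrow> act i (act i \<sigma>) = act i \<sigma>"
  by (rule ext) (auto simp: cupg_def)

lemma act_far:
  assumes P: "planar \<sigma>" and ij: "\<bar>i - j\<bar> \<ge> 2"
  shows "act i (act j \<sigma>) = act j (act i \<sigma>)"
  by (rule ext, rule cupg_far) (use ij planar_inv[OF P] in auto)

lemma act_near:
  assumes P: "planar \<sigma>" and ij: "\<bar>i - j\<bar> = 1"
  shows "act i (act j (act i \<sigma>)) = act i \<sigma>"
proof -
  have sym: "cupg a b = cupg b a" for a b :: int
    by (intro ext) (auto simp: cupg_def)
  note n = cupg_near[of \<sigma>, OF planar_inv[OF P]]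
  have "j = i + 1 \<or> i = j + 1" using ij by auto
  then show ?thesis
  proof
    assume "j = i + 1"
    then show ?thesis using n[of i "i + 1" "i + 1 + 1"] by auto
  next
    assume j: "i = j + 1"
    show ?thesis using n[of "i + 1" i j] unfolding j sym[of "j + 1 + 1"] sym[of "j + 1" j] by auto
  qed
qed

definition st :: "int list \<Rightarrow> int \<Rightarrow> int" where
  "st w = foldl (\<lambda>\<sigma> j. act j \<sigma>) (\<lambda>x. x) w"

lemma st_Nil [simp]: "st [] = (\<lambda>x. x)"
  and st_snoc [simp]: "st (w @ [j]) = act j (st w)"
  by (simp_all add: st_def)

lemma planar_foldl: "planar \<sigma> \<Longrightarrow> planar (foldl (\<lambda>\<sigma> j. act j \<sigma>) \<sigma> w)"
  by (induction w arbitrary: \<sigma>) (auto simp: planar_act)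

lemma planar_st: "planar (st w)"
  unfolding st_def by (rule planar_foldl[OF planar_id])

lemma st_context: "st (x @ l) = st (x @ r) \<Longrightarrow> st (x @ l @ y) = st (x @ r @ y)"
  by (simp add: st_def)

lemma st_comm: "\<bar>i - j\<bar> \<ge> 2 \<Longrightarrow> st (x @ [i, j] @ y) = st (x @ [j, i] @ y)"
  by (rule st_context) (simp add: st_def act_far planar_foldl planar_id)

lemma st_idem: "st (x @ [i, i] @ y) = st (x @ [i] @ y)"
  by (rule st_context) (simp add: st_def act_idem planar_foldl planar_id)

lemma st_near: "\<bar>i - j\<bar> = 1 \<Longrightarrow> st (x @ [i, j, i] @ y) = st (x @ [i] @ y)"
  by (rule st_context) (simp add: st_def act_near planar_foldl planar_id)

section \<open>Words up to commutation of distant letters\<close>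

inductive ceq :: "int list \<Rightarrow> int list \<Rightarrow> bool" for u where
  refl: "ceq u u"
| step: "ceq u (x @ [i, j] @ y) \<Longrightarrow> \<bar>i - j\<bar> \<ge> 2 \<Longrightarrow> ceq u (x @ [j, i] @ y)"

lemma ceq_trans: "ceq v w \<Longrightarrow> ceq u v \<Longrightarrow> ceq u w"
  by (induction rule: ceq.induct) (simp, metis ceq.step)

lemma ceq_swap: "\<bar>i - j\<bar> \<ge> 2 \<Longrightarrow> ceq (x @ [i, j] @ y) (x @ [j, i] @ y)"
  by (rule ceq.step[OF ceq.refl])

lemma ceq_sym: "ceq u v \<Longrightarrow> ceq v u"
proof (induction rule: ceq.induct)
  case refl show ?case by (rule ceq.refl)
next
  case (step x i j y)
  have "ceq (x @ [j, i] @ y) (x @ [i, j] @ y)" using step.hyps(2) by (intro ceq_swap) auto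
  then show ?case using step.IH ceq_trans by blast
qed

lemma ceq_context: "ceq u v \<Longrightarrow> ceq (x @ u @ y) (x @ v @ y)"
proof (induction rule: ceq.induct)
  case (step x' i j y')
  then show ?case using ceq.step[of "x @ u @ y" "x @ x'" i j "y' @ y"] by simp
qed (rule ceq.refl)

lemma ceq_append1: "ceq u v \<Longrightarrow> ceq (u @ y) (v @ y)"
  using ceq_context[of u v "[]"] by simp

lemma ceq_append2: "ceq u v \<Longrightarrow> ceq (x @ u) (x @ v)"
  using ceq_context[of u v x "[]"] by simp

lemma ceq_st: "ceq u v \<Longrightarrow> st v = st u"
proof (induction rule: ceq.induct)
  case (step x i j y)
  then show ?case using st_comm[of i j x y] by simp
qed simp

lemma ceq_move: "\<forall>x\<in>set u. \<bar>x - m\<bar> \<ge> 2 \<Longrightarrow> ceq ([m] @ u) (u @ [m])"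
proof (induction u)
  case Nil show ?case by (simp add: ceq.refl)
next
  case (Cons a u)
  have "ceq ([m, a] @ u) ([a, m] @ u)"
    using Cons.prems ceq_swap[of m a "[]" u] by (simp add: abs_minus_commute)
  moreover have "ceq ([a] @ ([m] @ u)) ([a] @ (u @ [m]))"
    using Cons by (intro ceq_append2) simp
  ultimately show ?case using ceq_trans by fastforce
qed

section \<open>Minimal words\<close>

definition contractible :: "int list \<Rightarrow> bool" where
  "contractible w \<longleftrightarrow> (\<exists>x y i. w = x @ [i, i] @ y) \<or>
     (\<exists>x y i j. \<bar>i - j\<bar> = 1 \<and> w = x @ [i, j, i] @ y)"

text \<open>These are the reduced words of the fully commutative permutations.\<close>

definition minimal :: "int list \<Rightarrow> bool" where
  "minimal v \<longleftrightarrow> (\<forall>w. ceq v w \<longrightarrow> \<not> contractible w)"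

lemma minimal_ceq: "minimal v \<Longrightarrow> ceq v w \<Longrightarrow> minimal w"
  unfolding minimal_def using ceq_trans by blast

lemma contractible_context: "contractible v \<Longrightarrow> contractible (x @ v @ y)"
  unfolding contractible_def by (metis append.assoc)

lemma minimal_factor: "minimal (x @ v @ y) \<Longrightarrow> minimal v"
  unfolding minimal_def using ceq_context contractible_context by blast

lemma minimal_prefix: "minimal (v @ y) \<Longrightarrow> minimal v"
  using minimal_factor[of "[]"] by simp

lemma not_minimal_idem: "\<not> minimal (x @ [i, i] @ y)"
  unfolding minimal_def contractible_def using ceq.refl by blast

lemma not_minimal_near: "\<bar>i - j\<bar> = 1 \<Longrightarrow> \<not> minimal (x @ [i, j, i] @ y)"
  unfolding minimal_def contractible_def using ceq.refl by blast

lemma far_if_less: "\<forall>x\<in>set u. x < m \<Longrightarrow> m - 1 \<notin> set u \<Longrightarrow> \<forall>x\<in>set u. \<bar>x - m\<bar> \<ge> (2::int)"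
proof
  fix x assume "\<forall>x\<in>set u. x < m" "m - 1 \<notin> set u" "x \<in> set u"
  then have "x < m" "x \<noteq> m - 1" by auto
  then show "\<bar>x - m\<bar> \<ge> 2" by linarith
qed

text \<open>Between two occurrences of \<open>m\<close> with only smaller letters in between, the letter \<open>m - 1\<close>
  would have to occur twice; descend to those.\<close>

lemma not_minimal_between: "\<forall>x\<in>set u. x < m \<Longrightarrow> \<not> minimal ([m] @ u @ [m])"
proof (induction "length u" arbitrary: u m rule: less_induct)
  case less
  show ?case
  proof
    assume min: "minimal ([m] @ u @ [m])"
    show False
    proof (cases "m - 1 \<in> set u")
      case False
      then have "\<forall>x\<in>set u. \<bar>x - m\<bar> \<ge> 2" using less.prems by (intro far_if_less)
      then have "ceq ([m] @ u) (u @ [m])" by (rule ceq_move)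
      then have "ceq ([m] @ u @ [m]) (u @ [m, m] @ [])" using ceq_append1[of "[m] @ u" "u @ [m]" "[m]"] by simp
      then show False using min minimal_ceq not_minimal_idem by blast
    next
      case True
      then obtain u1 u2 where u: "u = u1 @ [m - 1] @ u2" "m - 1 \<notin> set u1"
        using split_list_first[OF True] by auto
      have far: "ceq ([m] @ u1) (u1 @ [m])"
        by (rule ceq_move, rule far_if_less) (use u less.prems in auto)
      show False
      proof (cases "m - 1 \<in> set u2")
        case False
        have far2: "ceq ([m] @ u2) (u2 @ [m])"
          by (rule ceq_move, rule far_if_less) (use u False less.prems in auto)
        have "ceq (u1 @ [m, m - 1] @ (u2 @ [m])) (u1 @ [m, m - 1] @ ([m] @ u2))"
          using ceq_append2[OF ceq_sym[OF far2], of "u1 @ [m, m - 1]"] by simp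
        moreover have "ceq ([m] @ u @ [m]) (u1 @ [m, m - 1] @ (u2 @ [m]))"
          using ceq_append1[OF far, of "[m - 1] @ u2 @ [m]"] u by simp
        ultimately have "ceq ([m] @ u @ [m]) (u1 @ [m, m - 1] @ ([m] @ u2))" by (rule ceq_trans)
        then have "ceq ([m] @ u @ [m]) (u1 @ [m, m - 1, m] @ u2)" by simp
        moreover have "\<not> minimal (u1 @ [m, m - 1, m] @ u2)" by (rule not_minimal_near) simp
        ultimately show False using min minimal_ceq by blast
      next
        case True
        then obtain u3 u4 where u2: "u2 = u3 @ [m - 1] @ u4" "m - 1 \<notin> set u3"
          using split_list_first[OF True] by auto
        have "\<not> minimal ([m - 1] @ u3 @ [m - 1])"
        proof (rule less.hyps)
          show "length u3 < length u" using u u2 by simp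
          show "\<forall>x\<in>set u3. x < m - 1"
          proof
            fix x assume x: "x \<in> set u3"
            then have "x < m" "x \<noteq> m - 1" using u u2 less.prems by auto
            then show "x < m - 1" by linarith
          qed
        qed
        moreover have "[m] @ u @ [m] = ([m] @ u1) @ ([m - 1] @ u3 @ [m - 1]) @ (u4 @ [m])"
          using u u2 by simp
        ultimately show False using min minimal_factor by metis
      qed
    qed
  qed
qed

text \<open>\<open>turn_last\<close> describes the half diagrams with two nested arcs from \<open>j\<close> and \<open>j + 1\<close> to the
  left.  Multiplying by the generator \<open>j\<close> creates a cup at the left ends of these arcs; this must not
  happen in a minimal word, and indeed \<open>z U\<^sub>j U\<^sub>j\<^sub>-\<^sub>1 u U\<^sub>j\<close> can be shortened.\<close>

definition cup_last :: "int list \<Rightarrow> bool" where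
  "cup_last v \<longleftrightarrow> (\<forall>i. st v i = i + 1 \<longrightarrow> (\<exists>z. ceq v (z @ [i])))"

definition turn_last :: "int list \<Rightarrow> bool" where
  "turn_last v \<longleftrightarrow> (\<forall>j. st v j < j \<and> st v (j + 1) < j \<longrightarrow>
     (\<exists>z u. ceq v (z @ [j, j - 1] @ u) \<and> (\<forall>x\<in>set u. x \<le> j - 2)))"

lemma turn_last_not_minimal:
  assumes "turn_last v" "st v j < j" "st v (j + 1) < j"
  shows "\<not> minimal (v @ [j])"
proof
  assume min: "minimal (v @ [j])"
  from assms obtain z u where zu: "ceq v (z @ [j, j - 1] @ u)" "\<forall>x\<in>set u. x \<le> j - 2"
    unfolding turn_last_def by blast
  have "ceq ([j] @ u) (u @ [j])" by (rule ceq_move) (use zu(2) in \<open>force simp: abs_if\<close>)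
  then have "ceq ((z @ [j, j - 1]) @ (u @ [j])) ((z @ [j, j - 1]) @ ([j] @ u))"
    by (rule ceq_append2[OF ceq_sym])
  moreover have "ceq (v @ [j]) ((z @ [j, j - 1]) @ (u @ [j]))" using ceq_append1[OF zu(1), of "[j]"] by simp
  ultimately have "ceq (v @ [j]) ((z @ [j, j - 1]) @ ([j] @ u))" by (rule ceq_trans)
  then have "ceq (v @ [j]) (z @ [j, j - 1, j] @ u)" by simp
  moreover have "\<not> minimal (z @ [j, j - 1, j] @ u)" by (rule not_minimal_near) simp
  ultimately show False using min minimal_ceq by blast
qed

section \<open>Mirror images of words and half diagrams\<close>

definition refl_word :: "int list \<Rightarrow> int list" where
  "refl_word = map uminus"

text \<open>The mirror image x -> 1 - x takes the cup at {j, j + 1} to the one at {-j, -j + 1};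
  hence the reflection of a word changes the sign of its letters.\<close>

lemma cupg_refl:
  "cupg (- j) (- j + 1) (\<lambda>y. 1 - \<sigma> (1 - y)) x = 1 - cupg j (j + 1) \<sigma> (1 - x)" for x j :: int
proof -
  obtain y where x: "x = 1 - y" by (metis diff_diff_eq2 add_diff_cancel_left')
  have e: "1 - (- j + 1) = j" "1 - (- j) = j + 1" "1 - (1 - y) = y" by simp_all
  have "x = - j \<longleftrightarrow> y = j + 1" "x = - j + 1 \<longleftrightarrow> y = j"
    "1 - z = - j \<longleftrightarrow> z = j + 1" "1 - z = - j + 1 \<longleftrightarrow> z = j" for z using x by linarith+
  then show ?thesis unfolding cupg_def e x by auto
qed

lemma st_refl: "st (refl_word w) x = 1 - st w (1 - x)"
proof (induction w arbitrary: x rule: rev_induct)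
  case Nil show ?case by (simp add: refl_word_def)
next
  case (snoc j w)
  have "refl_word (w @ [j]) = refl_word w @ [- j]" by (simp add: refl_word_def)
  moreover have "st (refl_word w) = (\<lambda>y. 1 - st w (1 - y))" using snoc by blast
  ultimately show ?case by (simp only: st_snoc cupg_refl)
qed

lemma refl_refl: "refl_word (refl_word w) = w"
  by (simp add: refl_word_def o_def)

lemma ceq_refl: "ceq u v \<Longrightarrow> ceq (refl_word u) (refl_word v)"
proof (induction rule: ceq.induct)
  case (step x i j y)
  then show ?case using ceq.step[of "refl_word u" "refl_word x" "- i" "- j" "refl_word y"]
    by (simp add: refl_word_def abs_minus_commute)
qed (rule ceq.refl)

lemma contractible_refl: "contractible w \<Longrightarrow> contractible (refl_word w)"
  unfolding contractible_def
proof (elim disjE exE conjE)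
  fix x y i assume "w = x @ [i, i] @ y"
  then have "refl_word w = refl_word x @ [- i, - i] @ refl_word y" by (simp add: refl_word_def)
  then show "(\<exists>x y i. refl_word w = x @ [i, i] @ y) \<or> (\<exists>x y i j. \<bar>i - j\<bar> = 1 \<and> refl_word w = x @ [i, j, i] @ y)"
    by blast
next
  fix x y i j assume "w = x @ [i, j, i] @ y" and ij: "\<bar>i - j\<bar> = 1"
  then have "refl_word w = refl_word x @ [- i, - j, - i] @ refl_word y" by (simp add: refl_word_def)
  moreover have "\<bar>(- i) - (- j)\<bar> = 1" using ij by linarith
  ultimately show "(\<exists>x y i. refl_word w = x @ [i, i] @ y) \<or> (\<exists>x y i j. \<bar>i - j\<bar> = 1 \<and> refl_word w = x @ [i, j, i] @ y)"
    by blast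
qed

lemma minimal_refl: "minimal w \<Longrightarrow> minimal (refl_word w)"
  unfolding minimal_def by (metis ceq_refl refl_refl contractible_refl)

text \<open>A cup away from the last letter \<open>j\<close> can only be new if it joins the former
  partners of \<open>j\<close> and \<open>j + 1\<close>. Then two nested arcs lead in
  \<open>v\<close> from \<open>j\<close>, \<open>j + 1\<close> to \<open>i\<close>,
  \<open>i + 1\<close>, which contradicts minimality by \<open>turn_last\<close> if they lead to the
  left, and by its mirror image if they lead to the right.\<close>

lemma cup_before_last:
  assumes T: "turn_last v" "turn_last (refl_word v)" and min: "minimal (v @ [j])"
    and far: "\<bar>i - j\<bar> \<ge> 2" and cup: "act j (st v) i = i + 1"
  shows "st v i = i + 1"
proof (rule ccontr)
  assume ne: "st v i \<noteq> i + 1"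
  note inv = planar_inv[OF planar_st[of v]]
  have "st v i = j \<and> st v (j + 1) = i + 1 \<or> st v i = j + 1 \<and> st v j = i + 1"
  proof -
    have "i \<noteq> j" "i \<noteq> j + 1" using far by auto
    with cup ne show ?thesis unfolding cupg_def by (simp split: if_split_asm)
  qed
  then have arcs: "st v j \<in> {i, i + 1}" "st v (j + 1) \<in> {i, i + 1}" using inv[of i] by auto
  show False
  proof (cases "i < j")
    case True
    then have "st v j < j" "st v (j + 1) < j" using arcs far by auto
    then show False using turn_last_not_minimal[OF T(1)] min by blast
  next
    case False
    have "minimal (refl_word v @ [- j])" using minimal_refl[OF min] by (simp add: refl_word_def)
    moreover have "st (refl_word v) (- j) < - j" "st (refl_word v) (- j + 1) < - j"
      unfolding st_refl using arcs far False by (auto simp: add.commute[of 1 j])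
    ultimately show False using turn_last_not_minimal[OF T(2)] by blast
  qed
qed

lemma cup_last_snoc:
  assumes C: "cup_last v" and T: "turn_last v" "turn_last (refl_word v)" and min: "minimal (v @ [j])"
  shows "cup_last (v @ [j])"
  unfolding cup_last_def
proof (intro allI impI)
  fix i assume cup: "st (v @ [j]) i = i + 1"
  show "\<exists>z. ceq (v @ [j]) (z @ [i])"
  proof (cases "\<bar>i - j\<bar> \<ge> 2")
    case True
    then have "st v i = i + 1" using cup_before_last[OF T min True] cup by simp
    then obtain z where "ceq v (z @ [i])" using C unfolding cup_last_def by blast
    then have "ceq (v @ [j]) (z @ [i, j] @ [])" using ceq_append1 by fastforce
    then have "ceq (v @ [j]) (z @ [j, i] @ [])" using True by (rule ceq.step)
    then show ?thesis by (intro exI[of _ "z @ [j]"]) simp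
  next
    case False
    \<comment> \<open>A cup at \<open>j + 1\<close> or \<open>j - 1\<close> would share an endpoint
      with the cup {j, j + 1} made by the last letter.\<close>
    have "i \<noteq> j + 1" using cup by (auto simp: cupg_def)
    moreover have "i \<noteq> j - 1"
    proof
      assume "i = j - 1"
      then have "act j (st v) (act j (st v) i) = j + 1" using cup by (simp add: cupg_def)
      then show False using act_inv[OF planar_st[of v], of j i] \<open>i = j - 1\<close> by simp
    qed
    ultimately have "i = j" using False by linarith
    then show ?thesis using ceq.refl by blast
  qed
qed

text \<open>If \<open>m\<close> is distant from \<open>j\<close> and \<open>j + 1\<close>, both arcs
  were already present in \<open>v\<close>, up to their left ends. The letter \<open>m\<close> is
  then absorbed by \<open>u\<close> when it is smaller, and commutes to the front of
  \<open>[j, j - 1] @ u\<close> when it is larger. Only \<open>m = j - 1\<close> can produce the two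
  arcs anew, out of a cup at \<open>j\<close>.\<close>

lemma turn_last_snoc:
  assumes C: "cup_last v" and T: "turn_last v" and min: "minimal (v @ [m])"
  shows "turn_last (v @ [m])"
  unfolding turn_last_def
proof (intro allI impI, elim conjE)
  fix j assume "st (v @ [m]) j < j" "st (v @ [m]) (j + 1) < j"
  then have h: "act m (st v) j < j" "act m (st v) (j + 1) < j" by simp_all
  let ?\<sigma> = "st v"
  note P = planar_st[of v]
  note inv = planar_inv[OF P] and nest = planar_nest[OF P]
  have nT: "\<not> (?\<sigma> m < m \<and> ?\<sigma> (m + 1) < m)"
    using turn_last_not_minimal[OF T] min by blast
  have m: "m \<noteq> j" "m \<noteq> j + 1" using h by (auto simp: cupg_def)
  let ?goal = "\<exists>z u. ceq (v @ [m]) (z @ [j, j - 1] @ u) \<and> (\<forall>x\<in>set u. x \<le> j - 2)"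
  have keep: "\<exists>z u. ceq v (z @ [j, j - 1] @ u) \<and> (\<forall>x\<in>set u. x \<le> j - 2)" if "?\<sigma> j < j" "?\<sigma> (j + 1) < j"
    using T that unfolding turn_last_def by blast
  consider (a) "m = j - 1" | (b) "m \<le> j - 2" | (c) "m \<ge> j + 2" using m by linarith
  then show ?goal
  proof cases
    case a
    have y: "act m ?\<sigma> (j + 1) < j - 1"
    proof -
      have "act m ?\<sigma> (j + 1) \<noteq> j - 1"
      proof
        assume "act m ?\<sigma> (j + 1) = j - 1"
        then have "act m ?\<sigma> (act m ?\<sigma> (j + 1)) = j" using a by (simp add: cupg_def)
        then show False using act_inv[OF P, of m "j + 1"] by simp
      qed
      then show ?thesis using h by linarith
    qed
    consider (1) "?\<sigma> (j + 1) = j - 1" "?\<sigma> j < j - 1" | (2) "?\<sigma> (j + 1) = j"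
      | (3) "?\<sigma> (j + 1) < j - 1" "?\<sigma> (j + 1) \<noteq> j - 1" "?\<sigma> (j + 1) \<noteq> j"
      using y a by (auto simp: cupg_def split: if_splits)
    then show ?goal
    proof cases
      \<comment> \<open>The arc from \<open>j - 1\<close> to \<open>j + 1\<close> would be crossed
        by the one leading from \<open>j\<close> to the left.\<close>
      case 1
      then show ?goal using nest[of "j - 1" j] inv[of "j + 1"] by auto
    next
      case 2
      then have "?\<sigma> j = j + 1" using inv[of "j + 1"] by simp
      then obtain z where "ceq v (z @ [j])" using C unfolding cup_last_def by blast
      then have "ceq (v @ [m]) (z @ [j, j - 1] @ [])" using ceq_append1[of v "z @ [j]" "[m]"] a by simp
      then show ?goal by fastforce
    next
      \<comment> \<open>As \<open>j\<close> lies under the arc of \<open>j + 1\<close>, both arcs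
        were present in \<open>v\<close>; the appended \<open>j - 1\<close> then repeats the
        \<open>j - 1\<close> of \<open>v\<close> with only smaller letters in between.\<close>
      case 3
      have "?\<sigma> j < j" using nest[of "?\<sigma> (j + 1)" j] inv[of "j + 1"] 3 by auto
      then obtain z u where zu: "ceq v (z @ [j, j - 1] @ u)" "\<forall>x\<in>set u. x \<le> j - 2" using keep 3 by force
      have "ceq (v @ [m]) ((z @ [j]) @ ([j - 1] @ u @ [j - 1]))"
        using ceq_append1[OF zu(1), of "[m]"] a by simp
      then have "minimal ((z @ [j]) @ ([j - 1] @ u @ [j - 1]) @ [])" using min minimal_ceq by simp
      then have "minimal ([j - 1] @ u @ [j - 1])" by (rule minimal_factor)
      moreover have "\<not> minimal ([j - 1] @ u @ [j - 1])"
        by (rule not_minimal_between) (use zu(2) in auto)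
      ultimately show ?goal by blast
    qed
  next
    case b
    have "?\<sigma> j < j"
      using h(1) b inv[of j] by (auto simp: cupg_def split: if_splits)
    moreover have "?\<sigma> (j + 1) < j"
      using h(2) b inv[of "j + 1"] by (auto simp: cupg_def split: if_splits)
    ultimately obtain z u where zu: "ceq v (z @ [j, j - 1] @ u)" "\<forall>x\<in>set u. x \<le> j - 2" using keep by force
    have "ceq (v @ [m]) (z @ [j, j - 1] @ (u @ [m]))"
      using ceq_append1[OF zu(1), of "[m]"] by simp
    moreover have "\<forall>x\<in>set (u @ [m]). x \<le> j - 2" using zu(2) b by auto
    ultimately show ?goal by blast
  next
    case c
    \<comment> \<open>An arc of \<open>j\<close> or \<open>j + 1\<close> that has changed was
      attached to \<open>m\<close> or \<open>m + 1\<close> in \<open>v\<close>. Then both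
      \<open>m\<close> and \<open>m + 1\<close> were joined to points on their left, which
      \<open>nT\<close> excludes.\<close>
    have "?\<sigma> j < j \<and> ?\<sigma> (j + 1) < j"
    proof (rule ccontr)
      assume neg: "\<not> ?thesis"
      have c1: "?\<sigma> j < j \<or> ?\<sigma> m = j \<and> ?\<sigma> (m + 1) < j \<or> ?\<sigma> (m + 1) = j \<and> ?\<sigma> m < j"
        using h(1) c inv[of j] by (auto simp: cupg_def split: if_splits)
      have c2: "?\<sigma> (j + 1) < j \<or> ?\<sigma> m = j + 1 \<and> ?\<sigma> (m + 1) < j \<or> ?\<sigma> (m + 1) = j + 1 \<and> ?\<sigma> m < j"
        using h(2) c inv[of "j + 1"] by (auto simp: cupg_def split: if_splits)
      show False using c1 c2 neg nT c by auto
    qed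
    then obtain z u where zu: "ceq v (z @ [j, j - 1] @ u)" "\<forall>x\<in>set u. x \<le> j - 2" using keep by blast
    have "ceq ([m] @ ([j, j - 1] @ u)) (([j, j - 1] @ u) @ [m])"
      by (rule ceq_move) (use zu(2) c in \<open>auto simp: abs_if\<close>)
    note ceq_append2[OF ceq_sym[OF this], of z]
    moreover have "ceq (v @ [m]) (z @ (([j, j - 1] @ u) @ [m]))" using ceq_append1[OF zu(1), of "[m]"] by simp
    ultimately have "ceq (v @ [m]) (z @ ([m] @ ([j, j - 1] @ u)))" by (rule ceq_trans)
    then have "ceq (v @ [m]) ((z @ [m]) @ [j, j - 1] @ u)" by simp
    then show ?goal using zu(2) by blast
  qed
qed

lemma cup_turn_last_Nil: "cup_last []" "turn_last []"
  by (simp_all add: cup_last_def turn_last_def)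

text \<open>The induction is on the length and not along the list, because it is also applied to the
  mirror image of the prefix.\<close>

lemma minimal_last: "minimal v \<Longrightarrow> cup_last v \<and> turn_last v"
proof (induction "length v" arbitrary: v rule: less_induct)
  case less
  show ?case
  proof (cases v rule: rev_cases)
    case Nil then show ?thesis using cup_turn_last_Nil by simp
  next
    case (snoc v' j)
    have min: "minimal (v' @ [j])" and min': "minimal v'"
      using less.prems snoc minimal_prefix by blast+
    have IH: "cup_last v'" "turn_last v'" using less.hyps[of v'] snoc min' by auto
    have "turn_last (refl_word v')"
      using less.hyps[of "refl_word v'"] snoc minimal_refl[OF min'] by (simp add: refl_word_def)
    then show ?thesis using cup_last_snoc[OF IH _ min] turn_last_snoc[OF IH min] snoc by simp
  qed
qed

text \<open>The letters of \<open>T\<close> are split off from the right. By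
  \<open>cup_before_last\<close>, the cups at the other letters were there before the last letter
  was appended.\<close>

lemma minimal_cups:
  assumes "minimal v" "sorted_wrt (\<lambda>i j. i + 2 \<le> j) T" "\<forall>i\<in>set T. st v i = i + 1"
  shows "\<exists>z. ceq v (z @ T)"
  using assms
proof (induction T arbitrary: v rule: rev_induct)
  case Nil show ?case using ceq.refl by auto
next
  case (snoc i T)
  have "cup_last v" using minimal_last snoc.prems by blast
  then obtain z where z: "ceq v (z @ [i])" using snoc.prems unfolding cup_last_def by auto
  have minz: "minimal (z @ [i])" by (rule minimal_ceq[OF snoc.prems(1) z])
  then have min: "minimal z" by (rule minimal_prefix)
  have "st z k = k + 1" if k: "k \<in> set T" for k
  proof (rule cup_before_last[OF _ _ minz])
    show "turn_last z" "turn_last (refl_word z)" using minimal_last min minimal_refl by blast+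
    show "\<bar>k - i\<bar> \<ge> 2" using snoc.prems(2) k by (force simp: sorted_wrt_append)
    show "act i (st z) k = k + 1" using ceq_st[OF z] snoc.prems(3) k by simp
  qed
  then obtain z' where "ceq z (z' @ T)"
    using snoc.IH[OF min] snoc.prems(2) by (auto simp: sorted_wrt_append)
  then have "ceq (z @ [i]) (z' @ T @ [i])" using ceq_append1 by fastforce
  then show ?case using ceq_trans z by blast
qed

section \<open>Subquotients of chain complexes\<close>

text \<open>A relation inducing an isomorphism \<open>Z/B \<cong> Z'/B'\<close> of \<open>R\<close>-modules.  Unlike maps, such
  relations can be inverted and composed on the level of representatives.\<close>

definition sub_rel ::
    "('r, 'x) ring_scheme \<Rightarrow> ('r, 'g) module \<Rightarrow> 'g set \<Rightarrow> 'g set \<Rightarrow> ('r, 'h) module \<Rightarrow> 'h set \<Rightarrow> 'h set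
      \<Rightarrow> ('g \<Rightarrow> 'h \<Rightarrow> bool) \<Rightarrow> bool" where
  "sub_rel R G Z B G' Z' B' \<rho> \<longleftrightarrow>
     (\<forall>x y. \<rho> x y \<longrightarrow> x \<in> Z \<and> y \<in> Z' \<and> (x \<in> B \<longleftrightarrow> y \<in> B')) \<and>
     (\<forall>x\<in>Z. \<exists>y. \<rho> x y) \<and> (\<forall>y\<in>Z'. \<exists>x. \<rho> x y) \<and>
     (\<forall>x y x' y'. \<rho> x y \<longrightarrow> \<rho> x' y' \<longrightarrow> \<rho> (x \<oplus>\<^bsub>G\<^esub> x') (y \<oplus>\<^bsub>G'\<^esub> y')) \<and>
     (\<forall>r\<in>carrier R. \<forall>x y. \<rho> x y \<longrightarrow> \<rho> (r \<odot>\<^bsub>G\<^esub> x) (r \<odot>\<^bsub>G'\<^esub> y))"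

definition sub_iso ::
    "('r, 'x) ring_scheme \<Rightarrow> ('r, 'g) module \<Rightarrow> 'g set \<Rightarrow> 'g set \<Rightarrow> ('r, 'h) module \<Rightarrow> 'h set \<Rightarrow> 'h set \<Rightarrow> bool" where
  "sub_iso R G Z B G' Z' B' \<longleftrightarrow> (\<exists>\<rho>. sub_rel R G Z B G' Z' B' \<rho>)"

lemma sub_relD:
  assumes "sub_rel R G Z B G' Z' B' \<rho>"
  shows "\<And>x y. \<rho> x y \<Longrightarrow> x \<in> Z" "\<And>x y. \<rho> x y \<Longrightarrow> y \<in> Z'"
    "\<And>x y. \<rho> x y \<Longrightarrow> x \<in> B \<longleftrightarrow> y \<in> B'"
    "\<And>x. x \<in> Z \<Longrightarrow> \<exists>y. \<rho> x y" "\<And>y. y \<in> Z' \<Longrightarrow> \<exists>x. \<rho> x y"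
    "\<And>x y x' y'. \<rho> x y \<Longrightarrow> \<rho> x' y' \<Longrightarrow> \<rho> (x \<oplus>\<^bsub>G\<^esub> x') (y \<oplus>\<^bsub>G'\<^esub> y')"
    "\<And>r x y. r \<in> carrier R \<Longrightarrow> \<rho> x y \<Longrightarrow> \<rho> (r \<odot>\<^bsub>G\<^esub> x) (r \<odot>\<^bsub>G'\<^esub> y)"
  using assms unfolding sub_rel_def by simp_all

lemma sub_isoI:
  assumes "\<And>x y. \<rho> x y \<Longrightarrow> x \<in> Z" "\<And>x y. \<rho> x y \<Longrightarrow> y \<in> Z'"
    and "\<And>x y. \<rho> x y \<Longrightarrow> x \<in> B \<Longrightarrow> y \<in> B'" "\<And>x y. \<rho> x y \<Longrightarrow> y \<in> B' \<Longrightarrow> x \<in> B"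
    and "\<And>x. x \<in> Z \<Longrightarrow> \<exists>y. \<rho> x y" "\<And>y. y \<in> Z' \<Longrightarrow> \<exists>x. \<rho> x y"
    and "\<And>x y x' y'. \<rho> x y \<Longrightarrow> \<rho> x' y' \<Longrightarrow> \<rho> (x \<oplus>\<^bsub>G\<^esub> x') (y \<oplus>\<^bsub>G'\<^esub> y')"
    and "\<And>r x y. r \<in> carrier R \<Longrightarrow> \<rho> x y \<Longrightarrow> \<rho> (r \<odot>\<^bsub>G\<^esub> x) (r \<odot>\<^bsub>G'\<^esub> y)"
  shows "sub_iso R G Z B G' Z' B'"
  unfolding sub_iso_def sub_rel_def using assms by (intro exI[of _ \<rho>] conjI allI impI ballI iffI) simp_all

lemma sub_iso_sym: "sub_iso R G Z B G' Z' B' \<Longrightarrow> sub_iso R G' Z' B' G Z B"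
  unfolding sub_iso_def
proof (elim exE)
  fix \<rho> assume "sub_rel R G Z B G' Z' B' \<rho>"
  then show "\<exists>\<rho>. sub_rel R G' Z' B' G Z B \<rho>"
    unfolding sub_rel_def by (intro exI[of _ "\<lambda>x y. \<rho> y x"]) simp
qed

lemma sub_iso_trans:
  assumes "sub_iso R G Z B G' Z' B'" "sub_iso R G' Z' B' G'' Z'' B''"
  shows "sub_iso R G Z B G'' Z'' B''"
proof -
  from assms obtain \<rho> \<tau> where "sub_rel R G Z B G' Z' B' \<rho>" "sub_rel R G' Z' B' G'' Z'' B'' \<tau>"
    unfolding sub_iso_def by blast
  note 1 = sub_relD[OF this(1)] and 2 = sub_relD[OF this(2)]
  show ?thesis
  proof (rule sub_isoI[of "\<lambda>x z. \<exists>y. \<rho> x y \<and> \<tau> y z"])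
    show "\<exists>z y. \<rho> x y \<and> \<tau> y z" if "x \<in> Z" for x using 1(2) 1(4)[OF that] 2(4) by blast
    show "\<exists>x y. \<rho> x y \<and> \<tau> y z" if "z \<in> Z''" for z using 2(1) 2(5)[OF that] 1(5) by blast
    show "\<exists>y. \<rho> (r \<odot>\<^bsub>G\<^esub> x) y \<and> \<tau> y (r \<odot>\<^bsub>G''\<^esub> z)" if "r \<in> carrier R" "\<exists>y. \<rho> x y \<and> \<tau> y z" for r x z
      using 1(7) 2(7) that by blast
    show "\<exists>y. \<rho> (x \<oplus>\<^bsub>G\<^esub> x') y \<and> \<tau> y (z \<oplus>\<^bsub>G''\<^esub> z')" if "\<exists>y. \<rho> x y \<and> \<tau> y z" "\<exists>y. \<rho> x' y \<and> \<tau> y z'" for x x' z z'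
      using 1(6) 2(6) that by blast
  qed (use 1(1-3) 2(1-3) in auto)
qed

text \<open>Repeats the record built by \<open>homology\<close>, so that homology modules are
  instances by plain equality and \<open>Z\<close>, \<open>B\<close> can be reasoned about as
  sets.\<close>

definition subquot_mod :: "('r, 'g) module \<Rightarrow> 'g set \<Rightarrow> 'g set \<Rightarrow> ('r, 'g set) module" where
  "subquot_mod G Z B =
     \<lparr>carrier = (\<lambda>x. B +>\<^bsub>G\<^esub> x) ` Z, monoid.mult = undefined, one = undefined,
      ring.zero = B, ring.add = (\<lambda>X Y. X <+>\<^bsub>G\<^esub> Y),
      smult = (\<lambda>r X. \<Union>x\<in>X. B +>\<^bsub>G\<^esub> (r \<odot>\<^bsub>G\<^esub> x))\<rparr>"

lemma homology_subquot: "homology C d k = subquot_mod (C k) (cycles C d k) (boundaries C d k)"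
  by (simp add: homology_def subquot_mod_def)

locale subquotient = abelian_group G for R :: "('r, 'x) ring_scheme" and G :: "('r, 'g) module" (structure) +
  fixes Z B
  assumes Z: "Z \<subseteq> carrier G" and Zadd: "x \<in> Z \<Longrightarrow> y \<in> Z \<Longrightarrow> x \<oplus> y \<in> Z"
    and Zneg: "x \<in> Z \<Longrightarrow> \<ominus> x \<in> Z"
    and BZ: "B \<subseteq> Z" and B0: "\<zero> \<in> B" and Badd: "x \<in> B \<Longrightarrow> y \<in> B \<Longrightarrow> x \<oplus> y \<in> B"
    and Bneg: "x \<in> B \<Longrightarrow> \<ominus> x \<in> B"
    and Zsm: "r \<in> carrier R \<Longrightarrow> x \<in> Z \<Longrightarrow> r \<odot>\<^bsub>G\<^esub> x \<in> Z"
    and Bsm: "r \<in> carrier R \<Longrightarrow> x \<in> B \<Longrightarrow> r \<odot>\<^bsub>G\<^esub> x \<in> B"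
    and sm_add: "r \<in> carrier R \<Longrightarrow> x \<in> Z \<Longrightarrow> y \<in> Z \<Longrightarrow> r \<odot>\<^bsub>G\<^esub> (x \<oplus> y) = r \<odot>\<^bsub>G\<^esub> x \<oplus> r \<odot>\<^bsub>G\<^esub> y"
begin

lemma B_subgroup: "additive_subgroup B G"
proof
  show "B \<subseteq> carrier (add_monoid G)" using BZ Z by auto
  show "x \<otimes>\<^bsub>add_monoid G\<^esub> y \<in> B" if "x \<in> B" "y \<in> B" for x y using Badd that by simp
  show "\<one>\<^bsub>add_monoid G\<^esub> \<in> B" using B0 by simp
  show "inv\<^bsub>add_monoid G\<^esub> x \<in> B" if "x \<in> B" for x using Bneg[OF that] by (simp add: a_inv_def)
qed

sublocale B: abelian_subgroup B G
  by (rule abelian_subgroupI3[OF B_subgroup abelian_group_axioms])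

lemma Z0: "\<zero> \<in> Z" using B0 BZ by blast

lemma coset_B: "x \<in> Z \<Longrightarrow> B +> x = B \<longleftrightarrow> x \<in> B"
  using B.a_rcos_const B.a_rcos_self Z by blast

lemma coset_add: "x \<in> Z \<Longrightarrow> y \<in> Z \<Longrightarrow> (B +> x) <+> (B +> y) = B +> (x \<oplus> y)"
  using B.a_rcos_sum Z by blast

lemma coset_shift: "b \<in> B \<Longrightarrow> x \<in> Z \<Longrightarrow> B +> (b \<oplus> x) = B +> x"
  using a_coset_add_assoc[of B b x] B.a_rcos_const[of b] Z BZ by auto

lemma coset_smult:
  assumes r: "r \<in> carrier R" and x: "x \<in> Z"
  shows "(\<Union>y\<in>B +> x. B +> (r \<odot>\<^bsub>G\<^esub> y)) = B +> (r \<odot>\<^bsub>G\<^esub> x)"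
proof -
  have "B +> (r \<odot>\<^bsub>G\<^esub> y) = B +> (r \<odot>\<^bsub>G\<^esub> x)" if "y \<in> B +> x" for y
  proof -
    obtain b where b: "b \<in> B" "y = b \<oplus> x" using \<open>y \<in> B +> x\<close> unfolding a_r_coset_def' by blast
    then show ?thesis using coset_shift[OF Bsm[OF r b(1)] Zsm[OF r x]] sm_add[OF r _ x, of b] BZ by auto
  qed
  then show ?thesis using B.a_rcos_self[of x] x Z by blast
qed

lemma subquot_mod_abelian: "abelian_group (subquot_mod G Z B)"
proof (rule abelian_groupI)
  note s = subquot_mod_def coset_add Zadd subset_iff
  fix X Y W assume XYW: "X \<in> carrier (subquot_mod G Z B)" "Y \<in> carrier (subquot_mod G Z B)" "W \<in> carrier (subquot_mod G Z B)"
  then obtain x y w where [simp]: "X = B +> x" "Y = B +> y" "W = B +> w" and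
     [simp]: "x \<in> Z" "y \<in> Z" "w \<in> Z" by (auto simp: subquot_mod_def)
  have [simp]: "x \<in> carrier G" "y \<in> carrier G" "w \<in> carrier G" using Z by auto
  show "X \<oplus>\<^bsub>subquot_mod G Z B\<^esub> Y \<in> carrier (subquot_mod G Z B)" by (simp add: s)
  show "X \<oplus>\<^bsub>subquot_mod G Z B\<^esub> Y \<oplus>\<^bsub>subquot_mod G Z B\<^esub> W = X \<oplus>\<^bsub>subquot_mod G Z B\<^esub> (Y \<oplus>\<^bsub>subquot_mod G Z B\<^esub> W)"
    by (simp add: s a_assoc)
  show "X \<oplus>\<^bsub>subquot_mod G Z B\<^esub> Y = Y \<oplus>\<^bsub>subquot_mod G Z B\<^esub> X" by (simp add: s a_comm)
  have z: "\<zero>\<^bsub>subquot_mod G Z B\<^esub> = B +> \<zero>" using coset_B[OF Z0] B0 by (simp add: subquot_mod_def)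
  show "\<zero>\<^bsub>subquot_mod G Z B\<^esub> \<oplus>\<^bsub>subquot_mod G Z B\<^esub> X = X" unfolding z by (simp add: s Z0 del: a_coset_add_zero)
  have "(B +> (\<ominus> x)) \<oplus>\<^bsub>subquot_mod G Z B\<^esub> X = \<zero>\<^bsub>subquot_mod G Z B\<^esub>"
    unfolding z by (simp add: s Zneg l_neg del: a_coset_add_zero)
  moreover have "B +> (\<ominus> x) \<in> carrier (subquot_mod G Z B)" by (simp add: subquot_mod_def Zneg)
  ultimately show "\<exists>y\<in>carrier (subquot_mod G Z B). y \<oplus>\<^bsub>subquot_mod G Z B\<^esub> X = \<zero>\<^bsub>subquot_mod G Z B\<^esub>" by blast
next
  show "\<zero>\<^bsub>subquot_mod G Z B\<^esub> \<in> carrier (subquot_mod G Z B)"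
    using coset_B[OF Z0] B0 Z0 by (force simp: subquot_mod_def)
qed

lemma sub_iso_subquot_mod:
  "sub_iso R G Z B (subquot_mod G Z B) (carrier (subquot_mod G Z B)) {\<zero>\<^bsub>subquot_mod G Z B\<^esub>}"
  by (rule sub_isoI[of "\<lambda>x X. x \<in> Z \<and> X = B +> x"])
    (auto simp: subquot_mod_def coset_B coset_add coset_smult Zadd Zsm)

end

text \<open>With zero denominators the relation is the graph of a bijection: two partners of the
  same element both cancel against a partner of its negative, so they agree, and likewise in the
  other direction.\<close>

lemma sub_iso_module_isomorphic:
  assumes "abelian_group H" "abelian_group H'"
    and "sub_iso R H (carrier H) {\<zero>\<^bsub>H\<^esub>} H' (carrier H') {\<zero>\<^bsub>H'\<^esub>}"
  shows "module_isomorphic R H H'"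
proof -
  interpret H: abelian_group H by fact
  interpret H': abelian_group H' by fact
  from assms(3) obtain \<rho> where "sub_rel R H (carrier H) {\<zero>\<^bsub>H\<^esub>} H' (carrier H') {\<zero>\<^bsub>H'\<^esub>} \<rho>"
    unfolding sub_iso_def by blast
  note \<rho> = sub_relD[OF this]
  have fn: "y = y'" if "\<rho> x y" "\<rho> x y'" for x y y'
  proof -
    note c = \<rho>(1,2)[OF that(1)] \<rho>(2)[OF that(2)]
    obtain w where w: "\<rho> (\<ominus>\<^bsub>H\<^esub> x) w" using \<rho>(4) c by blast
    have "y \<oplus>\<^bsub>H'\<^esub> w = \<zero>\<^bsub>H'\<^esub>" "y' \<oplus>\<^bsub>H'\<^esub> w = \<zero>\<^bsub>H'\<^esub>"
      using \<rho>(3)[OF \<rho>(6)[OF that(1) w]] \<rho>(3)[OF \<rho>(6)[OF that(2) w]] c by (auto simp: H.r_neg)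
    then show ?thesis using H'.add.right_cancel c \<rho>(2)[OF w] by metis
  qed
  have inj: "x = x'" if "\<rho> x y" "\<rho> x' y" for x x' y
  proof -
    note c = \<rho>(1,2)[OF that(1)] \<rho>(1)[OF that(2)]
    obtain w where w: "\<rho> w (\<ominus>\<^bsub>H'\<^esub> y)" using \<rho>(5) c by blast
    have "x \<oplus>\<^bsub>H\<^esub> w = \<zero>\<^bsub>H\<^esub>" "x' \<oplus>\<^bsub>H\<^esub> w = \<zero>\<^bsub>H\<^esub>"
      using \<rho>(3)[OF \<rho>(6)[OF that(1) w]] \<rho>(3)[OF \<rho>(6)[OF that(2) w]] c by (auto simp: H'.r_neg)
    then show ?thesis using H.add.right_cancel c \<rho>(1)[OF w] by metis
  qed
  define f where "f x = (THE y. \<rho> x y)" for x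
  have f: "\<rho> x (f x)" if "x \<in> carrier H" for x
    unfolding f_def by (rule theI') (use \<rho>(4)[OF that] fn in blast)
  have fI: "f x = y" if "\<rho> x y" for x y using fn f \<rho>(1) that by blast
  show ?thesis unfolding module_isomorphic_def
  proof (intro exI[of _ f] conjI ballI)
    show "bij_betw f (carrier H) (carrier H')"
      unfolding bij_betw_def inj_on_def
    proof (intro conjI ballI impI)
      show "x = x'" if "x \<in> carrier H" "x' \<in> carrier H" "f x = f x'" for x x'
        using f[OF that(1)] f[OF that(2)] that(3) inj by simp
      show "f ` carrier H = carrier H'"
      proof
        show "f ` carrier H \<subseteq> carrier H'" using f \<rho>(2) by blast
        show "carrier H' \<subseteq> f ` carrier H"
        proof
          fix y assume "y \<in> carrier H'"
          then obtain x where "\<rho> x y" using \<rho>(5) by blast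
          then show "y \<in> f ` carrier H" using fI \<rho>(1) by blast
        qed
      qed
    qed
    show "f (x \<oplus>\<^bsub>H\<^esub> y) = f x \<oplus>\<^bsub>H'\<^esub> f y" if "x \<in> carrier H" "y \<in> carrier H" for x y
      by (rule fI, rule \<rho>(6)) (use f that in auto)
    show "f (r \<odot>\<^bsub>H\<^esub> x) = r \<odot>\<^bsub>H'\<^esub> f x" if "r \<in> carrier R" "x \<in> carrier H" for r x
      by (rule fI, rule \<rho>(7)) (use f that in auto)
  qed
qed

lemma subquot_mod_isomorphic:
  assumes "subquotient R G Z B" "subquotient R G' Z' B'" "sub_iso R G Z B G' Z' B'"
  shows "module_isomorphic R (subquot_mod G Z B) (subquot_mod G' Z' B')"
proof -
  interpret G: subquotient R G Z B by fact
  interpret G': subquotient R G' Z' B' by fact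
  show ?thesis
    by (rule sub_iso_module_isomorphic[OF G.subquot_mod_abelian G'.subquot_mod_abelian])
      (rule sub_iso_trans[OF sub_iso_sym[OF G.sub_iso_subquot_mod] sub_iso_trans[OF assms(3) G'.sub_iso_subquot_mod]])
qed

section \<open>Relative homology of subcomplexes\<close>

locale chain_complex =
  fixes R :: "('r, 'x) ring_scheme" and G :: "nat \<Rightarrow> ('r, 'c) module" and d :: "nat \<Rightarrow> 'c \<Rightarrow> 'c"
  assumes ab: "abelian_group (G k)"
    and sm_closed: "r \<in> carrier R \<Longrightarrow> x \<in> carrier (G k) \<Longrightarrow> r \<odot>\<^bsub>G k\<^esub> x \<in> carrier (G k)"
    and sm_add: "r \<in> carrier R \<Longrightarrow> x \<in> carrier (G k) \<Longrightarrow> y \<in> carrier (G k) \<Longrightarrow>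
      r \<odot>\<^bsub>G k\<^esub> (x \<oplus>\<^bsub>G k\<^esub> y) = r \<odot>\<^bsub>G k\<^esub> x \<oplus>\<^bsub>G k\<^esub> r \<odot>\<^bsub>G k\<^esub> y"
    and d_closed: "x \<in> carrier (G (Suc k)) \<Longrightarrow> d k x \<in> carrier (G k)"
    and d_add: "x \<in> carrier (G (Suc k)) \<Longrightarrow> y \<in> carrier (G (Suc k)) \<Longrightarrow>
      d k (x \<oplus>\<^bsub>G (Suc k)\<^esub> y) = d k x \<oplus>\<^bsub>G k\<^esub> d k y"
    and d_sm: "r \<in> carrier R \<Longrightarrow> x \<in> carrier (G (Suc k)) \<Longrightarrow> d k (r \<odot>\<^bsub>G (Suc k)\<^esub> x) = r \<odot>\<^bsub>G k\<^esub> d k x"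
    and d_d: "x \<in> carrier (G (Suc (Suc k))) \<Longrightarrow> d k (d (Suc k) x) = \<zero>\<^bsub>G k\<^esub>"
begin

lemma d_zero: "d k \<zero>\<^bsub>G (Suc k)\<^esub> = \<zero>\<^bsub>G k\<^esub>"
proof -
  interpret S: abelian_group "G (Suc k)" by (rule ab)
  interpret G: abelian_group "G k" by (rule ab)
  show ?thesis by (rule G.double_eq_zero) (simp_all add: d_closed d_add[symmetric])
qed

lemma d_neg: "x \<in> carrier (G (Suc k)) \<Longrightarrow> d k (\<ominus>\<^bsub>G (Suc k)\<^esub> x) = \<ominus>\<^bsub>G k\<^esub> d k x"
proof -
  assume x: "x \<in> carrier (G (Suc k))"
  interpret S: abelian_group "G (Suc k)" by (rule ab)
  interpret G: abelian_group "G k" by (rule ab)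
  show ?thesis
    by (rule G.minus_equality[symmetric]) (simp_all add: x d_closed d_add[symmetric] S.l_neg d_zero)
qed

definition subcomplex :: "(nat \<Rightarrow> 'c set) \<Rightarrow> bool" where
  "subcomplex Y \<longleftrightarrow> (\<forall>k. Y k \<subseteq> carrier (G k) \<and> \<zero>\<^bsub>G k\<^esub> \<in> Y k \<and>
     (\<forall>x\<in>Y k. \<forall>y\<in>Y k. x \<oplus>\<^bsub>G k\<^esub> y \<in> Y k) \<and> (\<forall>x\<in>Y k. \<ominus>\<^bsub>G k\<^esub> x \<in> Y k) \<and>
     (\<forall>r\<in>carrier R. \<forall>x\<in>Y k. r \<odot>\<^bsub>G k\<^esub> x \<in> Y k) \<and> (\<forall>x\<in>Y (Suc k). d k x \<in> Y k))"

lemma subcomplexD: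
  assumes "subcomplex Y"
  shows "x \<in> Y k \<Longrightarrow> x \<in> carrier (G k)" "\<zero>\<^bsub>G k\<^esub> \<in> Y k"
    "x \<in> Y k \<Longrightarrow> y \<in> Y k \<Longrightarrow> x \<oplus>\<^bsub>G k\<^esub> y \<in> Y k" "x \<in> Y k \<Longrightarrow> \<ominus>\<^bsub>G k\<^esub> x \<in> Y k"
    "r \<in> carrier R \<Longrightarrow> x \<in> Y k \<Longrightarrow> r \<odot>\<^bsub>G k\<^esub> x \<in> Y k" "x \<in> Y (Suc k) \<Longrightarrow> d k x \<in> Y k"
  using assms unfolding subcomplex_def by blast+

text \<open>The preimages in \<open>Y\<close> of the cycles of Y/B; \<open>rel_bounds\<close> gives
  those of its boundaries. The homology of Y/B is thus described without forming Y/B.\<close>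

definition rel_cycles :: "(nat \<Rightarrow> 'c set) \<Rightarrow> (nat \<Rightarrow> 'c set) \<Rightarrow> nat \<Rightarrow> 'c set" where
  "rel_cycles Y B k = {x \<in> Y k. \<forall>j. k = Suc j \<longrightarrow> d j x \<in> B j}"

definition rel_bounds :: "(nat \<Rightarrow> 'c set) \<Rightarrow> (nat \<Rightarrow> 'c set) \<Rightarrow> nat \<Rightarrow> 'c set" where
  "rel_bounds Y B k = {d k g \<oplus>\<^bsub>G k\<^esub> m | g m. g \<in> Y (Suc k) \<and> m \<in> B k}"

definition acyclic :: "(nat \<Rightarrow> 'c set) \<Rightarrow> (nat \<Rightarrow> 'c set) \<Rightarrow> nat \<Rightarrow> bool" where
  "acyclic Y B k \<longleftrightarrow> rel_cycles Y B k \<subseteq> rel_bounds Y B k"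

definition cx_sum :: "(nat \<Rightarrow> 'c set) \<Rightarrow> (nat \<Rightarrow> 'c set) \<Rightarrow> nat \<Rightarrow> 'c set" where
  "cx_sum X B k = {x \<oplus>\<^bsub>G k\<^esub> m | x m. x \<in> X k \<and> m \<in> B k}"

lemma rel_cycles_add:
  assumes "subcomplex Y" "subcomplex B" "x \<in> rel_cycles Y B k" "y \<in> rel_cycles Y B k"
  shows "x \<oplus>\<^bsub>G k\<^esub> y \<in> rel_cycles Y B k"
  using assms(3,4) unfolding rel_cycles_def
  by (auto simp: subcomplexD[OF assms(1)] subcomplexD[OF assms(2)] d_add)

lemma rel_cycles_sm:
  assumes "subcomplex Y" "subcomplex B" "x \<in> rel_cycles Y B k" "r \<in> carrier R"
  shows "r \<odot>\<^bsub>G k\<^esub> x \<in> rel_cycles Y B k"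
  using assms(3,4) unfolding rel_cycles_def
  by (auto simp: subcomplexD[OF assms(1)] subcomplexD[OF assms(2)] d_sm)

context
  fixes X Y B :: "nat \<Rightarrow> 'c set"
  assumes X: "subcomplex X" and Y: "subcomplex Y" and B: "subcomplex B"
    and XY: "\<And>k. X k \<subseteq> Y k" and BY: "\<And>k. B k \<subseteq> Y k"
begin

lemma subcomplex_Int: "subcomplex (\<lambda>k. X k \<inter> B k)"
  using X B unfolding subcomplex_def by blast

lemma subcomplex_sum: "subcomplex (cx_sum X B)"
  unfolding subcomplex_def
proof (intro allI conjI ballI)
  fix k
  interpret G: abelian_group "G k" by (rule ab)
  note D = subcomplexD[OF X] subcomplexD[OF B]
  have mem: "u \<oplus>\<^bsub>G k\<^esub> m \<in> cx_sum X B k" if "u \<in> X k" "m \<in> B k" for u m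
    using that unfolding cx_sum_def by blast
  show "cx_sum X B k \<subseteq> carrier (G k)"
    unfolding cx_sum_def using D(1) D(7) G.a_closed by blast
  show "\<zero>\<^bsub>G k\<^esub> \<in> cx_sum X B k" using mem[OF D(2,8)] by simp
  show "\<ominus>\<^bsub>G k\<^esub> x \<in> cx_sum X B k" if "x \<in> cx_sum X B k" for x
  proof -
    from that obtain u m where u: "x = u \<oplus>\<^bsub>G k\<^esub> m" "u \<in> X k" "m \<in> B k" unfolding cx_sum_def by blast
    show ?thesis using mem[OF D(4)[OF u(2)] D(10)[OF u(3)]] u(1) by (simp add: G.minus_add D(1)[OF u(2)] D(7)[OF u(3)])
  qed
  show "r \<odot>\<^bsub>G k\<^esub> x \<in> cx_sum X B k" if "r \<in> carrier R" "x \<in> cx_sum X B k" for x r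
  proof -
    from that(2) obtain u m where u: "x = u \<oplus>\<^bsub>G k\<^esub> m" "u \<in> X k" "m \<in> B k" unfolding cx_sum_def by blast
    show ?thesis using mem[OF D(5)[OF that(1) u(2)] D(11)[OF that(1) u(3)]] u(1)
      by (simp add: sm_add[OF that(1) D(1)[OF u(2)] D(7)[OF u(3)]])
  qed
  show "d k x \<in> cx_sum X B k" if "x \<in> cx_sum X B (Suc k)" for x
  proof -
    from that obtain u m where u: "x = u \<oplus>\<^bsub>G (Suc k)\<^esub> m" "u \<in> X (Suc k)" "m \<in> B (Suc k)"
      unfolding cx_sum_def by blast
    show ?thesis using mem[OF D(6)[OF u(2)] D(12)[OF u(3)]] u(1)
      by (simp add: d_add[OF D(1)[OF u(2)] D(7)[OF u(3)]])
  qed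
  show "x \<oplus>\<^bsub>G k\<^esub> y \<in> cx_sum X B k" if xy: "x \<in> cx_sum X B k" "y \<in> cx_sum X B k" for x y
  proof -
    from xy obtain u m v l where u: "x = u \<oplus>\<^bsub>G k\<^esub> m" "y = v \<oplus>\<^bsub>G k\<^esub> l" "u \<in> X k" "v \<in> X k" "m \<in> B k" "l \<in> B k"
      unfolding cx_sum_def by blast
    then have "x \<oplus>\<^bsub>G k\<^esub> y = (u \<oplus>\<^bsub>G k\<^esub> v) \<oplus>\<^bsub>G k\<^esub> (m \<oplus>\<^bsub>G k\<^esub> l)"
      using D(1,7) by (simp add: G.a_ac)
    then show ?thesis using u D(3,9) unfolding cx_sum_def by blast
  qed
qed

text \<open>This is the value \<open>h\<close> of the connecting map at \<open>f\<close>. Applying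
  the differential once more to \<open>d k f\<close> gives zero, so the boundary of \<open>h\<close>
  is the negative of that of \<open>m\<close> and lies in \<open>B\<close>.\<close>

lemma split_cycle:
  assumes f: "f \<in> rel_cycles Y (cx_sum X B) (Suc k)"
  obtains h m where "h \<in> rel_cycles X (\<lambda>k. X k \<inter> B k) k" "m \<in> B k" "d k f = h \<oplus>\<^bsub>G k\<^esub> m"
proof -
  have fY: "f \<in> Y (Suc k)" using f by (simp add: rel_cycles_def)
  obtain h m where hm: "h \<in> X k" "m \<in> B k" "d k f = h \<oplus>\<^bsub>G k\<^esub> m"
    using f unfolding rel_cycles_def cx_sum_def by auto
  have "d j h \<in> X j \<inter> B j" if j: "k = Suc j" for j
  proof
    interpret G: abelian_group "G j" by (rule ab)
    show "d j h \<in> X j" using hm j subcomplexD(6)[OF X] by blast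
    have c: "h \<in> carrier (G (Suc j))" "m \<in> carrier (G (Suc j))"
      using hm j subcomplexD(1)[OF X] subcomplexD(1)[OF B] by auto
    have "d j h \<oplus>\<^bsub>G j\<^esub> d j m = \<zero>\<^bsub>G j\<^esub>"
      using d_d[of f j] subcomplexD(1)[OF Y fY] hm(3) j c by (simp add: d_add)
    then have "d j h = \<ominus>\<^bsub>G j\<^esub> d j m" using c by (simp add: d_closed G.minus_equality)
    then show "d j h \<in> B j" using subcomplexD(4,6)[OF B] hm(2) j by auto
  qed
  then show thesis using hm that unfolding rel_cycles_def by blast
qed

text \<open>The difference of \<open>f\<close> and \<open>x\<close> is a cycle modulo
  \<open>B\<close>, hence a boundary modulo \<open>B\<close>; putting \<open>x\<close> back costs
  only an element of \<open>X\<close>.\<close>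

lemma acyclic_sub:
  assumes ac: "acyclic Y B k" and f: "f \<in> Y k" and x: "x \<in> X k"
    and df: "\<And>j. k = Suc j \<Longrightarrow> \<exists>m\<in>B j. d j f = d j x \<oplus>\<^bsub>G j\<^esub> m"
  shows "f \<in> rel_bounds Y (cx_sum X B) k"
proof -
  interpret G: abelian_group "G k" by (rule ab)
  have c: "f \<in> carrier (G k)" "x \<in> carrier (G k)" "x \<in> Y k"
    using f x subcomplexD(1)[OF X] subcomplexD(1)[OF Y] XY[of k] by auto
  have "f \<oplus>\<^bsub>G k\<^esub> \<ominus>\<^bsub>G k\<^esub> x \<in> rel_cycles Y B k"
    unfolding rel_cycles_def
  proof (intro CollectI conjI allI impI)
    show "f \<oplus>\<^bsub>G k\<^esub> \<ominus>\<^bsub>G k\<^esub> x \<in> Y k" using f c subcomplexD[OF Y] by auto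
    fix j assume j: "k = Suc j"
    interpret J: abelian_group "G j" by (rule ab)
    obtain m where m: "m \<in> B j" "d j f = d j x \<oplus>\<^bsub>G j\<^esub> m" using df[OF j] by blast
    have "d j (f \<oplus>\<^bsub>G k\<^esub> \<ominus>\<^bsub>G k\<^esub> x) = (d j x \<oplus>\<^bsub>G j\<^esub> m) \<oplus>\<^bsub>G j\<^esub> \<ominus>\<^bsub>G j\<^esub> d j x"
      using c j m(2) G.a_inv_closed by (simp add: d_add d_neg)
    also have "\<dots> = m" using subcomplexD(1)[OF B m(1)] c j by (simp add: J.a_ac J.r_neg1 J.r_neg2 J.r_neg d_closed)
    finally show "d j (f \<oplus>\<^bsub>G k\<^esub> \<ominus>\<^bsub>G k\<^esub> x) \<in> B j" using m by simp
  qed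
  then obtain g m where gm: "g \<in> Y (Suc k)" "m \<in> B k" "f \<oplus>\<^bsub>G k\<^esub> \<ominus>\<^bsub>G k\<^esub> x = d k g \<oplus>\<^bsub>G k\<^esub> m"
    using ac unfolding acyclic_def rel_bounds_def by blast
  have gm': "d k g \<in> carrier (G k)" "m \<in> carrier (G k)"
    using gm subcomplexD(1)[OF Y] subcomplexD(1)[OF B] d_closed by auto
  have "f = (f \<oplus>\<^bsub>G k\<^esub> \<ominus>\<^bsub>G k\<^esub> x) \<oplus>\<^bsub>G k\<^esub> x" using c by (simp add: G.a_assoc G.l_neg)
  also have "\<dots> = d k g \<oplus>\<^bsub>G k\<^esub> (x \<oplus>\<^bsub>G k\<^esub> m)" using gm' c unfolding gm(3) by (simp add: G.a_ac)
  finally show ?thesis using gm x unfolding rel_bounds_def cx_sum_def by blast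
qed

text \<open>Long exact sequence of (X + B)/B inside Y/B, the former being X modulo its intersection
  with \<open>B\<close>. In degree 0 there is no lower term, and the homology of Y/(X + B) is a
  quotient of that of Y/B.\<close>

lemma acyclic_sum:
  assumes ac: "acyclic Y B k" and acX: "\<And>j. k = Suc j \<Longrightarrow> acyclic X (\<lambda>k. X k \<inter> B k) j"
  shows "acyclic Y (cx_sum X B) k"
  unfolding acyclic_def
proof
  fix f assume f: "f \<in> rel_cycles Y (cx_sum X B) k"
  then have fY: "f \<in> Y k" by (simp add: rel_cycles_def)
  show "f \<in> rel_bounds Y (cx_sum X B) k"
  proof (cases k)
    case 0 show ?thesis
      by (rule acyclic_sub[OF ac fY subcomplexD(2)[OF X]]) (use 0 in simp)
  next
    case (Suc j)
    interpret J: abelian_group "G j" by (rule ab)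
    obtain h m where hm: "h \<in> rel_cycles X (\<lambda>k. X k \<inter> B k) j" "m \<in> B j" "d j f = h \<oplus>\<^bsub>G j\<^esub> m"
      using split_cycle[of f j] f Suc by blast
    then obtain x l where x: "x \<in> X (Suc j)" "l \<in> X j \<inter> B j" "h = d j x \<oplus>\<^bsub>G j\<^esub> l"
      using acX[OF Suc] unfolding acyclic_def rel_bounds_def by blast
    have c: "d j x \<in> carrier (G j)" "l \<in> carrier (G j)" "m \<in> carrier (G j)"
      using x hm(2) subcomplexD(1)[OF X] subcomplexD(1)[OF B] d_closed by auto
    have "d j f = d j x \<oplus>\<^bsub>G j\<^esub> (l \<oplus>\<^bsub>G j\<^esub> m)" using hm(3) x(3) c by (simp add: J.a_assoc)
    moreover have "l \<oplus>\<^bsub>G j\<^esub> m \<in> B j" using x hm subcomplexD(3)[OF B] by blast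
    ultimately show ?thesis
      by (intro acyclic_sub[OF ac fY, of x]) (use Suc x in auto)
  qed
qed

text \<open>The connecting map of the same sequence. It is injective by \<open>ac\<close>. For
  surjectivity \<open>z\<close> asks only that the homology of the subcomplex go to zero in that of
  Y/B, not that the latter vanish; degree 0 of the first shift depends on this.\<close>

lemma connecting_iso:
  assumes ac: "acyclic Y B (Suc k)" and z: "rel_cycles X (\<lambda>k. X k \<inter> B k) k \<subseteq> rel_bounds Y B k"
  shows "sub_iso R (G (Suc k)) (rel_cycles Y (cx_sum X B) (Suc k)) (rel_bounds Y (cx_sum X B) (Suc k))
     (G k) (rel_cycles X (\<lambda>k. X k \<inter> B k) k) (rel_bounds X (\<lambda>k. X k \<inter> B k) k)"
proof -
  let ?\<rho> = "\<lambda>f h. f \<in> rel_cycles Y (cx_sum X B) (Suc k) \<and> h \<in> rel_cycles X (\<lambda>k. X k \<inter> B k) k \<and>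
     (\<exists>m\<in>B k. d k f = h \<oplus>\<^bsub>G k\<^esub> m)"
  interpret G: abelian_group "G k" by (rule ab)
  interpret S: abelian_group "G (Suc k)" by (rule ab)
  note cX = subcomplexD(1)[OF X] and cY = subcomplexD(1)[OF Y] and cB = subcomplexD(1)[OF B]
  have fY: "f \<in> Y (Suc k)" if "f \<in> rel_cycles Y (cx_sum X B) (Suc k)" for f
    using that by (simp add: rel_cycles_def)
  have hX: "h \<in> X k" if "h \<in> rel_cycles X (\<lambda>k. X k \<inter> B k) k" for h
    using that by (simp add: rel_cycles_def)
  show ?thesis
  proof (rule sub_isoI[of ?\<rho>])
    fix f h assume \<rho>: "?\<rho> f h"
    then obtain m where m: "m \<in> B k" "d k f = h \<oplus>\<^bsub>G k\<^esub> m" and h: "h \<in> X k" and f: "f \<in> Y (Suc k)" using hX fY by blast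
    show "h \<in> rel_bounds X (\<lambda>k. X k \<inter> B k) k" if "f \<in> rel_bounds Y (cx_sum X B) (Suc k)"
    proof -
      from that obtain g x l where g: "g \<in> Y (Suc (Suc k))" "x \<in> X (Suc k)" "l \<in> B (Suc k)"
         "f = d (Suc k) g \<oplus>\<^bsub>G (Suc k)\<^esub> (x \<oplus>\<^bsub>G (Suc k)\<^esub> l)"
        unfolding rel_bounds_def cx_sum_def by blast
      note c = cY[OF g(1)] cX[OF g(2)] cB[OF g(3)] d_closed[OF cX[OF g(2)]] d_closed[OF cB[OF g(3)]]
        d_closed[OF cY[OF g(1)]] cB[OF m(1)] cX[OF h]
      have "h \<oplus>\<^bsub>G k\<^esub> m = d k x \<oplus>\<^bsub>G k\<^esub> d k l"
        using m(2) c unfolding g(4) by (simp add: d_add d_d)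
      then have "(h \<oplus>\<^bsub>G k\<^esub> m) \<oplus>\<^bsub>G k\<^esub> \<ominus>\<^bsub>G k\<^esub> m = (d k x \<oplus>\<^bsub>G k\<^esub> d k l) \<oplus>\<^bsub>G k\<^esub> \<ominus>\<^bsub>G k\<^esub> m" by simp
      then have hh: "h = d k x \<oplus>\<^bsub>G k\<^esub> (d k l \<oplus>\<^bsub>G k\<^esub> \<ominus>\<^bsub>G k\<^esub> m)"
        using c by (simp add: G.a_assoc G.r_neg)
      have b: "d k l \<oplus>\<^bsub>G k\<^esub> \<ominus>\<^bsub>G k\<^esub> m \<in> B k"
        using subcomplexD(3,4,6)[OF B] g(3) m(1) by blast
      \<comment> \<open>The remainder lies in \<open>B\<close> by construction and in
        \<open>X\<close> as the difference of \<open>h\<close> and \<open>d k x\<close>, so it is an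
        admissible denominator term.\<close>
      have "\<ominus>\<^bsub>G k\<^esub> d k x \<oplus>\<^bsub>G k\<^esub> h = d k l \<oplus>\<^bsub>G k\<^esub> \<ominus>\<^bsub>G k\<^esub> m"
        using c by (subst hh) (simp add: G.a_assoc[symmetric] G.l_neg)
      moreover have "\<ominus>\<^bsub>G k\<^esub> d k x \<oplus>\<^bsub>G k\<^esub> h \<in> X k"
        using subcomplexD(3,4,6)[OF X] g(2) h by blast
      ultimately show ?thesis using hh b g(2) unfolding rel_bounds_def by auto
    qed
    show "f \<in> rel_bounds Y (cx_sum X B) (Suc k)" if "h \<in> rel_bounds X (\<lambda>k. X k \<inter> B k) k"
    proof -
      from that obtain x l where x: "x \<in> X (Suc k)" "l \<in> B k" "h = d k x \<oplus>\<^bsub>G k\<^esub> l"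
        unfolding rel_bounds_def by blast
      note c = d_closed[OF cX[OF x(1)]] cB[OF x(2)] cB[OF m(1)]
      have "d k f = d k x \<oplus>\<^bsub>G k\<^esub> (l \<oplus>\<^bsub>G k\<^esub> m)" using m(2) c unfolding x(3) by (simp add: G.a_assoc)
      moreover have "l \<oplus>\<^bsub>G k\<^esub> m \<in> B k" using subcomplexD(3)[OF B] x m by blast
      ultimately show ?thesis by (intro acyclic_sub[OF ac f x(1)]) auto
    qed
  next
    show "\<exists>h. ?\<rho> f h" if "f \<in> rel_cycles Y (cx_sum X B) (Suc k)" for f
      using split_cycle[OF that] that by metis
    show "\<exists>f. ?\<rho> f h" if h: "h \<in> rel_cycles X (\<lambda>k. X k \<inter> B k) k" for h
    proof -
      obtain g m where g: "g \<in> Y (Suc k)" "m \<in> B k" "h = d k g \<oplus>\<^bsub>G k\<^esub> m"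
        using h z unfolding rel_bounds_def by blast
      note c = d_closed[OF cY[OF g(1)]] cB[OF g(2)]
      have dg: "d k g = h \<oplus>\<^bsub>G k\<^esub> \<ominus>\<^bsub>G k\<^esub> m" using c unfolding g(3) by (simp add: G.a_assoc G.r_neg)
      moreover have m: "\<ominus>\<^bsub>G k\<^esub> m \<in> B k" using subcomplexD(4)[OF B] g by blast
      ultimately have "d k g \<in> cx_sum X B k" using hX[OF h] unfolding cx_sum_def by blast
      then have "g \<in> rel_cycles Y (cx_sum X B) (Suc k)" using g(1) by (simp add: rel_cycles_def)
      then show ?thesis using dg m h by blast
    qed
    show "?\<rho> (f \<oplus>\<^bsub>G (Suc k)\<^esub> f') (h \<oplus>\<^bsub>G k\<^esub> h')" if \<rho>: "?\<rho> f h" and \<rho>': "?\<rho> f' h'" for f f' h h'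
    proof (intro conjI)
      show "f \<oplus>\<^bsub>G (Suc k)\<^esub> f' \<in> rel_cycles Y (cx_sum X B) (Suc k)"
        by (rule rel_cycles_add[OF Y subcomplex_sum]) (use \<rho> \<rho>' in auto)
      show "h \<oplus>\<^bsub>G k\<^esub> h' \<in> rel_cycles X (\<lambda>k. X k \<inter> B k) k"
        by (rule rel_cycles_add[OF X subcomplex_Int]) (use \<rho> \<rho>' in auto)
      from \<rho> \<rho>' obtain m m' where m: "m \<in> B k" "d k f = h \<oplus>\<^bsub>G k\<^esub> m" "m' \<in> B k" "d k f' = h' \<oplus>\<^bsub>G k\<^esub> m'" by blast
      have c: "f \<in> carrier (G (Suc k))" "f' \<in> carrier (G (Suc k))" "h \<in> carrier (G k)" "h' \<in> carrier (G k)"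
        using \<rho> \<rho>' fY hX cX cY by blast+
      have "d k (f \<oplus>\<^bsub>G (Suc k)\<^esub> f') = (h \<oplus>\<^bsub>G k\<^esub> h') \<oplus>\<^bsub>G k\<^esub> (m \<oplus>\<^bsub>G k\<^esub> m')"
        using c cB[OF m(1)] cB[OF m(3)] m by (simp add: d_add G.a_ac)
      then show "\<exists>m\<in>B k. d k (f \<oplus>\<^bsub>G (Suc k)\<^esub> f') = h \<oplus>\<^bsub>G k\<^esub> h' \<oplus>\<^bsub>G k\<^esub> m"
        using subcomplexD(3)[OF B] m by blast
    qed
    show "?\<rho> (r \<odot>\<^bsub>G (Suc k)\<^esub> f) (r \<odot>\<^bsub>G k\<^esub> h)" if r: "r \<in> carrier R" and \<rho>: "?\<rho> f h" for r f h
    proof (intro conjI)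
      show "r \<odot>\<^bsub>G (Suc k)\<^esub> f \<in> rel_cycles Y (cx_sum X B) (Suc k)"
        by (rule rel_cycles_sm[OF Y subcomplex_sum _ r]) (use \<rho> in auto)
      show "r \<odot>\<^bsub>G k\<^esub> h \<in> rel_cycles X (\<lambda>k. X k \<inter> B k) k"
        by (rule rel_cycles_sm[OF X subcomplex_Int _ r]) (use \<rho> in auto)
      from \<rho> obtain m where m: "m \<in> B k" "d k f = h \<oplus>\<^bsub>G k\<^esub> m" by blast
      have c: "f \<in> carrier (G (Suc k))" "h \<in> carrier (G k)" using \<rho> fY hX cX cY by blast+
      have "d k (r \<odot>\<^bsub>G (Suc k)\<^esub> f) = r \<odot>\<^bsub>G k\<^esub> h \<oplus>\<^bsub>G k\<^esub> r \<odot>\<^bsub>G k\<^esub> m"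
        using c cB[OF m(1)] m r by (simp add: d_sm sm_add)
      then show "\<exists>m\<in>B k. d k (r \<odot>\<^bsub>G (Suc k)\<^esub> f) = r \<odot>\<^bsub>G k\<^esub> h \<oplus>\<^bsub>G k\<^esub> m"
        using subcomplexD(5)[OF B r] m by blast
    qed
  qed blast+
qed

end

end

declare res_basis.simps [simp del]

section \<open>Chains with values in left ideals\<close>

definition left_ideal :: "('a, 'x) ring_scheme \<Rightarrow> 'a set \<Rightarrow> bool" where
  "left_ideal A Y \<longleftrightarrow> Y \<subseteq> carrier A \<and> \<zero>\<^bsub>A\<^esub> \<in> Y \<and> (\<forall>x\<in>Y. \<forall>y\<in>Y. x \<oplus>\<^bsub>A\<^esub> y \<in> Y) \<and>
     (\<forall>x\<in>carrier A. \<forall>y\<in>Y. x \<otimes>\<^bsub>A\<^esub> y \<in> Y)"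

lemma left_idealD:
  assumes "left_ideal A Y"
  shows "x \<in> Y \<Longrightarrow> x \<in> carrier A" "\<zero>\<^bsub>A\<^esub> \<in> Y" "x \<in> Y \<Longrightarrow> y \<in> Y \<Longrightarrow> x \<oplus>\<^bsub>A\<^esub> y \<in> Y"
    "x \<in> carrier A \<Longrightarrow> y \<in> Y \<Longrightarrow> x \<otimes>\<^bsub>A\<^esub> y \<in> Y"
  using assms unfolding left_ideal_def by auto

lemma (in ring) left_ideal_minus:
  assumes "left_ideal R Y" "x \<in> Y" shows "\<ominus> x \<in> Y"
proof -
  have "\<ominus> x = (\<ominus> \<one>) \<otimes> x" using left_idealD(1)[OF assms] by (simp add: l_minus)
  then show ?thesis using left_idealD(4)[OF assms(1) _ assms(2)] by simp
qed

text \<open>The modules of the resolution regarded over the ground ring, since the isomorphisms to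
  be produced are only \<open>R\<close>-linear.\<close>

definition res_scal :: "('r, 'a) module \<Rightarrow> ('a, 'l) module \<Rightarrow> nat \<Rightarrow> ('r, ('a, 'l) syz \<Rightarrow> 'a) module" where
  "res_scal A L k =
     \<lparr>carrier = carrier (res_mod A L k), monoid.mult = undefined, one = undefined,
      ring.zero = ring.zero (res_mod A L k), ring.add = ring.add (res_mod A L k),
      smult = (\<lambda>r. smult (res_mod A L k) (r \<odot>\<^bsub>A\<^esub> \<one>\<^bsub>A\<^esub>))\<rparr>"

text \<open>As the modules of the resolution are free, tensoring them with a left ideal
  \<open>Y\<close> gives the functions with values in \<open>Y\<close>, a submodule of all
  functions.\<close>

definition chain :: "('r, 'a) module \<Rightarrow> ('a, 'l) module \<Rightarrow> 'a set \<Rightarrow> nat \<Rightarrow> (('a, 'l) syz \<Rightarrow> 'a) set" where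
  "chain A L Y k = {f \<in> carrier (res_mod A L k). \<forall>b. f b \<in> Y}"

lemma res_scal_simps:
  "carrier (res_scal A L k) = carrier (res_mod A L k)"
  "\<zero>\<^bsub>res_scal A L k\<^esub> = (\<lambda>b. \<zero>\<^bsub>A\<^esub>)"
  "f \<oplus>\<^bsub>res_scal A L k\<^esub> g = (\<lambda>b. f b \<oplus>\<^bsub>A\<^esub> g b)"
  "r \<odot>\<^bsub>res_scal A L k\<^esub> f = (\<lambda>b. f b \<otimes>\<^bsub>A\<^esub> (r \<odot>\<^bsub>A\<^esub> \<one>\<^bsub>A\<^esub>))"
  by (simp_all add: res_scal_def free_rmod_simps)

locale resolution =
  fixes R :: "('r, 'x) ring_scheme" and A :: "('r, 'a) module" and L :: "('a, 'l) module"
  assumes L: "right_module A L"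
    and scalar_closed: "r \<in> carrier R \<Longrightarrow> r \<odot>\<^bsub>A\<^esub> \<one>\<^bsub>A\<^esub> \<in> carrier A"
    and scalar_central: "r \<in> carrier R \<Longrightarrow> x \<in> carrier A \<Longrightarrow>
      x \<otimes>\<^bsub>A\<^esub> (r \<odot>\<^bsub>A\<^esub> \<one>\<^bsub>A\<^esub>) = (r \<odot>\<^bsub>A\<^esub> \<one>\<^bsub>A\<^esub>) \<otimes>\<^bsub>A\<^esub> x"
begin

sublocale A: ring A by (rule res_ring[OF L])

lemma F: "right_module A (free_rmod A B)" for B :: "'b set"
  by (rule free_rmod_right_module[OF A.ring_axioms])

lemma bd_add:
  assumes f: "f \<in> carrier (res_mod A L (Suc k))" and g: "g \<in> carrier (res_mod A L (Suc k))"
  shows "res_bd A (\<lambda>b. f b \<oplus>\<^bsub>A\<^esub> g b) = (\<lambda>b. res_bd A f b \<oplus>\<^bsub>A\<^esub> res_bd A g b)"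
proof -
  interpret F1: right_module A "res_mod A L (Suc k)" by (rule F)
  show ?thesis
    using lin_ext_add[OF A.ring_axioms F res_bd_vals[OF L] f g]
      res_bd_restrict[OF L f] res_bd_restrict[OF L g] res_bd_restrict[OF L F1.M.a_closed[OF f g]]
    by (simp only: free_rmod_simps)
qed

lemma bd_smult:
  assumes f: "f \<in> carrier (res_mod A L (Suc k))" and a: "a \<in> carrier A"
  shows "res_bd A (\<lambda>b. f b \<otimes>\<^bsub>A\<^esub> a) = (\<lambda>b. res_bd A f b \<otimes>\<^bsub>A\<^esub> a)"
proof -
  interpret F1: right_module A "res_mod A L (Suc k)" by (rule F)
  show ?thesis
    using lin_ext_smult[OF A.ring_axioms F res_bd_vals[OF L] f a]
      res_bd_restrict[OF L f] res_bd_restrict[OF L F1.smult_closed[OF a f]]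
    by (simp only: free_rmod_simps)
qed

lemma aug_add:
  assumes f: "f \<in> carrier (res_mod A L 0)" and g: "g \<in> carrier (res_mod A L 0)"
  shows "res_aug A L (\<lambda>b. f b \<oplus>\<^bsub>A\<^esub> g b) = res_aug A L f \<oplus>\<^bsub>L\<^esub> res_aug A L g"
  using lin_ext_add[OF A.ring_axioms L res_aug_vals[OF L] f g] by (simp only: free_rmod_simps res_aug_def)

lemma aug_smult:
  assumes f: "f \<in> carrier (res_mod A L 0)" and a: "a \<in> carrier A"
  shows "res_aug A L (\<lambda>b. f b \<otimes>\<^bsub>A\<^esub> a) = a \<odot>\<^bsub>L\<^esub> res_aug A L f"
  using lin_ext_smult[OF A.ring_axioms L res_aug_vals[OF L] f a] by (simp only: free_rmod_simps res_aug_def)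

lemma aug_closed: "f \<in> carrier (res_mod A L 0) \<Longrightarrow> res_aug A L f \<in> carrier L"
  using res_aug_surj[OF L] by blast

lemma bd_bd:
  assumes "f \<in> carrier (res_mod A L (Suc (Suc k)))"
  shows "res_bd A (res_bd A f) = (\<lambda>b. \<zero>\<^bsub>A\<^esub>)"
  using res_exact[OF L, of k] assms by (auto simp: free_rmod_simps)

lemma free_rmod_add:
  assumes "f \<in> carrier (free_rmod A B)" "g \<in> carrier (free_rmod A B)"
  shows "(\<lambda>b. f b \<oplus>\<^bsub>A\<^esub> g b) \<in> carrier (free_rmod A B)"
proof -
  interpret F1: right_module A "free_rmod A B" by (rule F)
  show ?thesis using F1.M.a_closed[OF assms] by (simp only: free_rmod_simps)
qed

lemma free_rmod_smult:
  assumes "f \<in> carrier (free_rmod A B)" "a \<in> carrier A"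
  shows "(\<lambda>b. f b \<otimes>\<^bsub>A\<^esub> a) \<in> carrier (free_rmod A B)"
proof -
  interpret F1: right_module A "free_rmod A B" by (rule F)
  show ?thesis using F1.smult_closed[OF assms(2,1)] by (simp only: free_rmod_simps)
qed

lemma res_scal_abelian: "abelian_group (res_scal A L k)"
proof -
  interpret F1: right_module A "res_mod A L k" by (rule F)
  have c: "carrier (res_scal A L k) = carrier (res_mod A L k)" "ring.add (res_scal A L k) = ring.add (res_mod A L k)"
    "\<zero>\<^bsub>res_scal A L k\<^esub> = \<zero>\<^bsub>res_mod A L k\<^esub>"
    by (simp_all add: res_scal_def)
  show ?thesis
  proof (rule abelian_groupI)
    fix x assume "x \<in> carrier (res_scal A L k)"
    then show "\<exists>y\<in>carrier (res_scal A L k). y \<oplus>\<^bsub>res_scal A L k\<^esub> x = \<zero>\<^bsub>res_scal A L k\<^esub>"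
      unfolding c by (intro bexI[of _ "\<ominus>\<^bsub>res_mod A L k\<^esub> x"]) (simp_all add: F1.M.l_neg)
  qed (unfold c, simp_all add: F1.M.a_ac)
qed

lemma res_scal_smult_closed:
  "r \<in> carrier R \<Longrightarrow> f \<in> carrier (res_scal A L k) \<Longrightarrow> r \<odot>\<^bsub>res_scal A L k\<^esub> f \<in> carrier (res_scal A L k)"
  using free_rmod_smult scalar_closed unfolding res_scal_simps by blast

lemma res_scal_smult_add:
  assumes "r \<in> carrier R" "f \<in> carrier (res_scal A L k)" "g \<in> carrier (res_scal A L k)"
  shows "r \<odot>\<^bsub>res_scal A L k\<^esub> (f \<oplus>\<^bsub>res_scal A L k\<^esub> g) = r \<odot>\<^bsub>res_scal A L k\<^esub> f \<oplus>\<^bsub>res_scal A L k\<^esub> r \<odot>\<^bsub>res_scal A L k\<^esub> g"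
  using assms scalar_closed[OF assms(1)] free_rmodD(1)[of f A] free_rmodD(1)[of g A]
  unfolding res_scal_simps by (simp add: A.l_distr)

sublocale chain_complex R "res_scal A L" "\<lambda>k. res_bd A"
proof (rule chain_complex.intro, goal_cases)
  case 1 show ?case by (rule res_scal_abelian)
next
  case 2 then show ?case by (rule res_scal_smult_closed)
next
  case 3 then show ?case by (rule res_scal_smult_add)
next
  case 4 then show ?case using res_bd_closed[OF L] unfolding res_scal_simps by blast
next
  case 5 then show ?case using bd_add unfolding res_scal_simps by blast
next
  case 6 then show ?case using bd_smult scalar_closed unfolding res_scal_simps by blast
next
  case 7 then show ?case using bd_bd unfolding res_scal_simps by blast
qed

lemma res_scal_neg:
  assumes f: "f \<in> carrier (res_mod A L k)"
  shows "\<ominus>\<^bsub>res_scal A L k\<^esub> f = (\<lambda>b. \<ominus>\<^bsub>A\<^esub> f b)"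
proof -
  interpret G: abelian_group "res_scal A L k" by (rule res_scal_abelian)
  note D = free_rmodD[OF f]
  have "(\<lambda>b. \<ominus>\<^bsub>A\<^esub> f b) \<in> carrier (res_mod A L k)"
    by (rule free_rmodI[where C = "{b. f b \<noteq> \<zero>\<^bsub>A\<^esub>}"]) (use D in auto)
  then show ?thesis
    by (intro G.minus_equality) (use f D in \<open>auto simp: res_scal_simps A.l_neg\<close>)
qed

lemma chainD: "f \<in> chain A L Y k \<Longrightarrow> f \<in> carrier (res_mod A L k)" "f \<in> chain A L Y k \<Longrightarrow> f b \<in> Y"
  by (auto simp: chain_def)

text \<open>In a summand of the boundary the coefficient \<open>f t\<close> is multiplied from the
  left by the values of the basis image, and a left ideal absorbs such factors.\<close>

lemma bd_chain:
  assumes Y: "left_ideal A Y" and f: "f \<in> chain A L Y (Suc k)"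
  shows "res_bd A f \<in> chain A L Y k"
proof -
  interpret F1: right_module A "res_mod A L k" by (rule F)
  let ?\<phi> = "\<lambda>t. case t of Gen x \<Rightarrow> (\<lambda>b. \<zero>\<^bsub>A\<^esub>) | Syz xs \<Rightarrow> lin_comb A xs"
  note c = chainD(1)[OF f]
  have "(\<Oplus>\<^bsub>res_mod A L k\<^esub>t\<in>C. f t \<odot>\<^bsub>res_mod A L k\<^esub> ?\<phi> t) \<in> chain A L Y k"
    if "finite C" "C \<subseteq> res_basis A L (Suc k)" for C
    using that
  proof (induct C)
    case empty then show ?case by (simp add: chain_def free_rmod_simps left_idealD(2)[OF Y]) (simp add: free_rmod_def)
  next
    case (insert t C)
    have \<phi>: "?\<phi> u \<in> carrier (res_mod A L k)" if "u = t \<or> u \<in> C" for u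
      by (rule res_bd_vals[OF L]) (use that insert.prems in auto)
    have sm: "f u \<odot>\<^bsub>res_mod A L k\<^esub> ?\<phi> u \<in> carrier (res_mod A L k)" if "u \<in> insert t C" for u
      by (rule F1.smult_closed[OF free_rmodD(1)[OF c] \<phi>[of u]]) (use that in simp)
    have eq: "(\<Oplus>\<^bsub>res_mod A L k\<^esub>t\<in>insert t C. f t \<odot>\<^bsub>res_mod A L k\<^esub> ?\<phi> t)
       = f t \<odot>\<^bsub>res_mod A L k\<^esub> ?\<phi> t \<oplus>\<^bsub>res_mod A L k\<^esub> (\<Oplus>\<^bsub>res_mod A L k\<^esub>t\<in>C. f t \<odot>\<^bsub>res_mod A L k\<^esub> ?\<phi> t)"
    proof (rule F1.M.finsum_insert[OF insert.hyps(1,2)])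
      show "(\<lambda>t. f t \<odot>\<^bsub>res_mod A L k\<^esub> ?\<phi> t) \<in> C \<rightarrow> carrier (res_mod A L k)"
        using sm by (intro funcsetI) simp
      show "f t \<odot>\<^bsub>res_mod A L k\<^esub> ?\<phi> t \<in> carrier (res_mod A L k)" by (rule sm) simp
    qed
    have IH: "(\<Oplus>\<^bsub>res_mod A L k\<^esub>t\<in>C. f t \<odot>\<^bsub>res_mod A L k\<^esub> ?\<phi> t) \<in> chain A L Y k"
      by (rule insert.hyps(3)) (use insert.prems in simp)
    have v: "(f t \<odot>\<^bsub>res_mod A L k\<^esub> ?\<phi> t) b \<in> Y" for b
      unfolding free_rmod_simps
      by (rule left_idealD(4)[OF Y free_rmodD(1)[OF \<phi>[of t]] chainD(2)[OF f]]) simp_all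
    show ?case unfolding eq
    proof (unfold chain_def, intro CollectI conjI allI)
      show "f t \<odot>\<^bsub>res_mod A L k\<^esub> ?\<phi> t \<oplus>\<^bsub>res_mod A L k\<^esub> (\<Oplus>\<^bsub>res_mod A L k\<^esub>t\<in>C. f t \<odot>\<^bsub>res_mod A L k\<^esub> ?\<phi> t) \<in> carrier (res_mod A L k)"
        by (rule F1.M.a_closed[OF sm chainD(1)[OF IH]]) simp
      show "(f t \<odot>\<^bsub>res_mod A L k\<^esub> ?\<phi> t \<oplus>\<^bsub>res_mod A L k\<^esub> (\<Oplus>\<^bsub>res_mod A L k\<^esub>t\<in>C. f t \<odot>\<^bsub>res_mod A L k\<^esub> ?\<phi> t)) b \<in> Y" for b
        unfolding free_rmod_simps(2) by (rule left_idealD(3)[OF Y v chainD(2)[OF IH]])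
    qed
  qed
  then show ?thesis unfolding res_bd_restrict[OF L c] lin_ext_def using free_rmodD[OF c] by simp
qed

lemma chain_subcomplex:
  assumes Y: "left_ideal A Y" shows "subcomplex (chain A L Y)"
  unfolding subcomplex_def
proof (intro allI conjI ballI)
  fix k
  note Y' = left_idealD[OF Y] and s = res_scal_simps
  show "chain A L Y k \<subseteq> carrier (res_scal A L k)" by (auto simp: chain_def s)
  show "\<zero>\<^bsub>res_scal A L k\<^esub> \<in> chain A L Y k" by (simp add: chain_def s Y') (simp add: free_rmod_def)
  show "f \<oplus>\<^bsub>res_scal A L k\<^esub> g \<in> chain A L Y k" if "f \<in> chain A L Y k" "g \<in> chain A L Y k" for f g
    using that free_rmod_add Y' by (auto simp: chain_def s)
  show "\<ominus>\<^bsub>res_scal A L k\<^esub> f \<in> chain A L Y k" if "f \<in> chain A L Y k" for f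
  proof -
    interpret G: abelian_group "res_scal A L k" by (rule res_scal_abelian)
    have "\<ominus>\<^bsub>res_scal A L k\<^esub> f \<in> carrier (res_mod A L k)" using that G.a_inv_closed by (simp add: chain_def s)
    then show ?thesis using that A.left_ideal_minus[OF Y] by (auto simp: chain_def res_scal_neg)
  qed
  show "r \<odot>\<^bsub>res_scal A L k\<^esub> f \<in> chain A L Y k" if "r \<in> carrier R" "f \<in> chain A L Y k" for r f
  proof -
    have "(\<lambda>b. f b \<otimes>\<^bsub>A\<^esub> (r \<odot>\<^bsub>A\<^esub> \<one>\<^bsub>A\<^esub>)) \<in> carrier (res_mod A L k)"
      by (rule free_rmod_smult) (use that scalar_closed in \<open>auto simp: chain_def\<close>)
    \<comment> \<open>Scalars multiply from the right; a left ideal admits them because they are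
      central.\<close>
    then show ?thesis using that scalar_closed[OF that(1)] Y' unfolding chain_def s by (simp add: scalar_central)
  qed
  show "res_bd A f \<in> chain A L Y k" if "f \<in> chain A L Y (Suc k)" for f
    by (rule bd_chain[OF Y that])
qed

lemma chain_Int: "(\<lambda>k. chain A L X k \<inter> chain A L Y k) = chain A L (X \<inter> Y)"
  by (auto simp: chain_def)

lemma chain_mono: "X \<subseteq> Y \<Longrightarrow> chain A L X k \<subseteq> chain A L Y k"
  by (auto simp: chain_def)

lemma chain_sum:
  assumes X: "left_ideal A X" and Y: "left_ideal A Y"
  shows "chain A L {x \<oplus>\<^bsub>A\<^esub> y | x y. x \<in> X \<and> y \<in> Y} = cx_sum (chain A L X) (chain A L Y)"
proof (rule ext, intro Set.set_eqI iffI)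
  fix k f assume f: "f \<in> cx_sum (chain A L X) (chain A L Y) k"
  then show "f \<in> chain A L {x \<oplus>\<^bsub>A\<^esub> y | x y. x \<in> X \<and> y \<in> Y} k"
    using free_rmod_add unfolding cx_sum_def chain_def res_scal_simps by blast
next
  fix k f assume f: "f \<in> chain A L {x \<oplus>\<^bsub>A\<^esub> y | x y. x \<in> X \<and> y \<in> Y} k"
  note D = free_rmodD[OF chainD(1)[OF f]]
  \<comment> \<open>Both components are chosen zero wherever \<open>f\<close> vanishes, so that they
    inherit its finite support.\<close>
  have "\<exists>x y. x \<in> X \<and> y \<in> Y \<and> f b = x \<oplus>\<^bsub>A\<^esub> y \<and> (f b = \<zero>\<^bsub>A\<^esub> \<longrightarrow> x = \<zero>\<^bsub>A\<^esub> \<and> y = \<zero>\<^bsub>A\<^esub>)" for b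
  proof (cases "f b = \<zero>\<^bsub>A\<^esub>")
    case True then show ?thesis using left_idealD(2)[OF X] left_idealD(2)[OF Y] by auto
  next
    case False then show ?thesis using chainD(2)[OF f, of b] by blast
  qed
  then obtain g h where gh: "\<And>b. g b \<in> X" "\<And>b. h b \<in> Y" "\<And>b. f b = g b \<oplus>\<^bsub>A\<^esub> h b"
     "\<And>b. f b = \<zero>\<^bsub>A\<^esub> \<Longrightarrow> g b = \<zero>\<^bsub>A\<^esub>" "\<And>b. f b = \<zero>\<^bsub>A\<^esub> \<Longrightarrow> h b = \<zero>\<^bsub>A\<^esub>" by metis
  have "g \<in> carrier (res_mod A L k)"
  proof (rule free_rmodI[OF _ _ D(2,3)])
    show "g b \<in> carrier A" for b by (rule left_idealD(1)[OF X gh(1)])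
    show "b \<in> {b. f b \<noteq> \<zero>\<^bsub>A\<^esub>}" if "g b \<noteq> \<zero>\<^bsub>A\<^esub>" for b using gh(4) that by blast
  qed
  then have g: "g \<in> chain A L X k" using gh(1) by (simp add: chain_def)
  have "h \<in> carrier (res_mod A L k)"
  proof (rule free_rmodI[OF _ _ D(2,3)])
    show "h b \<in> carrier A" for b by (rule left_idealD(1)[OF Y gh(2)])
    show "b \<in> {b. f b \<noteq> \<zero>\<^bsub>A\<^esub>}" if "h b \<noteq> \<zero>\<^bsub>A\<^esub>" for b using gh(5) that by blast
  qed
  then have h: "h \<in> chain A L Y k" using gh(2) by (simp add: chain_def)
  have "f = (\<lambda>b. g b \<oplus>\<^bsub>A\<^esub> h b)" using gh(3) by (rule ext)
  then show "f \<in> cx_sum (chain A L X) (chain A L Y) k"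
    unfolding cx_sum_def res_scal_simps using g h by blast
qed

lemma exact_Suc:
  assumes "f \<in> carrier (res_mod A L (Suc k))" "res_bd A f = (\<lambda>b. \<zero>\<^bsub>A\<^esub>)"
  obtains g where "g \<in> carrier (res_mod A L (Suc (Suc k)))" "res_bd A g = f"
proof -
  have "f \<in> res_bd A ` carrier (res_mod A L (Suc (Suc k)))"
    unfolding res_exact[OF L, of k] using assms by (simp add: free_rmod_simps)
  then show thesis using that by blast
qed

lemma exact_0:
  assumes "f \<in> carrier (res_mod A L 0)" "res_aug A L f = \<zero>\<^bsub>L\<^esub>"
  obtains g where "g \<in> carrier (res_mod A L (Suc 0))" "res_bd A g = f"
proof -
  have "f \<in> res_bd A ` carrier (res_mod A L (Suc 0))"
    unfolding res_exact_aug[OF L] using assms by simp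
  then show thesis using that by blast
qed

lemma aug_zero:
  assumes f: "f \<in> carrier (res_mod A L 0)" and z: "\<And>b x. x \<in> carrier L \<Longrightarrow> f b \<odot>\<^bsub>L\<^esub> x = \<zero>\<^bsub>L\<^esub>"
  shows "res_aug A L f = \<zero>\<^bsub>L\<^esub>"
proof -
  interpret L: right_module A L by (rule L)
  have "(\<Oplus>\<^bsub>L\<^esub>b\<in>{b. f b \<noteq> \<zero>\<^bsub>A\<^esub>}. f b \<odot>\<^bsub>L\<^esub> (case b of Gen x \<Rightarrow> x | Syz xs \<Rightarrow> \<zero>\<^bsub>L\<^esub>))
    = (\<Oplus>\<^bsub>L\<^esub>b\<in>{b. f b \<noteq> \<zero>\<^bsub>A\<^esub>}. \<zero>\<^bsub>L\<^esub>)"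
  proof (rule L.M.finsum_cong')
    fix b assume "b \<in> {b. f b \<noteq> \<zero>\<^bsub>A\<^esub>}"
    then have "b \<in> res_basis A L 0" using free_rmodD(3)[OF f] by blast
    then show "f b \<odot>\<^bsub>L\<^esub> (case b of Gen x \<Rightarrow> x | Syz xs \<Rightarrow> \<zero>\<^bsub>L\<^esub>) = \<zero>\<^bsub>L\<^esub>"
      by (intro z res_aug_vals[OF L])
  qed auto
  then show ?thesis unfolding res_aug_def lin_ext_def by simp
qed

lemma rel_cycles_mem: "f \<in> rel_cycles (chain A L Y) (chain A L B) k \<Longrightarrow> f \<in> chain A L Y k"
  by (simp add: rel_cycles_def)

text \<open>A right identity \<open>e\<close> of \<open>Y\<close> lying in \<open>Y\<close> makes \<open>Y\<close> a direct summand of \<open>A\<close>.\<close>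

lemma acyclic_idempotent:
  assumes Y: "left_ideal A Y" and e: "e \<in> Y" "\<And>y. y \<in> Y \<Longrightarrow> y \<otimes>\<^bsub>A\<^esub> e = y"
    and k: "k = 0 \<Longrightarrow> (\<And>y x. y \<in> Y \<Longrightarrow> x \<in> carrier L \<Longrightarrow> y \<odot>\<^bsub>L\<^esub> x = \<zero>\<^bsub>L\<^esub>)"
  shows "acyclic (chain A L Y) (chain A L {\<zero>\<^bsub>A\<^esub>}) k"
  unfolding acyclic_def
proof
  fix f assume f: "f \<in> rel_cycles (chain A L Y) (chain A L {\<zero>\<^bsub>A\<^esub>}) k"
  note fY = rel_cycles_mem[OF f]
  have eA: "e \<in> carrier A" using e(1) left_idealD(1)[OF Y] by blast
  obtain g where g: "g \<in> carrier (res_mod A L (Suc k))" "res_bd A g = f"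
  proof (cases k)
    case 0
    have "f b \<odot>\<^bsub>L\<^esub> x = \<zero>\<^bsub>L\<^esub>" if "x \<in> carrier L" for b x
      using k[OF 0] chainD(2)[OF fY] that by blast
    then show thesis using exact_0[OF _ aug_zero] chainD(1)[OF fY] 0 that by metis
  next
    case (Suc j)
    then have "res_bd A f = (\<lambda>b. \<zero>\<^bsub>A\<^esub>)" using f by (auto simp: rel_cycles_def chain_def)
    then show thesis using exact_Suc[of f j] chainD(1)[OF fY] Suc that by metis
  qed
  have "(\<lambda>b. g b \<otimes>\<^bsub>A\<^esub> e) \<in> chain A L Y (Suc k)"
    using free_rmod_smult[OF g(1) eA] left_idealD(4)[OF Y _ e(1)] free_rmodD(1)[OF g(1)] by (auto simp: chain_def)
  moreover have "(\<lambda>b. \<zero>\<^bsub>A\<^esub>) \<in> chain A L {\<zero>\<^bsub>A\<^esub>} k"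
    by (simp add: chain_def) (simp add: free_rmod_def)
  moreover have "f = res_bd A (\<lambda>b. g b \<otimes>\<^bsub>A\<^esub> e) \<oplus>\<^bsub>res_scal A L k\<^esub> (\<lambda>b. \<zero>\<^bsub>A\<^esub>)"
    using bd_smult[OF g(1) eA] g(2) e(2)[OF chainD(2)[OF fY]] free_rmodD(1)[OF chainD(1)[OF fY]]
    by (simp add: res_scal_simps)
  ultimately show "f \<in> rel_bounds (chain A L Y) (chain A L {\<zero>\<^bsub>A\<^esub>}) k"
    unfolding rel_bounds_def by blast
qed

text \<open>Meant for degree 0 of the first shift: an ideal that acts as zero on \<open>L\<close>
  has only chains of augmentation zero in degree 0, and these bound in the full resolution by
  exactness.\<close>

lemma rel_bounds_0:
  assumes f: "f \<in> chain A L Y 0" and z: "\<And>y x. y \<in> Y \<Longrightarrow> x \<in> carrier L \<Longrightarrow> y \<odot>\<^bsub>L\<^esub> x = \<zero>\<^bsub>L\<^esub>"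
    and B: "left_ideal A B"
  shows "f \<in> rel_bounds (chain A L (carrier A)) (chain A L B) 0"
proof -
  have "res_aug A L f = \<zero>\<^bsub>L\<^esub>" by (rule aug_zero[OF chainD(1)[OF f]]) (use z chainD(2)[OF f] in blast)
  then obtain g where g: "g \<in> carrier (res_mod A L (Suc 0))" "res_bd A g = f"
    using exact_0 chainD(1)[OF f] by metis
  have "f = res_bd A g \<oplus>\<^bsub>res_scal A L 0\<^esub> \<zero>\<^bsub>res_scal A L 0\<^esub>"
    using g free_rmodD(1)[OF chainD(1)[OF f]] by (simp add: res_scal_simps)
  moreover have "g \<in> chain A L (carrier A) (Suc 0)" using g free_rmodD(1)[OF g(1)] by (simp add: chain_def)
  ultimately show ?thesis using subcomplexD(2)[OF chain_subcomplex[OF B]] unfolding rel_bounds_def by blast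
qed

end

section \<open>Torsion groups of cyclic modules\<close>

context
  fixes A :: "('r, 'a) module" and P :: "('a, 'p) module" and N :: "('a, 'n) module"
  assumes P: "right_module A P" and N: "left_module A N"
begin

interpretation P: right_module A P by (rule P)
interpretation N: left_module A N by (rule N)

abbreviation (input) FA :: "('p \<times> 'n \<Rightarrow>\<^sub>0 int) monoid" where
  "FA \<equiv> free_Abelian_group (carrier P \<times> carrier N)"

abbreviation (input) pre_tensor :: "('p \<times> 'n \<Rightarrow>\<^sub>0 int) \<Rightarrow> ('p \<times> 'n \<Rightarrow>\<^sub>0 int) set" where
  "pre_tensor z \<equiv> tensor_null A P N #>\<^bsub>FA\<^esub> z"

interpretation FA: comm_group FA by (rule abelian_free_Abelian_group)
interpretation K: normal "tensor_null A P N" FA by (rule tensor_null_normal[OF P N])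

lemma left_zero_smult: "y \<in> carrier N \<Longrightarrow> \<zero>\<^bsub>A\<^esub> \<odot>\<^bsub>N\<^esub> y = \<zero>\<^bsub>N\<^esub>"
  by (rule N.M.double_eq_zero) (simp, subst N.smult_l_distr[symmetric], simp_all)

lemma tensor_null_closed:
  "z \<in> tensor_null A P N \<Longrightarrow> w \<in> tensor_null A P N \<Longrightarrow> z + w \<in> tensor_null A P N"
  "z \<in> tensor_null A P N \<Longrightarrow> - z \<in> tensor_null A P N"
  "0 \<in> tensor_null A P N"
proof -
  show "z + w \<in> tensor_null A P N" if "z \<in> tensor_null A P N" "w \<in> tensor_null A P N"
    using K.m_closed[OF that] by simp
  show "0 \<in> tensor_null A P N" using K.one_closed by simp
  assume z: "z \<in> tensor_null A P N"
  then have "z \<in> carrier FA" by (rule K.mem_carrier)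
  then show "- z \<in> tensor_null A P N" using K.m_inv_closed[OF z] by simp
qed

lemma tensor_null_diff:
  "z \<in> tensor_null A P N \<Longrightarrow> w \<in> tensor_null A P N \<Longrightarrow> z - w \<in> tensor_null A P N"
  using tensor_null_closed(1)[OF _ tensor_null_closed(2), of z w] by simp

lemma pre_tensor_eq:
  assumes z: "z \<in> carrier FA" and w: "w \<in> carrier FA"
  shows "pre_tensor z = pre_tensor w \<longleftrightarrow> z - w \<in> tensor_null A P N"
proof
  assume "z - w \<in> tensor_null A P N"
  then have "pre_tensor w = pre_tensor ((z - w) \<otimes>\<^bsub>FA\<^esub> w)"
    using FA.coset_mult_assoc[OF K.subset K.mem_carrier w, of "z - w"] K.rcos_const[OF FA.group_axioms, of "z - w"]
    by simp
  then show "pre_tensor z = pre_tensor w" by simp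
next
  assume "pre_tensor z = pre_tensor w"
  moreover have "z \<in> pre_tensor z" by (rule FA.rcos_self[OF z K.subgroup_axioms])
  ultimately obtain k where "k \<in> tensor_null A P N" "z = k + w" by (auto simp: r_coset_def)
  then show "z - w \<in> tensor_null A P N" by simp
qed

lemma frag_FA: "x \<in> carrier P \<Longrightarrow> y \<in> carrier N \<Longrightarrow> frag_of (x, y) \<in> carrier FA"
  by simp

lemma pre_tensor_rel:
  "x \<in> carrier P \<Longrightarrow> x' \<in> carrier P \<Longrightarrow> y \<in> carrier N \<Longrightarrow>
     frag_of (x \<oplus>\<^bsub>P\<^esub> x', y) - frag_of (x, y) - frag_of (x', y) \<in> tensor_null A P N"
  "x \<in> carrier P \<Longrightarrow> y \<in> carrier N \<Longrightarrow> y' \<in> carrier N \<Longrightarrow>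
     frag_of (x, y \<oplus>\<^bsub>N\<^esub> y') - frag_of (x, y) - frag_of (x, y') \<in> tensor_null A P N"
  "a \<in> carrier A \<Longrightarrow> x \<in> carrier P \<Longrightarrow> y \<in> carrier N \<Longrightarrow>
     frag_of (a \<odot>\<^bsub>P\<^esub> x, y) - frag_of (x, a \<odot>\<^bsub>N\<^esub> y) \<in> tensor_null A P N"
  unfolding tensor_null_def by (rule generate.incl, simp only: tensor_relators_def, blast)+

lemma pre_tensor_zero: "y \<in> carrier N \<Longrightarrow> frag_of (\<zero>\<^bsub>P\<^esub>, y) \<in> tensor_null A P N"
  "x \<in> carrier P \<Longrightarrow> frag_of (x, \<zero>\<^bsub>N\<^esub>) \<in> tensor_null A P N"
  using tensor_null_closed(2)[OF pre_tensor_rel(1)[of "\<zero>\<^bsub>P\<^esub>" "\<zero>\<^bsub>P\<^esub>" y]]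
    tensor_null_closed(2)[OF pre_tensor_rel(2)[of x "\<zero>\<^bsub>N\<^esub>" "\<zero>\<^bsub>N\<^esub>"]] by simp_all

lemma tensor_simps:
  "carrier (tensor A P N) = pre_tensor ` carrier FA"
  "\<zero>\<^bsub>tensor A P N\<^esub> = tensor_null A P N"
  "z \<in> carrier FA \<Longrightarrow> w \<in> carrier FA \<Longrightarrow> pre_tensor z \<oplus>\<^bsub>tensor A P N\<^esub> pre_tensor w = pre_tensor (z + w)"
proof -
  show "carrier (tensor A P N) = pre_tensor ` carrier FA"
    unfolding tensor_def Let_def FactGroup_def RCOSETS_def by auto
  show "\<zero>\<^bsub>tensor A P N\<^esub> = tensor_null A P N" by (simp add: tensor_def Let_def FactGroup_def)
  show "pre_tensor z \<oplus>\<^bsub>tensor A P N\<^esub> pre_tensor w = pre_tensor (z + w)" if "z \<in> carrier FA" "w \<in> carrier FA"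
    using K.rcos_sum[OF that] by (simp add: tensor_def Let_def FactGroup_def)
qed

lemma tensor_abelian: "abelian_group (tensor A P N)"
proof (rule abelian_groupI)
  note s = tensor_simps
  have z: "\<zero>\<^bsub>tensor A P N\<^esub> = pre_tensor 0"
    using FA.coset_mult_one[OF K.subset] by (simp add: s(2))
  have c: "0 \<in> carrier FA" "\<And>z w. z \<in> carrier FA \<Longrightarrow> w \<in> carrier FA \<Longrightarrow> z + w \<in> carrier FA"
      "\<And>z. z \<in> carrier FA \<Longrightarrow> - z \<in> carrier FA"
    using FA.one_closed FA.m_closed FA.inv_closed by (simp_all del: carrier_free_Abelian_group_iff) fastforce+
  fix X Y W assume "X \<in> carrier (tensor A P N)" "Y \<in> carrier (tensor A P N)" "W \<in> carrier (tensor A P N)"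
  then obtain x y w where e: "X = pre_tensor x" "Y = pre_tensor y" "W = pre_tensor w"
    and x: "x \<in> carrier FA" "y \<in> carrier FA" "w \<in> carrier FA" unfolding s by blast
  note a = s(3)[OF x(1,2)] s(3)[OF x(2,1)] s(3)[OF x(2,3)] s(3)[OF c(2)[OF x(1,2)] x(3)]
    s(3)[OF x(1) c(2)[OF x(2,3)]] s(3)[OF c(1) x(1)] s(3)[OF c(3)[OF x(1)] x(1)]
  show "X \<oplus>\<^bsub>tensor A P N\<^esub> Y \<in> carrier (tensor A P N)" unfolding e a s(1) using c(2)[OF x(1,2)] by blast
  show "X \<oplus>\<^bsub>tensor A P N\<^esub> Y \<oplus>\<^bsub>tensor A P N\<^esub> W = X \<oplus>\<^bsub>tensor A P N\<^esub> (Y \<oplus>\<^bsub>tensor A P N\<^esub> W)"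
    unfolding e a by (simp only: add.assoc)
  show "X \<oplus>\<^bsub>tensor A P N\<^esub> Y = Y \<oplus>\<^bsub>tensor A P N\<^esub> X" unfolding e a by (simp only: add.commute)
  show "\<zero>\<^bsub>tensor A P N\<^esub> \<oplus>\<^bsub>tensor A P N\<^esub> X = X" unfolding z e a by simp
  have "pre_tensor (- x) \<oplus>\<^bsub>tensor A P N\<^esub> X = \<zero>\<^bsub>tensor A P N\<^esub>" unfolding z e a by simp
  moreover have "pre_tensor (- x) \<in> carrier (tensor A P N)" unfolding s(1) using c(3)[OF x(1)] by blast
  ultimately show "\<exists>y\<in>carrier (tensor A P N). y \<oplus>\<^bsub>tensor A P N\<^esub> X = \<zero>\<^bsub>tensor A P N\<^esub>" by blast
next
  show "\<zero>\<^bsub>tensor A P N\<^esub> \<in> carrier (tensor A P N)"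
    unfolding tensor_simps(1) using FA.coset_mult_one[OF K.subset] FA.one_closed
    by (simp add: tensor_simps(2) image_iff del: carrier_free_Abelian_group_iff) metis
qed

text \<open>When \<open>y0\<close> generates \<open>N\<close>, the coefficient of each second factor
  can be moved to the first one, and a sum of tensors with common second factor \<open>y0\<close> is
  again pure.\<close>

lemma tensor_represent:
  assumes y0: "y0 \<in> carrier N" and gen: "\<And>y. y \<in> carrier N \<Longrightarrow> \<exists>a\<in>carrier A. y = a \<odot>\<^bsub>N\<^esub> y0"
    and X: "X \<in> carrier (tensor A P N)"
  shows "\<exists>f\<in>carrier P. X = pre_tensor (frag_of (f, y0))"
proof -
  have *: "\<exists>f\<in>carrier P. z - frag_of (f, y0) \<in> tensor_null A P N"
    if "Poly_Mapping.keys z \<subseteq> carrier P \<times> carrier N" for z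
    using that
  proof (induction z rule: frag_induction)
    case zero
    show ?case using tensor_null_closed(2)[OF pre_tensor_zero(1)[OF y0]] by (intro bexI[of _ "\<zero>\<^bsub>P\<^esub>"]) auto
  next
    case (one p)
    then obtain x y where p: "p = (x, y)" "x \<in> carrier P" "y \<in> carrier N" by blast
    obtain a where a: "a \<in> carrier A" "y = a \<odot>\<^bsub>N\<^esub> y0" using gen[OF p(3)] by blast
    have "frag_of p - frag_of (a \<odot>\<^bsub>P\<^esub> x, y0) \<in> tensor_null A P N"
      using tensor_null_closed(2)[OF pre_tensor_rel(3)[OF a(1) p(2) y0]] p a by simp
    then show ?case using a p by blast
  next
    case (diff z w)
    then obtain f g where fg: "f \<in> carrier P" "z - frag_of (f, y0) \<in> tensor_null A P N"
      "g \<in> carrier P" "w - frag_of (g, y0) \<in> tensor_null A P N" by blast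
    have m: "f \<oplus>\<^bsub>P\<^esub> \<ominus>\<^bsub>P\<^esub> g \<in> carrier P" using fg by simp
    have "(f \<oplus>\<^bsub>P\<^esub> \<ominus>\<^bsub>P\<^esub> g) \<oplus>\<^bsub>P\<^esub> g = f" using fg by (simp add: P.M.a_assoc P.M.l_neg)
    then have "frag_of (f, y0) - frag_of (f \<oplus>\<^bsub>P\<^esub> \<ominus>\<^bsub>P\<^esub> g, y0) - frag_of (g, y0) \<in> tensor_null A P N"
      using pre_tensor_rel(1)[OF m fg(3) y0] by simp
    from tensor_null_closed(1)[OF this tensor_null_diff[OF fg(2,4)]]
    have "(z - w) - frag_of (f \<oplus>\<^bsub>P\<^esub> \<ominus>\<^bsub>P\<^esub> g, y0) \<in> tensor_null A P N" by (simp add: algebra_simps)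
    then show ?case using m by blast
  qed
  from X obtain z where z: "z \<in> carrier FA" "X = pre_tensor z" unfolding tensor_simps by blast
  then obtain f where f: "f \<in> carrier P" "z - frag_of (f, y0) \<in> tensor_null A P N" using *[of z] by auto
  then have "X = pre_tensor (frag_of (f, y0))"
    unfolding z(2) using pre_tensor_eq[OF z(1) frag_FA[OF f(1) y0]] by blast
  then show ?thesis using f(1) by blast
qed

end

context resolution begin

text \<open>Freeness of the left factor. For one direction, the balanced map sending (x, z) to
  \<open>x b\<close> times \<open>z\<close> is defined on the tensor product and detects the
  coordinate \<open>b\<close>. For the other, \<open>f\<close> is split into its finitely many
  coordinates, each of which is moved across to become zero in \<open>N\<close>.\<close>

lemma pure_tensor_zero:
  assumes N: "left_module A N" and y: "y \<in> carrier N" and f: "f \<in> carrier (free_rmod A B)"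
  shows "frag_of (f, y) \<in> tensor_null A (free_rmod A B) N \<longleftrightarrow> (\<forall>b. f b \<odot>\<^bsub>N\<^esub> y = \<zero>\<^bsub>N\<^esub>)"
proof
  interpret N: left_module A N by (rule N)
  interpret P: right_module A "free_rmod A B" by (rule F)
  let ?FA = "free_Abelian_group (carrier (free_rmod A B) \<times> carrier N)"
  {
    assume null: "frag_of (f, y) \<in> tensor_null A (free_rmod A B) N"
    show "\<forall>b. f b \<odot>\<^bsub>N\<^esub> y = \<zero>\<^bsub>N\<^esub>"
    proof
      fix b
      note v = free_rmodD(1)
      have im: "(\<lambda>p. fst p b \<odot>\<^bsub>N\<^esub> snd p) ` (carrier (free_rmod A B) \<times> carrier N) \<subseteq> carrier (add_monoid N)"
        using v by fastforce
      obtain h where h: "h \<in> hom ?FA (add_monoid N)"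
        "\<And>p. p \<in> carrier (free_rmod A B) \<times> carrier N \<Longrightarrow> h (frag_of p) = fst p b \<odot>\<^bsub>N\<^esub> snd p"
        using comm_group.free_Abelian_group_universal[OF N.M.a_comm_group im] by blast
      interpret FA: group ?FA by simp
      interpret h: group_hom ?FA "add_monoid N" h by unfold_locales (rule h(1))
      have hd: "h (z - w) = h z \<oplus>\<^bsub>N\<^esub> \<ominus>\<^bsub>N\<^esub> h w" if "z \<in> carrier ?FA" "w \<in> carrier ?FA" for z w
      proof -
        have "z - w = z \<otimes>\<^bsub>?FA\<^esub> inv\<^bsub>?FA\<^esub> w" using that(2) by simp
        then have "h (z - w) = h (z \<otimes>\<^bsub>?FA\<^esub> inv\<^bsub>?FA\<^esub> w)" by (rule arg_cong)
        also have "\<dots> = h z \<otimes>\<^bsub>add_monoid N\<^esub> inv\<^bsub>add_monoid N\<^esub> h w"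
          by (simp only: h.hom_mult[OF that(1) FA.inv_closed[OF that(2)]] h.hom_inv[OF that(2)])
        finally show ?thesis by (simp add: a_inv_def)
      qed
      have fr: "frag_of (x, z) \<in> carrier ?FA" "h (frag_of (x, z)) = x b \<odot>\<^bsub>N\<^esub> z"
        if "x \<in> carrier (free_rmod A B)" "z \<in> carrier N" for x z
        using h(2)[of "(x, z)"] that by auto
      have fd: "z - w \<in> carrier ?FA" if "z \<in> carrier ?FA" "w \<in> carrier ?FA" for z w
        using that keys_diff[of z w] by auto
      have rel: "h z = \<zero>\<^bsub>N\<^esub>" if "z \<in> tensor_relators A (free_rmod A B) N" for z
        using that unfolding tensor_relators_def
      proof (elim UnE CollectE exE conjE, goal_cases)
        case (1 x x' z')
        then show ?case
          by (simp only: hd fd fr P.M.a_closed) (simp add: free_rmod_simps v[OF 1(2)] v[OF 1(3)] N.smult_l_distr N.M.a_ac N.M.r_neg2 N.M.r_neg1 N.M.r_neg)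
      next
        case (2 x z' z'')
        then show ?case
          by (simp only: hd fd fr N.M.a_closed) (simp add: v[OF 2(2)] N.smult_r_distr N.M.a_ac N.M.r_neg2 N.M.r_neg1 N.M.r_neg)
      next
        case (3 a x z')
        then show ?case
          by (simp only: hd fd fr P.smult_closed N.smult_closed) (simp add: free_rmod_simps v[OF 3(3)] N.smult_assoc N.M.r_neg)
      qed
      have "h z = \<zero>\<^bsub>N\<^esub>" if "z \<in> tensor_null A (free_rmod A B) N" for z
        using that unfolding tensor_null_def
      proof (induction rule: generate.induct)
        case one then show ?case using h.hom_one by simp
      next
        case (incl z) then show ?case by (rule rel)
      next
        case (inv z)
        then have "z \<in> carrier ?FA" using tensor_relators_subset[OF F N] by blast
        then show ?case using h.hom_inv[of z] rel[OF inv] by (simp add: a_inv_def[symmetric] del: inv_free_Abelian_group carrier_free_Abelian_group_iff)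
      next
        case (eng z w)
        have "generate ?FA (tensor_relators A (free_rmod A B) N) \<subseteq> carrier ?FA"
          using FA.generate_incl[OF tensor_relators_subset[OF F N]] .
        then have "z \<in> carrier ?FA" "w \<in> carrier ?FA" using eng by blast+
        then show ?case using h.hom_mult[of z w] eng.IH by simp
      qed
      from this[OF null] show "f b \<odot>\<^bsub>N\<^esub> y = \<zero>\<^bsub>N\<^esub>" using fr(2)[OF f y] by simp
    qed
  }
  {
    assume z: "\<forall>b. f b \<odot>\<^bsub>N\<^esub> y = \<zero>\<^bsub>N\<^esub>"
    note T = tensor_null_closed[OF F N] pre_tensor_rel[OF F N] pre_tensor_zero[OF F N]
    have "frag_of (g, y) \<in> tensor_null A (free_rmod A B) N"
      if "finite C" "C \<subseteq> B" "g \<in> carrier (free_rmod A B)" "{b. g b \<noteq> \<zero>\<^bsub>A\<^esub>} \<subseteq> C" "\<forall>b. g b \<odot>\<^bsub>N\<^esub> y = \<zero>\<^bsub>N\<^esub>" for C g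
      using that
    proof (induction C arbitrary: g)
      case empty
      then have "g = \<zero>\<^bsub>free_rmod A B\<^esub>" by (auto simp: free_rmod_simps)
      then show ?case using pre_tensor_zero(1)[OF F N y] by simp
    next
      case (insert c C)
      let ?g = "g(c := \<zero>\<^bsub>A\<^esub>)" and ?e = "\<lambda>b. if b = c then \<one>\<^bsub>A\<^esub> else \<zero>\<^bsub>A\<^esub>"
      note D = free_rmodD[OF insert.prems(2)]
      have g: "?g \<in> carrier (free_rmod A B)"
        by (rule free_rmodI[where C = "{b. g b \<noteq> \<zero>\<^bsub>A\<^esub>}"]) (use D in \<open>auto split: if_splits\<close>)
      have e: "?e \<in> carrier (free_rmod A B)"
        by (rule free_rmodI[where C = "{c}"]) (use insert.prems in \<open>auto split: if_splits\<close>)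
      have ge: "g c \<odot>\<^bsub>free_rmod A B\<^esub> ?e \<in> carrier (free_rmod A B)" by (rule P.smult_closed[OF D(1) e])
      have sum: "?g \<oplus>\<^bsub>free_rmod A B\<^esub> (g c \<odot>\<^bsub>free_rmod A B\<^esub> ?e) = g"
        using D(1) by (auto simp: free_rmod_simps)
      have "frag_of (?g, y) \<in> tensor_null A (free_rmod A B) N"
      proof (rule insert.IH[OF _ g])
        show "\<forall>b. ?g b \<odot>\<^bsub>N\<^esub> y = \<zero>\<^bsub>N\<^esub>" using insert.prems(4) left_zero_smult[OF F N y] by simp
      qed (use insert.prems in auto)
      moreover have "frag_of (g c \<odot>\<^bsub>free_rmod A B\<^esub> ?e, y) - frag_of (?e, g c \<odot>\<^bsub>N\<^esub> y) \<in> tensor_null A (free_rmod A B) N"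
        by (rule pre_tensor_rel(3)[OF F N D(1) e y])
      moreover have "frag_of (?e, g c \<odot>\<^bsub>N\<^esub> y) \<in> tensor_null A (free_rmod A B) N"
        using pre_tensor_zero(2)[OF F N e] insert.prems(4) by simp
      moreover have "frag_of (g, y) - frag_of (?g, y) - frag_of (g c \<odot>\<^bsub>free_rmod A B\<^esub> ?e, y) \<in> tensor_null A (free_rmod A B) N"
        using pre_tensor_rel(1)[OF F N g ge y] unfolding sum .
      ultimately have "(frag_of (g, y) - frag_of (?g, y) - frag_of (g c \<odot>\<^bsub>free_rmod A B\<^esub> ?e, y)) + frag_of (?g, y)
          + (frag_of (g c \<odot>\<^bsub>free_rmod A B\<^esub> ?e, y) - frag_of (?e, g c \<odot>\<^bsub>N\<^esub> y)) + frag_of (?e, g c \<odot>\<^bsub>N\<^esub> y)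
          \<in> tensor_null A (free_rmod A B) N"
        by (intro tensor_null_closed(1)[OF F N])
      then show ?case by simp
    qed
    from this[OF free_rmodD(2,3)[OF f] f _ z] show "frag_of (f, y) \<in> tensor_null A (free_rmod A B) N" by simp
  }
qed

end

lemma (in chain_complex) homology_subquotient:
  "subquotient R (G k) (cycles G d k) (boundaries G d k)"
proof -
  interpret G: abelian_group "G k" by (rule ab)
  interpret S: abelian_group "G (Suc k)" by (rule ab)
  have n: "\<ominus>\<^bsub>G j\<^esub> \<zero>\<^bsub>G j\<^esub> = \<zero>\<^bsub>G j\<^esub>" "\<zero>\<^bsub>G j\<^esub> \<oplus>\<^bsub>G j\<^esub> \<zero>\<^bsub>G j\<^esub> = \<zero>\<^bsub>G j\<^esub>" for j
  proof -
    interpret J: abelian_group "G j" by (rule ab)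
    show "\<ominus>\<^bsub>G j\<^esub> \<zero>\<^bsub>G j\<^esub> = \<zero>\<^bsub>G j\<^esub>" "\<zero>\<^bsub>G j\<^esub> \<oplus>\<^bsub>G j\<^esub> \<zero>\<^bsub>G j\<^esub> = \<zero>\<^bsub>G j\<^esub>" by simp_all
  qed
  have r: "r \<odot>\<^bsub>G j\<^esub> \<zero>\<^bsub>G j\<^esub> = \<zero>\<^bsub>G j\<^esub>" if r: "r \<in> carrier R" for r j
  proof -
    interpret J: abelian_group "G j" by (rule ab)
    show ?thesis by (rule J.double_eq_zero) (simp_all add: sm_closed sm_add[symmetric] r)
  qed
  show ?thesis
  proof (intro subquotient.intro subquotient_axioms.intro ab)
    fix x y assume x: "x \<in> cycles G d k"
    then show "\<ominus>\<^bsub>G k\<^esub> x \<in> cycles G d k" by (auto simp: cycles_def d_neg n)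
    show "s \<odot>\<^bsub>G k\<^esub> x \<in> cycles G d k" if "s \<in> carrier R" for s
      using x that by (auto simp: cycles_def d_sm r sm_closed)
    assume "y \<in> cycles G d k"
    with x show "x \<oplus>\<^bsub>G k\<^esub> y \<in> cycles G d k" by (auto simp: cycles_def d_add n)
    from x \<open>y \<in> cycles G d k\<close> show "s \<odot>\<^bsub>G k\<^esub> (x \<oplus>\<^bsub>G k\<^esub> y) = s \<odot>\<^bsub>G k\<^esub> x \<oplus>\<^bsub>G k\<^esub> s \<odot>\<^bsub>G k\<^esub> y" if "s \<in> carrier R" for s
      using that by (auto simp: cycles_def sm_add)
  next
    fix x y assume "x \<in> boundaries G d k"
    then obtain u where u: "u \<in> carrier (G (Suc k))" "x = d k u" by (auto simp: boundaries_def)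
    show "\<ominus>\<^bsub>G k\<^esub> x \<in> boundaries G d k"
      unfolding boundaries_def u(2) d_neg[OF u(1), symmetric] using u(1) by blast
    show "s \<odot>\<^bsub>G k\<^esub> x \<in> boundaries G d k" if "s \<in> carrier R" for s
      unfolding boundaries_def u(2) d_sm[OF that u(1), symmetric] using sm_closed[OF that u(1)] by blast
    assume "y \<in> boundaries G d k"
    then obtain v where v: "v \<in> carrier (G (Suc k))" "y = d k v" by (auto simp: boundaries_def)
    show "x \<oplus>\<^bsub>G k\<^esub> y \<in> boundaries G d k"
      unfolding boundaries_def u(2) v(2) d_add[OF u(1) v(1), symmetric] using u(1) v(1) by blast
  next
    show "cycles G d k \<subseteq> carrier (G k)" by (auto simp: cycles_def)
    show "boundaries G d k \<subseteq> cycles G d k"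
      using d_closed d_d by (auto simp: boundaries_def cycles_def)
    show "\<zero>\<^bsub>G k\<^esub> \<in> boundaries G d k" unfolding boundaries_def using d_zero S.zero_closed by (metis image_eqI)
  qed
qed

text \<open>Both coefficient modules of the theorem, the trivial one and \<open>Cup\<close>, have a
  single generator. Tor is then governed by one left ideal, the annihilator of that
  generator.\<close>

locale cyclic_coefficients = resolution R A L for R :: "('r, 'x) ring_scheme"
    and A :: "('r, 'a) module" and L :: "('a, 'l) module" +
  fixes N :: "('a, 'n) module" and y0 :: 'n
  assumes N: "left_module A N" and y0: "y0 \<in> carrier N"
    and gen: "y \<in> carrier N \<Longrightarrow> \<exists>a\<in>carrier A. y = a \<odot>\<^bsub>N\<^esub> y0"
begin

sublocale N: left_module A N by (rule N)

definition ann :: "'a set" where "ann = {a \<in> carrier A. a \<odot>\<^bsub>N\<^esub> y0 = \<zero>\<^bsub>N\<^esub>}"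

lemma ann_left_ideal: "left_ideal A ann"
proof -
  have "a \<odot>\<^bsub>N\<^esub> \<zero>\<^bsub>N\<^esub> = \<zero>\<^bsub>N\<^esub>" if "a \<in> carrier A" for a
    by (rule N.M.double_eq_zero) (simp add: that, subst N.smult_r_distr[symmetric], simp_all add: that)
  then show ?thesis unfolding left_ideal_def ann_def
    by (auto simp: N.smult_l_distr N.smult_assoc y0 left_zero_smult[OF F N])
qed

definition pure :: "nat \<Rightarrow> (('a, 'l) syz \<Rightarrow> 'a) \<Rightarrow> ((('a, 'l) syz \<Rightarrow> 'a) \<times> 'n \<Rightarrow>\<^sub>0 int) set" where
  "pure k f = tensor_null A (res_mod A L k) N #>\<^bsub>free_Abelian_group (carrier (res_mod A L k) \<times> carrier N)\<^esub> frag_of (f, y0)"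

lemma pure_surj: "X \<in> carrier (Tor_complex A L N k) \<Longrightarrow> \<exists>f\<in>carrier (res_mod A L k). X = pure k f"
  unfolding Tor_complex_def pure_def using tensor_represent[OF F N y0 gen] by blast

lemma pure_closed: "f \<in> carrier (res_mod A L k) \<Longrightarrow> pure k f \<in> carrier (Tor_complex A L N k)"
  unfolding Tor_complex_def pure_def tensor_simps[OF F N] by (rule imageI) (simp add: y0)

lemma pure_add:
  assumes "f \<in> carrier (res_mod A L k)" "g \<in> carrier (res_mod A L k)"
  shows "pure k f \<oplus>\<^bsub>Tor_complex A L N k\<^esub> pure k g = pure k (f \<oplus>\<^bsub>res_scal A L k\<^esub> g)"
proof -
  interpret P: right_module A "res_mod A L k" by (rule F)
  note c = frag_FA[OF F N assms(1) y0] frag_FA[OF F N assms(2) y0] frag_FA[OF F N P.M.a_closed[OF assms] y0]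
  have s: "frag_of (f, y0) + frag_of (g, y0) \<in> carrier (free_Abelian_group (carrier (res_mod A L k) \<times> carrier N))"
    using c(1,2) keys_add[of "frag_of (f, y0)" "frag_of (g, y0)"] by auto
  have e: "f \<oplus>\<^bsub>res_scal A L k\<^esub> g = f \<oplus>\<^bsub>res_mod A L k\<^esub> g" by (simp add: res_scal_def)
  have "frag_of (f, y0) + frag_of (g, y0) - frag_of (f \<oplus>\<^bsub>res_mod A L k\<^esub> g, y0) \<in> tensor_null A (res_mod A L k) N"
    using tensor_null_closed(2)[OF F N pre_tensor_rel(1)[OF F N assms y0]] by (simp add: algebra_simps)
  then show ?thesis
    unfolding Tor_complex_def pure_def tensor_simps(3)[OF F N c(1,2)] e using pre_tensor_eq[OF F N s c(3)] by blast
qed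

lemma pure_zero:
  assumes f: "f \<in> carrier (res_mod A L k)"
  shows "pure k f = \<zero>\<^bsub>Tor_complex A L N k\<^esub> \<longleftrightarrow> f \<in> chain A L ann k"
proof -
  let ?FA = "free_Abelian_group (carrier (res_mod A L k) \<times> carrier N)"
  have z: "0 \<in> carrier ?FA" by simp
  have "tensor_null A (res_mod A L k) N = tensor_null A (res_mod A L k) N #>\<^bsub>?FA\<^esub> 0"
    by (rule group.coset_mult_one[OF group_free_Abelian_group subgroup.subset[OF normal_imp_subgroup[OF tensor_null_normal[OF F N]]],
          unfolded one_free_Abelian_group, symmetric])
  then have "pure k f = \<zero>\<^bsub>Tor_complex A L N k\<^esub> \<longleftrightarrow> frag_of (f, y0) \<in> tensor_null A (res_mod A L k) N"
    unfolding pure_def Tor_complex_def tensor_simps(2)[OF F N]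
    using pre_tensor_eq[OF F N frag_FA[OF F N f y0] z] by simp
  also have "\<dots> \<longleftrightarrow> f \<in> chain A L ann k"
    unfolding pure_tensor_zero[OF N y0 f] chain_def ann_def using f free_rmodD(1)[OF f] by auto
  finally show ?thesis .
qed

text \<open>The scalar acts on the second factor of a tensor but by right multiplication on
  functions; the balancing relation turns one into the other.\<close>

lemma pure_smult:
  assumes r: "r \<in> carrier R" and f: "f \<in> carrier (res_mod A L k)"
  shows "r \<odot>\<^bsub>Tor_complex A L N k\<^esub> pure k f = pure k (r \<odot>\<^bsub>res_scal A L k\<^esub> f)"
proof -
  let ?c = "r \<odot>\<^bsub>A\<^esub> \<one>\<^bsub>A\<^esub>"
  interpret P: right_module A "res_mod A L k" by (rule F)
  note c = scalar_closed[OF r]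
  have "r \<odot>\<^bsub>Tor_complex A L N k\<^esub> pure k f = tensor_map A (res_mod A L k) N (\<lambda>x. x) (\<lambda>y. ?c \<odot>\<^bsub>N\<^esub> y) (pure k f)"
    by (simp add: Tor_complex_def tensor_def Let_def)
  also have "\<dots> = tensor_null A (res_mod A L k) N #>\<^bsub>free_Abelian_group (carrier (res_mod A L k) \<times> carrier N)\<^esub>
      frag_extend (\<lambda>(x, y). frag_of (x, ?c \<odot>\<^bsub>N\<^esub> y)) (frag_of (f, y0))"
    unfolding pure_def
  proof (rule tensor_map_coset[OF F N F N])
    show "?c \<odot>\<^bsub>N\<^esub> (a \<odot>\<^bsub>N\<^esub> x) = a \<odot>\<^bsub>N\<^esub> (?c \<odot>\<^bsub>N\<^esub> x)" if "a \<in> carrier A" "x \<in> carrier N" for a x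
      using that c scalar_central[OF r that(1)] by (simp add: N.smult_assoc[symmetric])
  qed (use c f y0 in \<open>auto simp: N.smult_r_distr\<close>)
  also have "\<dots> = tensor_null A (res_mod A L k) N #>\<^bsub>free_Abelian_group (carrier (res_mod A L k) \<times> carrier N)\<^esub>
      frag_of (f, ?c \<odot>\<^bsub>N\<^esub> y0)"
    by (simp only: frag_extend_of prod.case)
  also have "\<dots> = pure k (?c \<odot>\<^bsub>res_mod A L k\<^esub> f)"
  proof -
    have "frag_of (f, ?c \<odot>\<^bsub>N\<^esub> y0) - frag_of (?c \<odot>\<^bsub>res_mod A L k\<^esub> f, y0) \<in> tensor_null A (res_mod A L k) N"
      using tensor_null_closed(2)[OF F N pre_tensor_rel(3)[OF F N c f y0]] by simp
    then show ?thesis unfolding pure_def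
      using pre_tensor_eq[OF F N frag_FA[OF F N f N.smult_closed[OF c y0]] frag_FA[OF F N P.smult_closed[OF c f] y0]]
      by blast
  qed
  finally show ?thesis by (simp add: res_scal_def)
qed

lemma pure_bd:
  assumes f: "f \<in> carrier (res_mod A L (Suc k))"
  shows "Tor_bd A L N k (pure (Suc k) f) = pure k (res_bd A f)"
proof -
  have "Tor_bd A L N k (pure (Suc k) f) =
    tensor_null A (res_mod A L k) N #>\<^bsub>free_Abelian_group (carrier (res_mod A L k) \<times> carrier N)\<^esub>
      frag_extend (\<lambda>(x, y). frag_of (res_bd A x, y)) (frag_of (f, y0))"
    unfolding Tor_bd_def pure_def
  proof (rule tensor_map_coset[OF F N F N])
    show "res_bd A \<in> carrier (res_mod A L (Suc k)) \<rightarrow> carrier (res_mod A L k)" using res_bd_closed[OF L] by blast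
    show "res_bd A (x \<oplus>\<^bsub>res_mod A L (Suc k)\<^esub> y) = res_bd A x \<oplus>\<^bsub>res_mod A L k\<^esub> res_bd A y"
      if "x \<in> carrier (res_mod A L (Suc k))" "y \<in> carrier (res_mod A L (Suc k))" for x y
      unfolding free_rmod_simps by (rule bd_add[OF that])
    show "res_bd A (a \<odot>\<^bsub>res_mod A L (Suc k)\<^esub> x) = a \<odot>\<^bsub>res_mod A L k\<^esub> res_bd A x"
      if "a \<in> carrier A" "x \<in> carrier (res_mod A L (Suc k))" for a x
      unfolding free_rmod_simps by (rule bd_smult[OF that(2,1)])
  qed (use f y0 in auto)
  then show ?thesis by (simp only: frag_extend_of prod.case pure_def)
qed

lemma pure_eq:
  assumes f: "f \<in> carrier (res_mod A L k)" and g: "g \<in> carrier (res_mod A L k)"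
  shows "pure k f = pure k g \<longleftrightarrow> (\<exists>m\<in>chain A L ann k. f = g \<oplus>\<^bsub>res_scal A L k\<^esub> m)"
proof
  interpret T: abelian_group "Tor_complex A L N k" unfolding Tor_complex_def by (rule tensor_abelian[OF F N])
  interpret G: abelian_group "res_scal A L k" by (rule res_scal_abelian)
  have c: "carrier (res_scal A L k) = carrier (res_mod A L k)" by (simp add: res_scal_simps)
  note fg = f[folded c] g[folded c]
  let ?m = "f \<oplus>\<^bsub>res_scal A L k\<^esub> \<ominus>\<^bsub>res_scal A L k\<^esub> g"
  have m: "?m \<in> carrier (res_mod A L k)" "\<ominus>\<^bsub>res_scal A L k\<^esub> g \<in> carrier (res_mod A L k)"
    unfolding c[symmetric] using fg by simp_all
  {
    assume "pure k f = pure k g"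
    then have "pure k ?m = pure k (g \<oplus>\<^bsub>res_scal A L k\<^esub> \<ominus>\<^bsub>res_scal A L k\<^esub> g)"
      unfolding pure_add[OF f m(2), symmetric] pure_add[OF g m(2), symmetric] by simp
    also have "\<dots> = \<zero>\<^bsub>Tor_complex A L N k\<^esub>"
      using pure_zero[of "\<zero>\<^bsub>res_scal A L k\<^esub>" k] subcomplexD(2)[OF chain_subcomplex[OF ann_left_ideal]] G.zero_closed[unfolded c] fg
      by (simp add: G.r_neg)
    finally have "?m \<in> chain A L ann k" using pure_zero[OF m(1)] by simp
    moreover have "f = g \<oplus>\<^bsub>res_scal A L k\<^esub> ?m" using fg by (simp add: G.a_ac G.r_neg1 G.r_neg2 G.r_neg)
    ultimately show "\<exists>m\<in>chain A L ann k. f = g \<oplus>\<^bsub>res_scal A L k\<^esub> m" by blast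
  }
  assume "\<exists>m\<in>chain A L ann k. f = g \<oplus>\<^bsub>res_scal A L k\<^esub> m"
  then obtain l where l: "l \<in> chain A L ann k" "f = g \<oplus>\<^bsub>res_scal A L k\<^esub> l" by blast
  have "pure k f = pure k g \<oplus>\<^bsub>Tor_complex A L N k\<^esub> \<zero>\<^bsub>Tor_complex A L N k\<^esub>"
    unfolding l(2) pure_add[OF g chainD(1)[OF l(1)], symmetric] using pure_zero[OF chainD(1)[OF l(1)]] l(1) by simp
  then show "pure k f = pure k g" using pure_closed[OF g] by simp
qed

text \<open>Every law is carried over from the complex of functions along the surjection
  \<open>pure\<close>.\<close>

lemma Tor_chain_complex: "chain_complex R (Tor_complex A L N) (Tor_bd A L N)"
proof (rule chain_complex.intro, goal_cases)
  case 1 show ?case unfolding Tor_complex_def by (rule tensor_abelian[OF F N])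
next
  case (2 r x k)
  then show ?case using pure_surj[OF 2(2)] pure_smult[OF 2(1)] pure_closed sm_closed[OF 2(1)] by (auto simp: res_scal_simps(1))
next
  case (3 r x k y)
  then obtain f g where f: "f \<in> carrier (res_mod A L k)" "x = pure k f" and g: "g \<in> carrier (res_mod A L k)" "y = pure k g"
    using pure_surj by metis
  note c = f(1)[folded res_scal_simps(1)] g(1)[folded res_scal_simps(1)]
  interpret G: abelian_group "res_scal A L k" by (rule res_scal_abelian)
  show ?case unfolding f(2) g(2) pure_add[OF f(1) g(1)] pure_smult[OF 3(1) f(1)] pure_smult[OF 3(1) g(1)]
    pure_smult[OF 3(1) G.a_closed[OF c, unfolded res_scal_simps(1)]]
    pure_add[OF sm_closed[OF 3(1) c(1), unfolded res_scal_simps(1)] sm_closed[OF 3(1) c(2), unfolded res_scal_simps(1)]]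
    sm_add[OF 3(1) c] ..
next
  case (4 x k)
  then show ?case using pure_surj[OF 4] pure_bd pure_closed res_bd_closed[OF L] by fastforce
next
  case (5 x k y)
  then obtain f g where f: "f \<in> carrier (res_mod A L (Suc k))" "x = pure (Suc k) f"
    and g: "g \<in> carrier (res_mod A L (Suc k))" "y = pure (Suc k) g"
    using pure_surj by metis
  note c = f(1)[folded res_scal_simps(1)] g(1)[folded res_scal_simps(1)]
  interpret G: abelian_group "res_scal A L (Suc k)" by (rule res_scal_abelian)
  show ?case unfolding f(2) g(2) pure_add[OF f(1) g(1)] pure_bd[OF f(1)] pure_bd[OF g(1)]
    pure_bd[OF G.a_closed[OF c, unfolded res_scal_simps(1)]]
    pure_add[OF res_bd_closed[OF L f(1)] res_bd_closed[OF L g(1)]] d_add[OF c] ..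
next
  case (6 r x k)
  then obtain f where f: "f \<in> carrier (res_mod A L (Suc k))" "x = pure (Suc k) f"
    using pure_surj by metis
  note c = f(1)[folded res_scal_simps(1)]
  show ?case unfolding f(2) pure_bd[OF f(1)] pure_smult[OF 6(1) f(1)] pure_smult[OF 6(1) res_bd_closed[OF L f(1)]]
    pure_bd[OF sm_closed[OF 6(1) c, unfolded res_scal_simps(1)]] d_sm[OF 6(1) c] ..
next
  case (7 x k)
  then obtain f where f: "f \<in> carrier (res_mod A L (Suc (Suc k)))" "x = pure (Suc (Suc k)) f"
    using pure_surj by metis
  show ?case unfolding f(2) pure_bd[OF f(1)] pure_bd[OF res_bd_closed[OF L f(1)]]
      d_d[OF f(1)[folded res_scal_simps(1)]]
    using pure_zero[of "\<zero>\<^bsub>res_scal A L k\<^esub>" k] subcomplexD(1,2)[OF chain_subcomplex[OF ann_left_ideal]]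
    by (simp add: res_scal_simps(1))
qed

text \<open>Since N is A/ann, tensoring the resolution with N amounts to passing from
  \<open>A\<close>-valued functions to their classes modulo \<open>ann\<close>-valued ones. From
  here on only functions with values in left ideals are considered, and no tensors.\<close>

theorem Tor_rel:
  "sub_iso R (Tor_complex A L N k) (cycles (Tor_complex A L N) (Tor_bd A L N) k) (boundaries (Tor_complex A L N) (Tor_bd A L N) k)
     (res_scal A L k) (rel_cycles (chain A L (carrier A)) (chain A L ann) k) (rel_bounds (chain A L (carrier A)) (chain A L ann) k)"
proof -
  have ch: "f \<in> chain A L (carrier A) k \<longleftrightarrow> f \<in> carrier (res_mod A L k)" for f k
    using free_rmodD(1)[of f A] by (auto simp: chain_def)
  have A: "left_ideal A (carrier A)" by (simp add: left_ideal_def)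
  have cyc: "pure k f \<in> cycles (Tor_complex A L N) (Tor_bd A L N) k \<longleftrightarrow> f \<in> rel_cycles (chain A L (carrier A)) (chain A L ann) k"
    if f: "f \<in> carrier (res_mod A L k)" for f
  proof (cases k)
    case 0 then show ?thesis using f pure_closed[OF f] by (simp add: cycles_def rel_cycles_def ch)
  next
    case (Suc j)
    note f' = f[unfolded Suc]
    show ?thesis using f pure_closed[OF f] pure_bd[OF f'] pure_zero[OF res_bd_closed[OF L f']] Suc
      by (simp add: cycles_def rel_cycles_def ch)
  qed
  have bd: "pure k f \<in> boundaries (Tor_complex A L N) (Tor_bd A L N) k \<longleftrightarrow> f \<in> rel_bounds (chain A L (carrier A)) (chain A L ann) k"
    if f: "f \<in> carrier (res_mod A L k)" for f
  proof -
    have "pure k f \<in> boundaries (Tor_complex A L N) (Tor_bd A L N) k \<longleftrightarrow> (\<exists>g\<in>carrier (res_mod A L (Suc k)). pure k f = pure k (res_bd A g))"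
    proof
      assume "pure k f \<in> boundaries (Tor_complex A L N) (Tor_bd A L N) k"
      then obtain X where X: "X \<in> carrier (Tor_complex A L N (Suc k))" "pure k f = Tor_bd A L N k X"
        unfolding boundaries_def by blast
      obtain g where g: "g \<in> carrier (res_mod A L (Suc k))" "X = pure (Suc k) g" using pure_surj[OF X(1)] by blast
      then show "\<exists>g\<in>carrier (res_mod A L (Suc k)). pure k f = pure k (res_bd A g)"
        using X(2) pure_bd[OF g(1)] by auto
    next
      assume "\<exists>g\<in>carrier (res_mod A L (Suc k)). pure k f = pure k (res_bd A g)"
      then obtain g where g: "g \<in> carrier (res_mod A L (Suc k))" "pure k f = pure k (res_bd A g)" by blast
      show "pure k f \<in> boundaries (Tor_complex A L N) (Tor_bd A L N) k"
        unfolding boundaries_def g(2) pure_bd[OF g(1), symmetric] by (rule imageI[OF pure_closed[OF g(1)]])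
    qed
    also have "\<dots> \<longleftrightarrow> f \<in> rel_bounds (chain A L (carrier A)) (chain A L ann) k"
    proof -
      have "(\<exists>g\<in>carrier (res_mod A L (Suc k)). pure k f = pure k (res_bd A g)) \<longleftrightarrow>
        (\<exists>g\<in>carrier (res_mod A L (Suc k)). \<exists>m\<in>chain A L ann k. f = res_bd A g \<oplus>\<^bsub>res_scal A L k\<^esub> m)"
        by (rule bex_cong[OF HOL.refl]) (rule pure_eq[OF f res_bd_closed[OF L]])
      then show ?thesis unfolding rel_bounds_def ch by blast
    qed
    finally show ?thesis .
  qed
  have mem: "f \<in> carrier (res_mod A L k)" if "f \<in> rel_cycles (chain A L (carrier A)) (chain A L ann) k" for f
    using that unfolding rel_cycles_def ch by simp
  note sA = chain_subcomplex[OF A] and sN = chain_subcomplex[OF ann_left_ideal]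
  show ?thesis
  proof (rule sub_isoI[of "\<lambda>X f. f \<in> rel_cycles (chain A L (carrier A)) (chain A L ann) k \<and> X = pure k f"], goal_cases)
    case (5 X)
    then have "X \<in> carrier (Tor_complex A L N k)" by (simp add: cycles_def)
    then obtain f where f: "f \<in> carrier (res_mod A L k)" "X = pure k f" using pure_surj by blast
    show ?case using 5 unfolding f(2) cyc[OF f(1)] by blast
  next
    case (1 X f) then show ?case using cyc[OF mem] by blast
  next
    case (3 X f) then show ?case using bd[OF mem] by blast
  next
    case (4 X f) then show ?case using bd[OF mem] by blast
  next
    case (7 X f X' f')
    then have f: "f \<in> rel_cycles (chain A L (carrier A)) (chain A L ann) k"
      "f' \<in> rel_cycles (chain A L (carrier A)) (chain A L ann) k" and X: "X = pure k f" "X' = pure k f'" by auto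
    show ?case unfolding X using pure_add[OF mem[OF f(1)] mem[OF f(2)]] rel_cycles_add[OF sA sN f] by simp
  next
    case (8 r X f)
    then have f: "f \<in> rel_cycles (chain A L (carrier A)) (chain A L ann) k" and X: "X = pure k f" by auto
    show ?case unfolding X using pure_smult[OF 8(1) mem[OF f]] rel_cycles_sm[OF sA sN f 8(1)] by simp
  qed blast+
qed

end

section \<open>Words in the Temperley--Lieb algebra\<close>

definition word_mon :: "('r, 'x) ring_scheme \<Rightarrow> 's list \<Rightarrow> 's list \<Rightarrow> 'r" where
  "word_mon R w = (\<lambda>u. if u = w then \<one>\<^bsub>R\<^esub> else \<zero>\<^bsub>R\<^esub>)"

definition restr :: "('r, 'x) ring_scheme \<Rightarrow> 's list set \<Rightarrow> ('s list \<Rightarrow> 'r) \<Rightarrow> 's list \<Rightarrow> 'r" where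
  "restr R Q f = (\<lambda>w. if w \<in> Q then f w else \<zero>\<^bsub>R\<^esub>)"

context cring begin

lemma word_mon_closed: "w \<in> lists S \<Longrightarrow> word_mon R w \<in> carrier (free_alg R S)"
  by (rule free_algI[where W = "{w}"]) (auto simp: word_mon_def split: if_splits)

lemma restr_closed: "f \<in> carrier (free_alg R S) \<Longrightarrow> restr R Q f \<in> carrier (free_alg R S)"
  by (rule free_algI[where W = "{w. f w \<noteq> \<zero>}"])
    (auto simp: restr_def free_alg_closed_val free_alg_fin dest: free_alg_letters split: if_splits)

lemma word_mon_mult_left:
  assumes f: "f \<in> carrier (free_alg R S)"
  shows "(word_mon R u \<otimes>\<^bsub>free_alg R S\<^esub> f) w = (if take (length u) w = u then f (drop (length u) w) else \<zero>)"
proof -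
  note v = free_alg_closed_val[OF f]
  have "(word_mon R u \<otimes>\<^bsub>free_alg R S\<^esub> f) w = (\<Oplus>k\<in>{..length w}. if length u = k then (if take (length u) w = u then f (drop (length u) w) else \<zero>) else \<zero>)"
    unfolding free_alg_simps
  proof (rule finsum_cong')
    fix k assume k: "k \<in> {..length w}"
    show "word_mon R u (take k w) \<otimes> f (drop k w) = (if length u = k then (if take (length u) w = u then f (drop (length u) w) else \<zero>) else \<zero>)"
      using k v by (auto simp: word_mon_def)
  qed (use v in auto)
  also have "\<dots> = (if take (length u) w = u then f (drop (length u) w) else \<zero>)"
  proof (cases "length u \<le> length w")
    case True
    then show ?thesis
      using add.finprod_singleton[of "length u" "{..length w}" "\<lambda>_. if take (length u) w = u then f (drop (length u) w) else \<zero>"] v by simp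
  next
    case False
    then have "take (length u) w \<noteq> u" by (metis length_take min.cobounded1)
    then show ?thesis by simp
  qed
  finally show ?thesis .
qed

lemma word_mon_mult_right:
  assumes f: "f \<in> carrier (free_alg R S)"
  shows "(f \<otimes>\<^bsub>free_alg R S\<^esub> word_mon R u) w =
    (if length u \<le> length w \<and> drop (length w - length u) w = u then f (take (length w - length u) w) else \<zero>)"
proof -
  note v = free_alg_closed_val[OF f]
  let ?c = "if length u \<le> length w \<and> drop (length w - length u) w = u then f (take (length w - length u) w) else \<zero>"
  have "(f \<otimes>\<^bsub>free_alg R S\<^esub> word_mon R u) w = (\<Oplus>k\<in>{..length w}. if length w - length u = k then ?c else \<zero>)"
    unfolding free_alg_simps
  proof (rule finsum_cong')
    fix k assume k: "k \<in> {..length w}"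
    then show "f (take k w) \<otimes> word_mon R u (drop k w) = (if length w - length u = k then ?c else \<zero>)"
      using v by (auto simp: word_mon_def)
  qed (use v in auto)
  also have "\<dots> = ?c"
    using add.finprod_singleton[of "length w - length u" "{..length w}" "\<lambda>_. ?c"] v by simp
  finally show ?thesis .
qed

lemma word_mon_mult: "v \<in> lists S \<Longrightarrow> word_mon R u \<otimes>\<^bsub>free_alg R S\<^esub> word_mon R v = word_mon R (u @ v)"
proof
  fix w assume v: "v \<in> lists S"
  have "take (length u) w = u \<and> drop (length u) w = v \<longleftrightarrow> w = u @ v"
    by (metis append_eq_conv_conj)
  then show "(word_mon R u \<otimes>\<^bsub>free_alg R S\<^esub> word_mon R v) w = word_mon R (u @ v) w"
    unfolding word_mon_mult_left[OF word_mon_closed[OF v]] by (auto simp: word_mon_def)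
qed

lemma free_alg_smult_closed: "r \<in> carrier R \<Longrightarrow> f \<in> carrier (free_alg R S) \<Longrightarrow> r \<odot>\<^bsub>free_alg R S\<^esub> f \<in> carrier (free_alg R S)"
  by (rule free_algI[where W = "{w. f w \<noteq> \<zero>}"])
    (auto simp: free_alg_simps free_alg_closed_val free_alg_fin dest: free_alg_letters)

lemma free_alg_one: "\<one>\<^bsub>free_alg R S\<^esub> = word_mon R []"
  by (simp add: free_alg_simps word_mon_def)

lemma free_alg_scalar:
  assumes r: "r \<in> carrier R" and f: "f \<in> carrier (free_alg R S)"
  shows "(r \<odot>\<^bsub>free_alg R S\<^esub> \<one>\<^bsub>free_alg R S\<^esub>) \<otimes>\<^bsub>free_alg R S\<^esub> f = r \<odot>\<^bsub>free_alg R S\<^esub> f"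
    and "f \<otimes>\<^bsub>free_alg R S\<^esub> (r \<odot>\<^bsub>free_alg R S\<^esub> \<one>\<^bsub>free_alg R S\<^esub>) = r \<odot>\<^bsub>free_alg R S\<^esub> f"
proof -
  note v = free_alg_closed_val[OF f]
  show "(r \<odot>\<^bsub>free_alg R S\<^esub> \<one>\<^bsub>free_alg R S\<^esub>) \<otimes>\<^bsub>free_alg R S\<^esub> f = r \<odot>\<^bsub>free_alg R S\<^esub> f"
  proof
    fix w
    have "((r \<odot>\<^bsub>free_alg R S\<^esub> \<one>\<^bsub>free_alg R S\<^esub>) \<otimes>\<^bsub>free_alg R S\<^esub> f) w = (\<Oplus>k\<in>{..length w}. if 0 = k then r \<otimes> f w else \<zero>)"
      unfolding free_alg_simps by (rule finsum_cong') (use v r in auto)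
    then show "((r \<odot>\<^bsub>free_alg R S\<^esub> \<one>\<^bsub>free_alg R S\<^esub>) \<otimes>\<^bsub>free_alg R S\<^esub> f) w = (r \<odot>\<^bsub>free_alg R S\<^esub> f) w"
      using add.finprod_singleton[of 0 "{..length w}" "\<lambda>_. r \<otimes> f w"] v r by (simp add: free_alg_simps)
  qed
  show "f \<otimes>\<^bsub>free_alg R S\<^esub> (r \<odot>\<^bsub>free_alg R S\<^esub> \<one>\<^bsub>free_alg R S\<^esub>) = r \<odot>\<^bsub>free_alg R S\<^esub> f"
  proof
    fix w
    have "(f \<otimes>\<^bsub>free_alg R S\<^esub> (r \<odot>\<^bsub>free_alg R S\<^esub> \<one>\<^bsub>free_alg R S\<^esub>)) w = (\<Oplus>k\<in>{..length w}. if length w = k then r \<otimes> f w else \<zero>)"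
      unfolding free_alg_simps by (rule finsum_cong') (use v r in \<open>auto simp: m_comm\<close>)
    then show "(f \<otimes>\<^bsub>free_alg R S\<^esub> (r \<odot>\<^bsub>free_alg R S\<^esub> \<one>\<^bsub>free_alg R S\<^esub>)) w = (r \<odot>\<^bsub>free_alg R S\<^esub> f) w"
      using add.finprod_singleton[of "length w" "{..length w}" "\<lambda>_. r \<otimes> f w"] v r by (simp add: free_alg_simps)
  qed
qed

lemma free_alg_induct:
  assumes f: "f \<in> carrier (free_alg R S)" and X: "{w. f w \<noteq> \<zero>} \<subseteq> X"
    and zero: "Q \<zero>\<^bsub>free_alg R S\<^esub>"
    and step: "\<And>g r w. Q g \<Longrightarrow> g \<in> carrier (free_alg R S) \<Longrightarrow> r \<in> carrier R \<Longrightarrow> w \<in> X \<Longrightarrow> w \<in> lists S \<Longrightarrow>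
      Q (g \<oplus>\<^bsub>free_alg R S\<^esub> r \<odot>\<^bsub>free_alg R S\<^esub> word_mon R w)"
  shows "Q f"
proof -
  have "Q g" if "finite C" "C \<subseteq> X \<inter> lists S" "g \<in> carrier (free_alg R S)" "{w. g w \<noteq> \<zero>} \<subseteq> C" for C g
    using that
  proof (induction C arbitrary: g)
    case empty
    then have "g = \<zero>\<^bsub>free_alg R S\<^esub>" by (auto simp: free_alg_simps)
    then show ?case using zero by simp
  next
    case (insert w C)
    note v = free_alg_closed_val[OF insert.prems(2)]
    have c: "restr R (- {w}) g \<in> carrier (free_alg R S)" by (rule restr_closed[OF insert.prems(2)])
    have "Q (restr R (- {w}) g)"
      by (rule insert.IH[OF _ c]) (use insert.prems in \<open>auto simp: restr_def\<close>)
    then have "Q (restr R (- {w}) g \<oplus>\<^bsub>free_alg R S\<^esub> g w \<odot>\<^bsub>free_alg R S\<^esub> word_mon R w)"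
      by (rule step[OF _ c v]) (use insert.prems in auto)
    moreover have "restr R (- {w}) g \<oplus>\<^bsub>free_alg R S\<^esub> g w \<odot>\<^bsub>free_alg R S\<^esub> word_mon R w = g"
      using v by (auto simp: free_alg_simps restr_def word_mon_def)
    ultimately show ?case by simp
  qed
  from this[OF free_alg_fin[OF f] _ f] X free_alg_letters[OF f] show ?thesis by blast
qed

end

declare One_nat_def [simp del]

locale temperley_lieb = cring R for R :: "('r, 'x) ring_scheme" (structure) +
  fixes a :: 'r and n :: nat
  assumes a: "a \<in> carrier R"
begin

abbreviation (input) FS :: "('r, nat list \<Rightarrow> 'r) module" where "FS \<equiv> free_alg R {1..<n}"
abbreviation (input) TLA :: "('r, (nat list \<Rightarrow> 'r) set) module" where "TLA \<equiv> TL R n a"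
abbreviation (input) letters :: "nat list set" where "letters \<equiv> lists {1..<n}"

sublocale FS: ring FS by (rule free_alg_ring)
sublocale I: ideal "TL_ideal R n a" FS by (rule TL_ideal_ideal[OF a])
sublocale TLA: ring TLA by (rule TL_ring[OF a])

definition cls :: "(nat list \<Rightarrow> 'r) \<Rightarrow> (nat list \<Rightarrow> 'r) set" where
  "cls f = TL_ideal R n a +>\<^bsub>FS\<^esub> f"

lemma cls_hom: "ring_hom_ring FS TLA cls"
proof -
  interpret q: ring_hom_ring FS "FS Quot TL_ideal R n a" "(+>\<^bsub>FS\<^esub>) (TL_ideal R n a)"
    by (rule I.rcos_ring_hom_ring)
  show ?thesis
    by (rule ring_hom_ringI2[OF FS.ring_axioms TLA.ring_axioms], rule ring_hom_memI)
      (unfold TL_def quot_alg_simps cls_def, (rule q.hom_closed q.hom_mult q.hom_add q.hom_one; assumption)+)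
qed

sublocale cls: ring_hom_ring FS TLA cls by (rule cls_hom)

lemma cls_eq_iff:
  assumes f: "f \<in> carrier FS" and g: "g \<in> carrier FS"
  shows "cls f = cls g \<longleftrightarrow> f \<ominus>\<^bsub>FS\<^esub> g \<in> TL_ideal R n a"
  unfolding cls_def using FS.quotient_eq_iff_same_a_r_cos[OF I.ideal_axioms f g] by blast

lemma TLA_cases: "X \<in> carrier TLA \<Longrightarrow> (\<And>f. f \<in> carrier FS \<Longrightarrow> X = cls f \<Longrightarrow> thesis) \<Longrightarrow> thesis"
  unfolding cls_def by (erule TL_carrier_cases)

abbreviation (input) sc :: "'r \<Rightarrow> (nat list \<Rightarrow> 'r) set" where "sc r \<equiv> r \<odot>\<^bsub>TLA\<^esub> \<one>\<^bsub>TLA\<^esub>"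

lemma sc_cls: "r \<in> carrier R \<Longrightarrow> sc r = cls (r \<odot>\<^bsub>FS\<^esub> \<one>\<^bsub>FS\<^esub>)"
proof -
  assume r: "r \<in> carrier R"
  have "sc r = cls (r \<odot>\<^bsub>FS\<^esub> \<one>\<^bsub>FS\<^esub>) \<otimes>\<^bsub>TLA\<^esub> \<one>\<^bsub>TLA\<^esub>"
    by (simp add: TL_def quot_alg_def cls_def)
  then show ?thesis using free_alg_smult_closed[OF r FS.one_closed] by simp
qed

lemma sc_closed: "r \<in> carrier R \<Longrightarrow> sc r \<in> carrier TLA"
  using free_alg_smult_closed[OF _ FS.one_closed] by (simp add: sc_cls)

lemma cls_smult: "r \<in> carrier R \<Longrightarrow> f \<in> carrier FS \<Longrightarrow> cls (r \<odot>\<^bsub>FS\<^esub> f) = sc r \<otimes>\<^bsub>TLA\<^esub> cls f"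
  using free_alg_smult_closed[OF _ FS.one_closed] free_alg_scalar(1)[of r f "{1..<n}"]
  by (simp add: sc_cls cls.hom_mult[symmetric])

lemma sc_central:
  assumes r: "r \<in> carrier R" and X: "X \<in> carrier TLA"
  shows "X \<otimes>\<^bsub>TLA\<^esub> sc r = sc r \<otimes>\<^bsub>TLA\<^esub> X"
proof -
  obtain f where f: "f \<in> carrier FS" "X = cls f" using X by (rule TLA_cases)
  show ?thesis
    using free_alg_smult_closed[OF r FS.one_closed] free_alg_scalar[OF r f(1)] f
    by (simp add: sc_cls[OF r] cls.hom_mult[symmetric])
qed

definition W :: "nat list \<Rightarrow> (nat list \<Rightarrow> 'r) set" where "W w = cls (word_mon R w)"

lemma W_closed: "w \<in> letters \<Longrightarrow> W w \<in> carrier TLA"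
  unfolding W_def by (rule cls.hom_closed[OF word_mon_closed])

lemma W_append: "u \<in> letters \<Longrightarrow> v \<in> letters \<Longrightarrow> W (u @ v) = W u \<otimes>\<^bsub>TLA\<^esub> W v"
  unfolding W_def using word_mon_mult[of v "{1..<n}" u]
    cls.hom_mult[OF word_mon_closed[of u "{1..<n}"] word_mon_closed[of v "{1..<n}"]] by simp

lemma W_Nil: "W [] = \<one>\<^bsub>TLA\<^esub>"
  unfolding W_def free_alg_one[of "{1..<n}", symmetric] by (rule cls.hom_one)

text \<open>The span of the words in \<open>X\<close>, described by polynomials supported on
  \<open>X\<close> so that two representatives of one element can be compared in the free
  algebra.\<close>

definition Sp :: "nat list set \<Rightarrow> (nat list \<Rightarrow> 'r) set set" where
  "Sp X = {cls f | f. f \<in> carrier FS \<and> {w. f w \<noteq> \<zero>} \<subseteq> X}"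

lemma W_Sp: "w \<in> letters \<Longrightarrow> w \<in> X \<Longrightarrow> W w \<in> Sp X"
  unfolding Sp_def W_def using word_mon_closed[of w "{1..<n}"] by (auto simp: word_mon_def split: if_splits)

lemma Sp_induct [consumes 1, case_names zero step]:
  assumes x: "x \<in> Sp X" and zero: "Q \<zero>\<^bsub>TLA\<^esub>"
    and step: "\<And>y r w. Q y \<Longrightarrow> y \<in> carrier TLA \<Longrightarrow> r \<in> carrier R \<Longrightarrow> w \<in> X \<Longrightarrow> w \<in> letters \<Longrightarrow>
      Q (y \<oplus>\<^bsub>TLA\<^esub> sc r \<otimes>\<^bsub>TLA\<^esub> W w)"
  shows "Q x"
proof -
  obtain f where f: "f \<in> carrier FS" "{w. f w \<noteq> \<zero>} \<subseteq> X" "x = cls f" using x unfolding Sp_def by blast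
  have "Q (cls f)"
    using f(1,2)
  proof (rule free_alg_induct)
    show "Q (cls \<zero>\<^bsub>FS\<^esub>)" using zero by simp
    fix g r w assume g: "Q (cls g)" "g \<in> carrier FS" "r \<in> carrier R" "w \<in> X" "w \<in> letters"
    have "cls (g \<oplus>\<^bsub>FS\<^esub> r \<odot>\<^bsub>FS\<^esub> word_mon R w) = cls g \<oplus>\<^bsub>TLA\<^esub> sc r \<otimes>\<^bsub>TLA\<^esub> W w"
      using g word_mon_closed[OF g(5)] free_alg_smult_closed[OF g(3) word_mon_closed[OF g(5)]] by (simp add: cls_smult W_def)
    then show "Q (cls (g \<oplus>\<^bsub>FS\<^esub> r \<odot>\<^bsub>FS\<^esub> word_mon R w))"
      using step[OF g(1) cls.hom_closed[OF g(2)] g(3-5)] by simp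
  qed
  then show ?thesis using f(3) by simp
qed

lemma support_add:
  "{w. (f \<oplus>\<^bsub>FS\<^esub> g) w \<noteq> \<zero>} \<subseteq> {w. f w \<noteq> \<zero>} \<union> {w. g w \<noteq> \<zero>}"
  by (auto simp: free_alg_simps)

lemma Sp_UNIV: "Sp UNIV = carrier TLA"
  unfolding Sp_def using TLA_cases cls.hom_closed by blast

lemma Sp_left_ideal:
  assumes X: "\<And>v w. v \<in> letters \<Longrightarrow> w \<in> X \<Longrightarrow> v @ w \<in> X"
  shows "left_ideal TLA (Sp X)"
  unfolding left_ideal_def
proof (intro conjI ballI subsetI)
  show "x \<in> carrier TLA" if "x \<in> Sp X" for x
  proof -
    from that obtain f where "f \<in> carrier FS" "x = cls f" unfolding Sp_def by blast
    then show ?thesis by simp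
  qed
  have "{w. \<zero>\<^bsub>FS\<^esub> w \<noteq> \<zero>} \<subseteq> X" by (simp add: free_alg_simps)
  then show "\<zero>\<^bsub>TLA\<^esub> \<in> Sp X" unfolding Sp_def
    using cls.hom_zero[symmetric] FS.zero_closed by blast
  fix y assume "y \<in> Sp X"
  then obtain g where g: "g \<in> carrier FS" "{w. g w \<noteq> \<zero>} \<subseteq> X" "y = cls g" unfolding Sp_def by blast
  show "x \<oplus>\<^bsub>TLA\<^esub> y \<in> Sp X" if "x \<in> Sp X" for x
  proof -
    from that obtain f where f: "f \<in> carrier FS" "{w. f w \<noteq> \<zero>} \<subseteq> X" "x = cls f" unfolding Sp_def by blast
    have "{w. (f \<oplus>\<^bsub>FS\<^esub> g) w \<noteq> \<zero>} \<subseteq> X" using f g support_add[of f g] by blast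
    moreover have "x \<oplus>\<^bsub>TLA\<^esub> y = cls (f \<oplus>\<^bsub>FS\<^esub> g)" using f g by simp
    ultimately show ?thesis unfolding Sp_def using FS.a_closed[OF f(1) g(1)] by blast
  qed
  show "x \<otimes>\<^bsub>TLA\<^esub> y \<in> Sp X" if x: "x \<in> carrier TLA" for x
  proof -
    obtain f where f: "f \<in> carrier FS" "x = cls f" using x by (rule TLA_cases)
    have "w \<in> X" if nz: "(f \<otimes>\<^bsub>FS\<^esub> g) w \<noteq> \<zero>" for w
    proof (rule ccontr)
      assume "w \<notin> X"
      have "f (take k w) \<otimes> g (drop k w) = \<zero>" for k
      proof (cases "f (take k w) = \<zero>")
        case True then show ?thesis using free_alg_closed_val[OF g(1)] by simp
      next
        case False
        then have "take k w \<in> letters" by (rule free_alg_letters[OF f(1)])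
        then have "g (drop k w) = \<zero>" using X[of "take k w" "drop k w"] \<open>w \<notin> X\<close> g(2) by auto
        then show ?thesis using free_alg_closed_val[OF f(1)] by simp
      qed
      then show False using nz by (simp add: free_alg_simps)
    qed
    moreover have "x \<otimes>\<^bsub>TLA\<^esub> y = cls (f \<otimes>\<^bsub>FS\<^esub> g)" using f g by simp
    ultimately show ?thesis unfolding Sp_def using FS.m_closed[OF f(1) g(1)] by blast
  qed
qed

lemma Sp_Un: "Sp (X \<union> Y) = {x \<oplus>\<^bsub>TLA\<^esub> y | x y. x \<in> Sp X \<and> y \<in> Sp Y}"
proof (intro Set.set_eqI iffI)
  fix x assume "x \<in> Sp (X \<union> Y)"
  then obtain f where f: "f \<in> carrier FS" "{w. f w \<noteq> \<zero>} \<subseteq> X \<union> Y" "x = cls f" unfolding Sp_def by blast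
  note c = restr_closed[OF f(1), of X] restr_closed[OF f(1), of "- X"]
  have "f = restr R X f \<oplus>\<^bsub>FS\<^esub> restr R (- X) f"
    using free_alg_closed_val[OF f(1)] by (auto simp: free_alg_simps restr_def)
  then have "x = cls (restr R X f) \<oplus>\<^bsub>TLA\<^esub> cls (restr R (- X) f)" using f(3) cls.hom_add[OF c] by simp
  moreover have "{w. restr R X f w \<noteq> \<zero>} \<subseteq> X" "{w. restr R (- X) f w \<noteq> \<zero>} \<subseteq> Y"
    using f(2) by (auto simp: restr_def)
  then have "cls (restr R X f) \<in> Sp X" "cls (restr R (- X) f) \<in> Sp Y"
    using c unfolding Sp_def by blast+
  ultimately show "x \<in> {x \<oplus>\<^bsub>TLA\<^esub> y | x y. x \<in> Sp X \<and> y \<in> Sp Y}" by blast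
next
  fix x assume "x \<in> {x \<oplus>\<^bsub>TLA\<^esub> y | x y. x \<in> Sp X \<and> y \<in> Sp Y}"
  then obtain f g where f: "f \<in> carrier FS" "{w. f w \<noteq> \<zero>} \<subseteq> X" and g: "g \<in> carrier FS" "{w. g w \<noteq> \<zero>} \<subseteq> Y"
    and x: "x = cls f \<oplus>\<^bsub>TLA\<^esub> cls g" unfolding Sp_def by blast
  have "{w. (f \<oplus>\<^bsub>FS\<^esub> g) w \<noteq> \<zero>} \<subseteq> X \<union> Y" using f g support_add[of f g] by blast
  moreover have "x = cls (f \<oplus>\<^bsub>FS\<^esub> g)" using f g x by simp
  ultimately show "x \<in> Sp (X \<union> Y)" unfolding Sp_def using FS.a_closed[OF f(1) g(1)] by blast
qed

end

section \<open>The grading by invariants of words\<close>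

text \<open>Only the words of a relation are kept. The coefficient \<open>a\<close> of a closed loop
  is dropped, since membership in an invariant set concerns words alone.\<close>

definition TL_rule :: "nat list \<Rightarrow> nat list \<Rightarrow> bool" where
  "TL_rule l r \<longleftrightarrow> (\<exists>i j. l = [i, j] \<and> r = [j, i] \<and> (i + 2 \<le> j \<or> j + 2 \<le> i)) \<or>
     (\<exists>i j. l = [i, j, i] \<and> r = [i] \<and> (j = i + 1 \<or> i = j + 1)) \<or> (\<exists>i. l = [i, i] \<and> r = [i])"

definition invariant :: "nat list set \<Rightarrow> bool" where
  "invariant Q \<longleftrightarrow> (\<forall>x y l r. TL_rule l r \<longrightarrow> (x @ l @ y \<in> Q \<longleftrightarrow> x @ r @ y \<in> Q))"

lemma invariant_left: "invariant Q \<Longrightarrow> invariant {w. u @ w \<in> Q}"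
  unfolding invariant_def by (metis append.assoc mem_Collect_eq)

lemma invariant_right: "invariant Q \<Longrightarrow> invariant {w. w @ u \<in> Q}"
  unfolding invariant_def by (metis append.assoc mem_Collect_eq)

context cring begin

lemma restr_add:
  "restr R Q (f \<oplus>\<^bsub>free_alg R S\<^esub> g) = restr R Q f \<oplus>\<^bsub>free_alg R S\<^esub> restr R Q g"
  by (auto simp: restr_def free_alg_simps)

lemma restr_zero: "restr R Q \<zero>\<^bsub>free_alg R S\<^esub> = \<zero>\<^bsub>free_alg R S\<^esub>"
  by (auto simp: restr_def free_alg_simps)

lemma restr_smult: "r \<in> carrier R \<Longrightarrow> restr R Q (r \<odot>\<^bsub>free_alg R S\<^esub> f) = r \<odot>\<^bsub>free_alg R S\<^esub> restr R Q f"
  by (auto simp: restr_def free_alg_simps)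

lemma restr_neg:
  assumes f: "f \<in> carrier (free_alg R S)"
  shows "restr R Q (\<ominus>\<^bsub>free_alg R S\<^esub> f) = \<ominus>\<^bsub>free_alg R S\<^esub> restr R Q f"
proof -
  interpret FS: ring "free_alg R S" by (rule free_alg_ring)
  have "restr R Q (\<ominus>\<^bsub>free_alg R S\<^esub> f) \<oplus>\<^bsub>free_alg R S\<^esub> restr R Q f = \<zero>\<^bsub>free_alg R S\<^esub>"
    using f by (simp add: restr_add[symmetric] FS.l_neg restr_zero)
  then show ?thesis
    by (rule FS.minus_equality[symmetric]) (simp_all add: restr_closed f)
qed

lemma restr_mon_left:
  assumes f: "f \<in> carrier (free_alg R S)"
  shows "restr R Q (word_mon R u \<otimes>\<^bsub>free_alg R S\<^esub> f) = word_mon R u \<otimes>\<^bsub>free_alg R S\<^esub> restr R {w. u @ w \<in> Q} f"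
proof
  fix w show "restr R Q (word_mon R u \<otimes>\<^bsub>free_alg R S\<^esub> f) w = (word_mon R u \<otimes>\<^bsub>free_alg R S\<^esub> restr R {w. u @ w \<in> Q} f) w"
    unfolding word_mon_mult_left[OF restr_closed[OF f]]
    by (simp add: restr_def word_mon_mult_left[OF f]) (metis append_take_drop_id)
qed

lemma restr_mon_right:
  assumes f: "f \<in> carrier (free_alg R S)"
  shows "restr R Q (f \<otimes>\<^bsub>free_alg R S\<^esub> word_mon R u) = restr R {w. w @ u \<in> Q} f \<otimes>\<^bsub>free_alg R S\<^esub> word_mon R u"
proof
  fix w show "restr R Q (f \<otimes>\<^bsub>free_alg R S\<^esub> word_mon R u) w = (restr R {w. w @ u \<in> Q} f \<otimes>\<^bsub>free_alg R S\<^esub> word_mon R u) w"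
    unfolding word_mon_mult_right[OF restr_closed[OF f]]
    by (simp add: restr_def word_mon_mult_right[OF f]) (metis append_take_drop_id)
qed

lemma restr_mon: "restr R Q (word_mon R w) = (if w \<in> Q then word_mon R w else \<zero>\<^bsub>free_alg R S\<^esub>)"
  by (auto simp: restr_def word_mon_def free_alg_simps)

end

context temperley_lieb begin

lemma letter_mon: "letter R i = word_mon R [i]"
  by (simp add: letter_def word_mon_def)

lemma relator_cases:
  assumes "x \<in> TL_relators R n a"
  obtains l r c where "TL_rule l r" "l \<in> letters" "r \<in> letters" "c \<in> carrier R"
    "x = word_mon R l \<ominus>\<^bsub>FS\<^esub> c \<odot>\<^bsub>FS\<^esub> word_mon R r"
proof -
  have one: "\<one> \<odot>\<^bsub>FS\<^esub> word_mon R r = word_mon R r" for r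
    by (auto simp: free_alg_simps word_mon_def)
  have m: "word_mon R u \<otimes>\<^bsub>FS\<^esub> word_mon R v = word_mon R (u @ v)" if "v \<in> letters" for u v
    using word_mon_mult[OF that] .
  show thesis
    using assms unfolding TL_relators_def Let_def letter_mon
  proof (elim UnE CollectE exE conjE, goal_cases)
    case (1 i j)
    then show ?case by (intro that[of "[i, j]" "[j, i]" \<one>]) (auto simp: TL_rule_def one m)
  next
    case (2 i j)
    then show ?case by (intro that[of "[i, j, i]" "[i]" \<one>]) (auto simp: TL_rule_def one m)
  next
    case (3 i)
    then show ?case by (intro that[of "[i, i]" "[i]" a]) (auto simp: TL_rule_def m a)
  qed
qed

lemma TL_ideal_smult: "r \<in> carrier R \<Longrightarrow> f \<in> TL_ideal R n a \<Longrightarrow> r \<odot>\<^bsub>FS\<^esub> f \<in> TL_ideal R n a"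
  using I.I_l_closed[of f "r \<odot>\<^bsub>FS\<^esub> \<one>\<^bsub>FS\<^esub>"] free_alg_scalar(1)[of r f "{1..<n}"]
    free_alg_smult_closed[OF _ FS.one_closed] I.Icarr by simp

text \<open>As both sides of every relation have the same invariants, the algebra is graded by any
  invariant of words: the ideal of relations is stable under restriction to an invariant set.\<close>

lemma TL_ideal_restr:
  assumes Q: "invariant Q" and f: "f \<in> TL_ideal R n a"
  shows "restr R Q f \<in> TL_ideal R n a"
proof -
  \<comment> \<open>All invariant sets have to be treated at once: multiplication by a word
    \<open>u\<close> replaces \<open>Q\<close> by the set of words that \<open>u\<close> carries
    into \<open>Q\<close>.\<close>
  define J where "J = {f \<in> carrier FS. \<forall>Q. invariant Q \<longrightarrow> restr R Q f \<in> TL_ideal R n a}"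
  have Jc: "f \<in> carrier FS" if "f \<in> J" for f using that by (simp add: J_def)
  have JQ: "restr R Q f \<in> TL_ideal R n a" if "f \<in> J" "invariant Q" for f Q using that by (simp add: J_def)
  have Jadd: "f \<oplus>\<^bsub>FS\<^esub> g \<in> J" if "f \<in> J" "g \<in> J" for f g
    using that by (auto simp: J_def restr_add)
  have J0: "\<zero>\<^bsub>FS\<^esub> \<in> J" by (simp add: J_def restr_zero)
  have Jsm: "r \<odot>\<^bsub>FS\<^esub> f \<in> J" if "r \<in> carrier R" "f \<in> J" for r f
    using that by (auto simp: J_def restr_smult TL_ideal_smult free_alg_smult_closed)
  have monl: "word_mon R u \<otimes>\<^bsub>FS\<^esub> f \<in> J" if "f \<in> J" "u \<in> letters" for f u
    using that JQ[OF that(1) invariant_left] word_mon_closed[OF that(2)] Jc[OF that(1)]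
    by (auto simp: J_def restr_mon_left intro: I.I_l_closed)
  have monr: "f \<otimes>\<^bsub>FS\<^esub> word_mon R u \<in> J" if "f \<in> J" "u \<in> letters" for f u
    using that JQ[OF that(1) invariant_right] word_mon_closed[OF that(2)] Jc[OF that(1)]
    by (auto simp: J_def restr_mon_right intro: I.I_r_closed)
  have smm: "(r \<odot>\<^bsub>FS\<^esub> x) \<otimes>\<^bsub>FS\<^esub> y = r \<odot>\<^bsub>FS\<^esub> (x \<otimes>\<^bsub>FS\<^esub> y)" "x \<otimes>\<^bsub>FS\<^esub> (r \<odot>\<^bsub>FS\<^esub> y) = r \<odot>\<^bsub>FS\<^esub> (x \<otimes>\<^bsub>FS\<^esub> y)"
    if "r \<in> carrier R" "x \<in> carrier FS" "y \<in> carrier FS" for r x y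
  proof -
    let ?r = "r \<odot>\<^bsub>FS\<^esub> \<one>\<^bsub>FS\<^esub>"
    have rc: "?r \<in> carrier FS" using free_alg_smult_closed[OF that(1) FS.one_closed] .
    show "(r \<odot>\<^bsub>FS\<^esub> x) \<otimes>\<^bsub>FS\<^esub> y = r \<odot>\<^bsub>FS\<^esub> (x \<otimes>\<^bsub>FS\<^esub> y)"
      unfolding free_alg_scalar(1)[OF that(1,2), symmetric] free_alg_scalar(1)[OF that(1) FS.m_closed[OF that(2,3)], symmetric]
      by (rule FS.m_assoc[OF rc that(2,3)])
    show "x \<otimes>\<^bsub>FS\<^esub> (r \<odot>\<^bsub>FS\<^esub> y) = r \<odot>\<^bsub>FS\<^esub> (x \<otimes>\<^bsub>FS\<^esub> y)"
      unfolding free_alg_scalar(2)[OF that(1,3), symmetric] free_alg_scalar(2)[OF that(1) FS.m_closed[OF that(2,3)], symmetric]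
      by (rule FS.m_assoc[OF that(2,3) rc, symmetric])
  qed
  have l: "g \<otimes>\<^bsub>FS\<^esub> f \<in> J" if f: "f \<in> J" and g: "g \<in> carrier FS" for f g
    using g subset_UNIV
  proof (rule free_alg_induct)
    show "\<zero>\<^bsub>FS\<^esub> \<otimes>\<^bsub>FS\<^esub> f \<in> J" using Jc[OF f] J0 by simp
    fix g r w assume h: "g \<otimes>\<^bsub>FS\<^esub> f \<in> J" "g \<in> carrier FS" "r \<in> carrier R" "w \<in> letters"
    note c = word_mon_closed[OF h(4)]
    have "(g \<oplus>\<^bsub>FS\<^esub> r \<odot>\<^bsub>FS\<^esub> word_mon R w) \<otimes>\<^bsub>FS\<^esub> f = g \<otimes>\<^bsub>FS\<^esub> f \<oplus>\<^bsub>FS\<^esub> r \<odot>\<^bsub>FS\<^esub> (word_mon R w \<otimes>\<^bsub>FS\<^esub> f)"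
      using FS.l_distr[OF h(2) free_alg_smult_closed[OF h(3) c] Jc[OF f]] smm(1)[OF h(3) c Jc[OF f]] by simp
    then show "(g \<oplus>\<^bsub>FS\<^esub> r \<odot>\<^bsub>FS\<^esub> word_mon R w) \<otimes>\<^bsub>FS\<^esub> f \<in> J"
      using Jadd[OF h(1) Jsm[OF h(3) monl[OF f h(4)]]] by simp
  qed
  have r: "f \<otimes>\<^bsub>FS\<^esub> g \<in> J" if f: "f \<in> J" and g: "g \<in> carrier FS" for f g
    using g subset_UNIV
  proof (rule free_alg_induct)
    show "f \<otimes>\<^bsub>FS\<^esub> \<zero>\<^bsub>FS\<^esub> \<in> J" using Jc[OF f] J0 by simp
    fix g r w assume h: "f \<otimes>\<^bsub>FS\<^esub> g \<in> J" "g \<in> carrier FS" "r \<in> carrier R" "w \<in> letters"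
    note c = word_mon_closed[OF h(4)]
    have "f \<otimes>\<^bsub>FS\<^esub> (g \<oplus>\<^bsub>FS\<^esub> r \<odot>\<^bsub>FS\<^esub> word_mon R w) = f \<otimes>\<^bsub>FS\<^esub> g \<oplus>\<^bsub>FS\<^esub> r \<odot>\<^bsub>FS\<^esub> (f \<otimes>\<^bsub>FS\<^esub> word_mon R w)"
      using FS.r_distr[OF h(2) free_alg_smult_closed[OF h(3) c] Jc[OF f]] smm(2)[OF h(3) Jc[OF f] c] by simp
    then show "f \<otimes>\<^bsub>FS\<^esub> (g \<oplus>\<^bsub>FS\<^esub> r \<odot>\<^bsub>FS\<^esub> word_mon R w) \<in> J"
      using Jadd[OF h(1) Jsm[OF h(3) monr[OF f h(4)]]] by simp
  qed
  have "ideal J FS"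
  proof (rule idealI[OF FS.ring_axioms])
    show "subgroup J (add_monoid FS)"
    proof (rule subgroup.intro)
      show "J \<subseteq> carrier (add_monoid FS)" using Jc by auto
      show "x \<otimes>\<^bsub>add_monoid FS\<^esub> y \<in> J" if "x \<in> J" "y \<in> J" for x y using Jadd[OF that] by simp
      show "\<one>\<^bsub>add_monoid FS\<^esub> \<in> J" using J0 by simp
      show "inv\<^bsub>add_monoid FS\<^esub> x \<in> J" if "x \<in> J" for x
        using Jc[OF that] JQ[OF that] by (auto simp: a_inv_def[symmetric] J_def restr_neg I.a_inv_closed)
    qed
  qed (use l r in auto)
  moreover have "TL_relators R n a \<subseteq> J"
  proof
    fix x assume x: "x \<in> TL_relators R n a"
    then obtain l r c where lr: "TL_rule l r" "l \<in> letters" "r \<in> letters" "c \<in> carrier R"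
      "x = word_mon R l \<ominus>\<^bsub>FS\<^esub> c \<odot>\<^bsub>FS\<^esub> word_mon R r" by (rule relator_cases)
    have xI: "x \<in> TL_ideal R n a"
      unfolding TL_ideal_def using FS.genideal_self[OF TL_relators_closed[OF a]] x by blast
    have "restr R Q x \<in> TL_ideal R n a" if "invariant Q" for Q
    proof -
      have "l \<in> Q \<longleftrightarrow> r \<in> Q"
        using that lr(1) unfolding invariant_def by (metis append.left_neutral append.right_neutral)
      \<comment> \<open>Both words of a relator lie in \<open>Q\<close> or neither does, so that
        restriction keeps the relator or annihilates it.\<close>
      then have "restr R Q x = (if l \<in> Q then x else \<zero>\<^bsub>FS\<^esub>)"
        using word_mon_closed[OF lr(2)] word_mon_closed[OF lr(3)] lr(4) free_alg_smult_closed[OF lr(4) word_mon_closed[OF lr(3)]]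
          free_alg_smult_closed[OF lr(4) FS.zero_closed] free_alg_scalar(1)[OF lr(4) FS.zero_closed]
          free_alg_smult_closed[OF lr(4) FS.one_closed]
        by (auto simp: lr(5) FS.minus_eq restr_add restr_neg restr_smult restr_mon[where S = "{1..<n}"])
      then show ?thesis using xI by simp
    qed
    then show "x \<in> J" using I.Icarr[OF xI] by (simp add: J_def)
  qed
  ultimately have "TL_ideal R n a \<subseteq> J"
    unfolding TL_ideal_def by (rule FS.genideal_minimal)
  then show ?thesis using f Q by (auto simp: J_def)
qed

text \<open>Two polynomials for the same element differ by a member of the ideal of relations, and
  so do their restrictions to \<open>Q\<close>. The one supported on \<open>Y\<close> is unchanged,
  so the restriction of the other still represents the element.\<close>

lemma Sp_Int:
  assumes Q: "invariant Q" and Y: "Y \<subseteq> Q"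
  shows "Sp X \<inter> Sp Y \<subseteq> Sp (X \<inter> Q)"
proof
  fix x assume "x \<in> Sp X \<inter> Sp Y"
  then obtain f g where f: "f \<in> carrier FS" "{w. f w \<noteq> \<zero>} \<subseteq> X" "x = cls f"
    and g: "g \<in> carrier FS" "{w. g w \<noteq> \<zero>} \<subseteq> Y" "x = cls g" unfolding Sp_def by blast
  have "f \<ominus>\<^bsub>FS\<^esub> g \<in> TL_ideal R n a" using cls_eq_iff[OF f(1) g(1)] f g by simp
  then have "restr R Q (f \<ominus>\<^bsub>FS\<^esub> g) \<in> TL_ideal R n a" by (rule TL_ideal_restr[OF Q])
  moreover have "restr R Q (f \<ominus>\<^bsub>FS\<^esub> g) = restr R Q f \<ominus>\<^bsub>FS\<^esub> restr R Q g"
    using f(1) g(1) by (simp add: FS.minus_eq restr_add restr_neg)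
  moreover have "g w = \<zero>" if "w \<notin> Q" for w using g(2) Y that by blast
  then have "restr R Q g = g" by (auto simp: restr_def)
  ultimately have "cls (restr R Q f) = x" using cls_eq_iff[OF restr_closed[OF f(1)] g(1)] g(3) by simp
  moreover have "{w. restr R Q f w \<noteq> \<zero>} \<subseteq> X \<inter> Q" using f(2) by (auto simp: restr_def)
  ultimately show "x \<in> Sp (X \<inter> Q)" using restr_closed[OF f(1)] unfolding Sp_def by blast
qed

lemma W_rules:
  "i \<in> {1..<n} \<Longrightarrow> j \<in> {1..<n} \<Longrightarrow> i + 2 \<le> j \<or> j + 2 \<le> i \<Longrightarrow> W [i, j] = W [j, i]"
  "i \<in> {1..<n} \<Longrightarrow> j \<in> {1..<n} \<Longrightarrow> j = i + 1 \<or> i = j + 1 \<Longrightarrow> W [i, j, i] = W [i]"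
  "i \<in> {1..<n} \<Longrightarrow> W [i, i] = sc a \<otimes>\<^bsub>TLA\<^esub> W [i]"
proof -
  have m: "word_mon R u \<otimes>\<^bsub>FS\<^esub> word_mon R v = word_mon R (u @ v)" if "v \<in> letters" for u v
    using word_mon_mult[OF that] .
  have rel: "x \<in> TL_ideal R n a" if "x \<in> TL_relators R n a" for x
    unfolding TL_ideal_def using FS.genideal_self[OF TL_relators_closed[OF a]] that by blast
  show "W [i, j] = W [j, i]" if "i \<in> {1..<n}" "j \<in> {1..<n}" "i + 2 \<le> j \<or> j + 2 \<le> i"
  proof -
    have "letter R i \<otimes>\<^bsub>FS\<^esub> letter R j \<ominus>\<^bsub>FS\<^esub> letter R j \<otimes>\<^bsub>FS\<^esub> letter R i \<in> TL_relators R n a"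
      unfolding TL_relators_def Let_def using that by blast
    then have "word_mon R [i, j] \<ominus>\<^bsub>FS\<^esub> word_mon R [j, i] \<in> TL_ideal R n a"
      using rel m that by (simp add: letter_mon)
    then show ?thesis unfolding W_def
      using cls_eq_iff[OF word_mon_closed[of "[i, j]" "{1..<n}"] word_mon_closed[of "[j, i]" "{1..<n}"]] that by simp
  qed
  show "W [i, j, i] = W [i]" if "i \<in> {1..<n}" "j \<in> {1..<n}" "j = i + 1 \<or> i = j + 1"
  proof -
    have "letter R i \<otimes>\<^bsub>FS\<^esub> letter R j \<otimes>\<^bsub>FS\<^esub> letter R i \<ominus>\<^bsub>FS\<^esub> letter R i \<in> TL_relators R n a"
      unfolding TL_relators_def Let_def using that by blast
    then have "word_mon R [i, j, i] \<ominus>\<^bsub>FS\<^esub> word_mon R [i] \<in> TL_ideal R n a"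
      using rel m that by (simp add: letter_mon)
    then show ?thesis unfolding W_def
      using cls_eq_iff[OF word_mon_closed[of "[i, j, i]" "{1..<n}"] word_mon_closed[of "[i]" "{1..<n}"]] that by simp
  qed
  show "W [i, i] = sc a \<otimes>\<^bsub>TLA\<^esub> W [i]" if "i \<in> {1..<n}"
  proof -
    have "letter R i \<otimes>\<^bsub>FS\<^esub> letter R i \<ominus>\<^bsub>FS\<^esub> a \<odot>\<^bsub>FS\<^esub> letter R i \<in> TL_relators R n a"
      unfolding TL_relators_def Let_def using that by blast
    then have "word_mon R [i, i] \<ominus>\<^bsub>FS\<^esub> a \<odot>\<^bsub>FS\<^esub> word_mon R [i] \<in> TL_ideal R n a"
      using rel m that by (simp add: letter_mon)
    then have "cls (word_mon R [i, i]) = cls (a \<odot>\<^bsub>FS\<^esub> word_mon R [i])"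
      using cls_eq_iff[OF word_mon_closed free_alg_smult_closed[OF a word_mon_closed], of "[i, i]" "[i]"] that by simp
    then show ?thesis unfolding W_def using cls_smult[OF a word_mon_closed, of "[i]"] that by simp
  qed
qed

end

section \<open>Half diagrams and minimal forms of words in the algebra\<close>

abbreviation iw :: "nat list \<Rightarrow> int list" where "iw \<equiv> map int"

definition cup_below :: "nat \<Rightarrow> nat list set" where
  "cup_below k = {w. \<exists>i. 1 \<le> i \<and> i < k \<and> st (iw w) (int i) = int i + 1}"

lemma st_rule: "TL_rule l r \<Longrightarrow> st (iw (x @ l @ y)) = st (iw (x @ r @ y))"
  unfolding TL_rule_def
proof (elim disjE exE conjE)
  fix i j assume "l = [i, j]" "r = [j, i]" "i + 2 \<le> j"
  then show ?thesis using st_comm[of "int i" "int j" "iw x" "iw y"] by simp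
next
  fix i j assume "l = [i, j]" "r = [j, i]" "j + 2 \<le> i"
  then show ?thesis using st_comm[of "int i" "int j" "iw x" "iw y"] by simp
next
  fix i j assume "l = [i, j, i]" "r = [i]" "j = i + 1"
  then show ?thesis using st_near[of "int i" "int j" "iw x" "iw y"] by simp
next
  fix i j assume "l = [i, j, i]" "r = [i]" "i = j + 1"
  then show ?thesis using st_near[of "int i" "int j" "iw x" "iw y"] by simp
next
  fix i assume "l = [i, i]" "r = [i]"
  then show ?thesis using st_idem[of "iw x" "int i" "iw y"] by simp
qed

lemma invariant_cup_below: "invariant (cup_below k)"
  unfolding invariant_def
proof (intro allI impI)
  fix x y l r assume "TL_rule l r"
  then have "st (iw (x @ l @ y)) = st (iw (x @ r @ y))" by (rule st_rule)
  then show "x @ l @ y \<in> cup_below k \<longleftrightarrow> x @ r @ y \<in> cup_below k" unfolding cup_below_def mem_Collect_eq by (simp only:)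
qed

lemma st_far_letters:
  assumes "st v i = i + 1" "\<forall>j\<in>set u. j \<ge> i + 2 \<or> j \<le> i - 2"
  shows "st (v @ u) i = i + 1"
  using assms(2)
proof (induction u rule: rev_induct)
  case Nil then show ?case using assms(1) by simp
next
  case (snoc j u)
  then have IH: "st (v @ u) i = i + 1" by simp
  have "j \<ge> i + 2 \<or> j \<le> i - 2" using snoc.prems by simp
  then have "act j (st (v @ u)) i = i + 1" using IH by (auto simp: cupg_def)
  then show ?case using st_snoc[of "v @ u" j] by simp
qed

lemma st_cup: "st (v @ [j]) j = j + 1"
  by (simp add: cupg_def)

abbreviation (input) gaps :: "nat list \<Rightarrow> bool" where "gaps \<equiv> sorted_wrt (\<lambda>i j. i + 2 \<le> j)"

text \<open>The letters that follow \<open>i\<close> in \<open>M\<close> are distant from it and do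
  not touch the cup that it makes.\<close>

lemma st_cups:
  assumes "gaps M" "i \<in> set M" shows "st (iw (z @ M)) (int i) = int i + 1"
proof -
  obtain u v where M: "M = u @ [i] @ v" using split_list[OF assms(2)] by auto
  have "st ((iw (z @ u) @ [int i]) @ iw v) (int i) = int i + 1"
  proof (rule st_far_letters[OF st_cup])
    show "\<forall>j\<in>set (iw v). j \<ge> int i + 2 \<or> j \<le> int i - 2"
      using assms(1) unfolding M by (auto simp: sorted_wrt_append)
  qed
  then show ?thesis unfolding M by simp
qed

context temperley_lieb begin

lemma sc_mult: "r \<in> carrier R \<Longrightarrow> s \<in> carrier R \<Longrightarrow> sc (r \<otimes> s) = sc r \<otimes>\<^bsub>TLA\<^esub> sc s"
proof -
  assume r: "r \<in> carrier R" and s: "s \<in> carrier R"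
  have "(r \<otimes> s) \<odot>\<^bsub>FS\<^esub> \<one>\<^bsub>FS\<^esub> = r \<odot>\<^bsub>FS\<^esub> (s \<odot>\<^bsub>FS\<^esub> \<one>\<^bsub>FS\<^esub>)"
    using r s by (auto simp: free_alg_simps m_assoc)
  then show ?thesis
    using r s cls_smult[OF r free_alg_smult_closed[OF s FS.one_closed]] by (simp add: sc_cls)
qed

lemma sc_one: "sc \<one> = \<one>\<^bsub>TLA\<^esub>"
proof -
  have "\<one> \<odot>\<^bsub>FS\<^esub> \<one>\<^bsub>FS\<^esub> = \<one>\<^bsub>FS\<^esub>" by (auto simp: free_alg_simps)
  then show ?thesis using sc_cls[OF one_closed] by simp
qed

lemma W_context: 
  assumes "x \<in> letters" "y \<in> letters" "u \<in> letters" "v \<in> letters" "W u = W v"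
  shows "W (x @ u @ y) = W (x @ v @ y)"
proof -
  have "u @ y \<in> letters" "v @ y \<in> letters" using assms by auto
  then show ?thesis using W_append[OF assms(1)] W_append[OF assms(3,2)] W_append[OF assms(4,2)] assms(5) by simp
qed

text \<open>The combinatorics takes place on integer words. A commutation never leaves the image of
  the admissible words, so its result can be read back in the algebra.\<close>

lemma W_ceq:
  assumes "ceq (iw u) w'" "u \<in> letters"
  shows "\<exists>v\<in>letters. w' = iw v \<and> W v = W u"
  using assms(1)
proof (induction rule: ceq.induct)
  case refl then show ?case using assms(2) by blast
next
  case (step x i j y)
  then obtain v where v: "v \<in> letters" "x @ [i, j] @ y = iw v" "W v = W u" by blast
  then obtain x' v1 where v1: "v = x' @ v1" "x = iw x'" "[i, j] @ y = iw v1"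
    by (metis append_eq_map_conv)
  then obtain i' j' y' where v2: "v1 = [i', j'] @ y'" "i = int i'" "j = int j'" "y = iw y'"
    by (auto simp: Cons_eq_map_conv)
  have l: "x' \<in> letters" "y' \<in> letters" "i' \<in> {1..<n}" "j' \<in> {1..<n}" using v(1) v1 v2 by auto
  have "i' + 2 \<le> j' \<or> j' + 2 \<le> i'" using step.hyps(2) v2 by linarith
  then have "W (x' @ [i', j'] @ y') = W (x' @ [j', i'] @ y')"
    by (intro W_context W_rules(1)[OF l(3,4)]) (use l in auto)
  then show ?case using v v1 v2 l by (intro bexI[of _ "x' @ [j', i'] @ y'"]) auto
qed

text \<open>As long as some commuted form has a contractible factor, the word is shortened; this
  costs the scalar \<open>a\<close> or \<open>1\<close> and leaves the half diagram alone.\<close>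

lemma W_minimal:
  assumes "w \<in> letters"
  shows "\<exists>r\<in>carrier R. \<exists>v\<in>letters. minimal (iw v) \<and> st (iw v) = st (iw w) \<and> W w = sc r \<otimes>\<^bsub>TLA\<^esub> W v"
  using assms
proof (induction "length w" arbitrary: w rule: less_induct)
  case less
  show ?case
  proof (cases "minimal (iw w)")
    case True
    then show ?thesis using less.prems W_closed by (intro bexI[of _ \<one>] bexI[of _ w]) (auto simp: sc_one)
  next
    case False
    then obtain w' where w': "ceq (iw w) w'" "contractible w'" unfolding minimal_def by blast
    then obtain u where u: "u \<in> letters" "w' = iw u" "W u = W w" using W_ceq less.prems by blast
    have len: "length u = length w"
    proof -
      have "ceq p q \<Longrightarrow> length q = length p" for p q by (induction rule: ceq.induct) auto
      then show ?thesis using w'(1) u(2) by (metis length_map)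
    qed
    have su: "st (iw u) = st (iw w)" using ceq_st[OF w'(1)] u(2) by simp
    obtain v c where v: "v \<in> letters" "c \<in> carrier R" "length v < length u" "st (iw v) = st (iw u)" "W u = sc c \<otimes>\<^bsub>TLA\<^esub> W v"
    proof -
      from w'(2) consider (1) x y i where "w' = x @ [i, i] @ y" | (2) x y i j where "\<bar>i - j\<bar> = 1" "w' = x @ [i, j, i] @ y"
        unfolding contractible_def by blast
      then show thesis
      proof cases
        case 1
        then have "iw u = x @ ([i, i] @ y)" using u(2) by simp
        then obtain x' u1 where u1: "u = x' @ u1" "x = iw x'" "[i, i] @ y = iw u1"
          by (metis append_eq_map_conv)
        then obtain i' y' where u2: "u1 = [i', i'] @ y'" "i = int i'"
          by (auto simp: Cons_eq_map_conv)
        have l: "x' \<in> letters" "y' \<in> letters" "i' \<in> {1..<n}" using u(1) u1 u2 by auto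
        have l': "[i'] \<in> letters" "[i', i'] \<in> letters" using l by auto
        have "W (x' @ [i', i'] @ y') = W x' \<otimes>\<^bsub>TLA\<^esub> ((sc a \<otimes>\<^bsub>TLA\<^esub> W [i']) \<otimes>\<^bsub>TLA\<^esub> W y')"
          using l l' W_rules(3)[OF l(3)] by (simp only: W_append append_in_lists_conv simp_thms)
        also have "\<dots> = (W x' \<otimes>\<^bsub>TLA\<^esub> sc a) \<otimes>\<^bsub>TLA\<^esub> (W [i'] \<otimes>\<^bsub>TLA\<^esub> W y')"
          using W_closed[OF l(1)] W_closed[OF l(2)] W_closed[OF l'(1)] sc_closed[OF a] by (simp add: TLA.m_assoc)
        also have "\<dots> = sc a \<otimes>\<^bsub>TLA\<^esub> W (x' @ [i'] @ y')"
          unfolding sc_central[OF a W_closed[OF l(1)]]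
          using W_closed[OF l(1)] W_closed[OF l(2)] W_closed[OF l'(1)] sc_closed[OF a] l l'
          by (simp only: W_append append_in_lists_conv simp_thms TLA.m_assoc TLA.m_closed)
        finally have "W u = sc a \<otimes>\<^bsub>TLA\<^esub> W (x' @ [i'] @ y')" using u1 u2 by simp
        moreover have "st (iw (x' @ [i'] @ y')) = st (iw u)"
          unfolding u1 u2 by (rule st_rule[symmetric]) (auto simp: TL_rule_def)
        ultimately show thesis using that[of "x' @ [i'] @ y'" a] l u1 u2 a by auto
      next
        case 2
        then have "iw u = x @ ([i, j, i] @ y)" using u(2) by simp
        then obtain x' u1 where u1: "u = x' @ u1" "x = iw x'" "[i, j, i] @ y = iw u1"
          by (metis append_eq_map_conv)
        then obtain i' j' y' where u2: "u1 = [i', j', i'] @ y'" "i = int i'" "j = int j'"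
          by (auto simp: Cons_eq_map_conv)
        have ij: "j' = i' + 1 \<or> i' = j' + 1" using 2(1) u2 by linarith
        have l: "x' \<in> letters" "y' \<in> letters" "i' \<in> {1..<n}" "j' \<in> {1..<n}" using u(1) u1 u2 by auto
        have "W (x' @ [i', j', i'] @ y') = W (x' @ [i'] @ y')"
          by (rule W_context) (use l W_rules(2)[OF l(3,4) ij] in auto)
        then have "W u = sc \<one> \<otimes>\<^bsub>TLA\<^esub> W (x' @ [i'] @ y')" using u1 u2 l W_closed[of "x' @ [i'] @ y'"] by (simp add: sc_one)
        moreover have "st (iw (x' @ [i'] @ y')) = st (iw u)"
          unfolding u1 u2 by (rule st_rule[symmetric]) (use ij in \<open>auto simp: TL_rule_def\<close>)
        ultimately show thesis using that[of "x' @ [i'] @ y'" \<one>] l u1 u2 by auto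
      qed
    qed
    obtain r t where t: "r \<in> carrier R" "t \<in> letters" "minimal (iw t)" "st (iw t) = st (iw v)" "W v = sc r \<otimes>\<^bsub>TLA\<^esub> W t"
      using less.hyps[of v] v len by auto
    have "W w = sc (c \<otimes> r) \<otimes>\<^bsub>TLA\<^esub> W t"
      using u(3) v(5) t(5) sc_mult[OF v(2) t(1)] sc_closed[OF v(2)] sc_closed[OF t(1)] W_closed[OF t(2)]
      by (simp add: TLA.m_assoc)
    then show ?thesis using t v su by (intro bexI[of _ "c \<otimes> r"] bexI[of _ t]) auto
  qed
qed

section \<open>Left ideals spanned by words\<close>

text \<open>For admissible \<open>M\<close> these words span A U_M, and
  \<open>Cup_sub_words k M\<close> spans the ideal S_k inside it.\<close>

definition Cup_words :: "nat list \<Rightarrow> nat list set" where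
  "Cup_words M = {z @ M | z. z \<in> letters}"

definition Cup_sub_words :: "nat \<Rightarrow> nat list \<Rightarrow> nat list set" where
  "Cup_sub_words k M = {z @ [i] @ M | z i. z \<in> letters \<and> i \<in> {1..<n} \<and> i \<le> k}"

lemma word_ideal:
  "left_ideal TLA (Sp (Cup_words M))" "left_ideal TLA (Sp (Cup_sub_words k M))"
proof -
  have "v @ w \<in> Cup_words M" if "v \<in> letters" "w \<in> Cup_words M" for v w
  proof -
    from that(2) obtain z where z: "w = z @ M" "z \<in> letters" unfolding Cup_words_def by blast
    then have "v @ w = (v @ z) @ M" "v @ z \<in> letters" using that(1) by auto
    then show ?thesis unfolding Cup_words_def by blast
  qed
  then show "left_ideal TLA (Sp (Cup_words M))" by (rule Sp_left_ideal)
  have "v @ w \<in> Cup_sub_words k M" if v: "v \<in> letters" and w: "w \<in> Cup_sub_words k M" for v w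
  proof -
    from w obtain z i where z: "w = z @ [i] @ M" "z \<in> letters" "i \<in> {1..<n}" "i \<le> k" unfolding Cup_sub_words_def by blast
    then have "v @ w = (v @ z) @ [i] @ M" "v @ z \<in> letters" using v by auto
    then show ?thesis using z unfolding Cup_sub_words_def by blast
  qed
  then show "left_ideal TLA (Sp (Cup_sub_words k M))" by (rule Sp_left_ideal)
qed

lemma Sp_subset_ideal:
  assumes Y: "left_ideal TLA Y" and X: "\<And>w. w \<in> X \<Longrightarrow> w \<in> letters \<Longrightarrow> W w \<in> Y"
  shows "Sp X \<subseteq> Y"
proof
  fix x assume "x \<in> Sp X"
  then show "x \<in> Y"
  proof (induction rule: Sp_induct)
    case zero show ?case by (rule left_idealD(2)[OF Y])
  next
    case (step y r w)
    show ?case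
      by (rule left_idealD(3)[OF Y step(1) left_idealD(4)[OF Y sc_closed[OF step(3)] X[OF step(4,5)]]])
  qed
qed

text \<open>Every word of S_(k-1) has a cup at some \<open>i < k\<close>. By the grading, the
  intersection is therefore spanned by words that end in \<open>k # M\<close> and have such a cup as
  well; a minimal form of such a word can be made to end in \<open>i # k # M\<close>.\<close>

lemma Cup_words_Int:
  assumes k: "k \<in> {1..<n}" and M: "gaps (k # M)" "M \<in> letters"
  shows "Sp (Cup_words (k # M)) \<inter> Sp (Cup_sub_words (k - 1) M) = Sp (Cup_sub_words (k - 2) (k # M))"
proof
  have far: "int j \<ge> int i + 2" if "j \<in> set M" "i \<le> k" for i j using M(1) that by auto
  have "Cup_sub_words (k - 1) M \<subseteq> cup_below k"
  proof
    fix w assume "w \<in> Cup_sub_words (k - 1) M"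
    then obtain z i where z: "w = z @ [i] @ M" "i \<in> {1..<n}" "i \<le> k - 1" unfolding Cup_sub_words_def by blast
    then have i: "1 \<le> i" "i < k" using k by auto
    have "st ((iw z @ [int i]) @ iw M) (int i) = int i + 1"
    proof (rule st_far_letters[OF st_cup], rule ballI)
      fix j assume "j \<in> set (iw M)"
      then obtain j' where j: "j' \<in> set M" "j = int j'" by auto
      show "j \<ge> int i + 2 \<or> j \<le> int i - 2" using far[OF j(1), of i] i j(2) by simp
    qed
    then have "st (iw w) (int i) = int i + 1" unfolding z(1) by simp
    then show "w \<in> cup_below k" using i unfolding cup_below_def by blast
  qed
  then have "Sp (Cup_words (k # M)) \<inter> Sp (Cup_sub_words (k - 1) M) \<subseteq> Sp (Cup_words (k # M) \<inter> cup_below k)"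
    by (rule Sp_Int[OF invariant_cup_below])
  also have "\<dots> \<subseteq> Sp (Cup_sub_words (k - 2) (k # M))"
  proof (rule Sp_subset_ideal[OF word_ideal(2)])
    fix w assume w: "w \<in> Cup_words (k # M) \<inter> cup_below k" "w \<in> letters"
    then obtain z i where z: "w = z @ (k # M)" and i: "1 \<le> i" "i < k" "st (iw w) (int i) = int i + 1"
      unfolding Cup_words_def cup_below_def by blast
    have cups: "st (iw w) (int j) = int j + 1" if "j \<in> set (k # M)" for j
      unfolding z by (rule st_cups[OF M(1) that])
    \<comment> \<open>Cups at \<open>k - 1\<close> and at \<open>k\<close> would share the point
      \<open>k\<close>.\<close>
    have "i \<noteq> k - 1"
    proof
      assume ik: "i = k - 1"
      then have "st (iw w) (int k) = int k - 1" using i planar_inv[OF planar_st, of "iw w" "int i"] by simp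
      then show False using cups[of k] by simp
    qed
    then have i2: "i \<le> k - 2" "i + 2 \<le> k" using i by auto
    obtain r v where v: "r \<in> carrier R" "v \<in> letters" "minimal (iw v)" "st (iw v) = st (iw w)" "W w = sc r \<otimes>\<^bsub>TLA\<^esub> W v"
      using W_minimal[OF w(2)] by blast
    have "\<exists>t. ceq (iw v) (t @ iw (i # k # M))"
    proof (rule minimal_cups[OF v(3)])
      have "k + 2 \<le> j" if "j \<in> set M" for j using M(1) that by simp
      then have "i + 2 \<le> j" if "j \<in> set M" for j using i2(2) that by (meson add_leD1 le_trans)
      then have g: "gaps (i # k # M)" using M(1) i2(2) by simp
      show "sorted_wrt (\<lambda>i j. i + 2 \<le> j) (iw (i # k # M))"
        unfolding sorted_wrt_map by (rule sorted_wrt_mono_rel[OF _ g]) simp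
      have "st (iw v) (int j) = int j + 1" if "j \<in> set (i # k # M)" for j
        unfolding v(4) using that i(3) cups by (cases "j = i") auto
      then show "\<forall>j\<in>set (iw (i # k # M)). st (iw v) j = j + 1" by simp
    qed
    then obtain t u where t: "u \<in> letters" "t @ iw (i # k # M) = iw u" "W u = W v" using W_ceq[OF _ v(2)] by blast
    then obtain t' m where "u = t' @ m" "iw (i # k # M) = iw m" by (metis append_eq_map_conv)
    then have u: "u = t' @ [i] @ (k # M)" using map_injective[of int "i # k # M" m] by (simp add: inj_of_nat)
    have "t' \<in> letters" "i \<in> {1..<n}" using t(1) u by auto
    then have "u \<in> Cup_sub_words (k - 2) (k # M)" using u i2(1) unfolding Cup_sub_words_def by blast
    then have "W v \<in> Sp (Cup_sub_words (k - 2) (k # M))" using W_Sp[OF t(1)] unfolding t(3)[symmetric] by blast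
    then show "W w \<in> Sp (Cup_sub_words (k - 2) (k # M))"
      unfolding v(5) by (rule left_idealD(4)[OF word_ideal(2) sc_closed[OF v(1)]])
  qed
  finally show "Sp (Cup_words (k # M)) \<inter> Sp (Cup_sub_words (k - 1) M) \<subseteq> Sp (Cup_sub_words (k - 2) (k # M))" .
next
  have "W w \<in> Sp (Cup_words (k # M)) \<and> W w \<in> Sp (Cup_sub_words (k - 1) M)"
    if w: "w \<in> Cup_sub_words (k - 2) (k # M)" "w \<in> letters" for w
  proof
    obtain z i where z: "w = z @ [i] @ (k # M)" "z \<in> letters" "i \<in> {1..<n}" "i \<le> k - 2"
      using w(1) unfolding Cup_sub_words_def by blast
    have "w = (z @ [i]) @ (k # M)" "z @ [i] \<in> letters" using z by auto
    then have "w \<in> Cup_words (k # M)" unfolding Cup_words_def by blast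
    then show "W w \<in> Sp (Cup_words (k # M))" by (rule W_Sp[OF w(2)])
    have ik: "i + 2 \<le> k" using z(3,4) by auto
    have "W (z @ [i, k] @ M) = W (z @ [k, i] @ M)"
      by (intro W_context W_rules(1)[OF z(3) k]) (use z k M ik in auto)
    then have e: "W w = W ((z @ [k]) @ [i] @ M)" unfolding z(1) by simp
    have "z @ [k] \<in> letters" "i \<le> k - 1" using z(2) k ik by auto
    then have "(z @ [k]) @ [i] @ M \<in> Cup_sub_words (k - 1) M"
      unfolding Cup_sub_words_def using z(3) by blast
    moreover have "(z @ [k]) @ [i] @ M \<in> letters" using z k M by auto
    ultimately show "W w \<in> Sp (Cup_sub_words (k - 1) M)" unfolding e by (intro W_Sp)
  qed
  then show "Sp (Cup_sub_words (k - 2) (k # M)) \<subseteq> Sp (Cup_words (k # M)) \<inter> Sp (Cup_sub_words (k - 1) M)"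
    using Sp_subset_ideal[OF word_ideal(1), of "Cup_sub_words (k - 2) (k # M)"]
      Sp_subset_ideal[OF word_ideal(2), of "Cup_sub_words (k - 2) (k # M)"] by blast
qed

end

section \<open>Idempotent generators of the ideals\<close>

context temperley_lieb begin

lemma W_commute:
  assumes "m \<in> {1..<n}" "u \<in> letters" "\<forall>x\<in>set u. x + 2 \<le> m \<or> m + 2 \<le> x"
  shows "W ([m] @ u) = W (u @ [m])"
  using assms(3,2)
proof (induction u)
  case (Cons x u)
  have x: "x \<in> {1..<n}" "u \<in> letters" using Cons.prems(2) by simp_all
  have "W ([] @ [m, x] @ u) = W ([] @ [x, m] @ u)"
    by (intro W_context W_rules(1)) (use assms(1) x Cons.prems in auto)
  also have "\<dots> = W ([x] @ ([m] @ u) @ [])" by simp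
  also have "\<dots> = W ([x] @ (u @ [m]) @ [])"
    by (rule W_context) (use assms(1) x Cons in auto)
  finally show ?case by simp
qed simp

text \<open>Since U_m commutes with both words, the product becomes U U_m U_m' U_m X U, then U U_m X
  U and finally U_m U X U. A letter can thus be added to a regular word at the price of one
  neighbour of it.\<close>

lemma regular_insert:
  assumes U: "U \<in> letters" and X: "X \<in> letters" and m: "m \<in> {1..<n}" "m' \<in> {1..<n}" "m' = m + 1 \<or> m = m' + 1"
    and far: "\<forall>x\<in>set U \<union> set X. x + 2 \<le> m \<or> m + 2 \<le> x"
    and reg: "W (U @ X @ U) = W U"
  shows "W ((m # U) @ (m' # X) @ (m # U)) = W (m # U)"
proof -
  have cU: "W ([m] @ U) = W (U @ [m])" and cX: "W ([m] @ X) = W (X @ [m])"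
    by (rule W_commute; use m U X far in auto)+
  have "W ([] @ ([m] @ U) @ ([m'] @ X @ [m] @ U)) = W ([] @ (U @ [m]) @ ([m'] @ X @ [m] @ U))"
    by (rule W_context[OF _ _ _ _ cU]) (use m U X in auto)
  also have "\<dots> = W ((U @ [m, m']) @ (X @ [m]) @ U)" by simp
  also have "\<dots> = W ((U @ [m, m']) @ ([m] @ X) @ U)"
    by (rule W_context[OF _ _ _ _ cX[symmetric]]) (use m U X in auto)
  also have "\<dots> = W (U @ [m, m', m] @ (X @ U))" by simp
  also have "\<dots> = W (U @ [m] @ (X @ U))"
    by (rule W_context[OF _ _ _ _ W_rules(2)[OF m]]) (use m U X in auto)
  also have "\<dots> = W ([] @ (U @ [m]) @ (X @ U))" by simp
  also have "\<dots> = W ([] @ ([m] @ U) @ (X @ U))"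
    by (rule W_context[OF _ _ _ _ cU[symmetric]]) (use m U X in auto)
  also have "\<dots> = W ([m] @ (U @ X @ U) @ [])" by simp
  also have "\<dots> = W ([m] @ U @ [])"
    by (rule W_context[OF _ _ _ _ reg]) (use m U X in auto)
  finally show ?thesis by simp
qed

text \<open>Each letter m is paired with m - 1, which is a letter because 1 <= p < m. The letters
  are added in increasing order, so that everything used before, at most m - 2, commutes with
  m.\<close>

lemma regular_above:
  assumes "gaps M" "M \<in> letters" "\<forall>i\<in>set M. 1 \<le> p \<and> p + 1 \<le> i"
  shows "\<exists>X\<in>letters. W (M @ X @ M) = W M \<and> (\<forall>x\<in>set X. x + 1 \<in> set M)"
  using assms
proof (induction M rule: rev_induct)
  case Nil then show ?case by (intro bexI[of _ "[]"]) auto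
next
  case (snoc m U)
  have U: "U \<in> letters" "gaps U" "m \<in> {1..<n}" "\<forall>i\<in>set U. i + 2 \<le> m" "1 \<le> p" "p + 1 \<le> m"
    using snoc.prems by (auto simp: sorted_wrt_append)
  obtain X where X: "X \<in> letters" "W (U @ X @ U) = W U" "\<forall>x\<in>set X. x + 1 \<in> set U"
    using snoc.IH U snoc.prems by auto
  have far: "\<forall>x\<in>set U \<union> set X. x + 2 \<le> m \<or> m + 2 \<le> x" using U X(3) by fastforce
  have c: "W ([m] @ U) = W (U @ [m])" by (rule W_commute) (use U in auto)
  have m': "m - 1 \<in> {1..<n}" "m - 1 = m + 1 \<or> m = (m - 1) + 1" using U by auto
  have "W ([] @ (U @ [m]) @ (([m - 1] @ X) @ (U @ [m]))) = W ([] @ ([m] @ U) @ (([m - 1] @ X) @ (U @ [m])))"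
    by (rule W_context[OF _ _ _ _ c[symmetric]]) (use m' U X in auto)
  also have "\<dots> = W (([m] @ U @ [m - 1] @ X) @ (U @ [m]) @ [])" by simp
  also have "\<dots> = W (([m] @ U @ [m - 1] @ X) @ ([m] @ U) @ [])"
    by (rule W_context[OF _ _ _ _ c[symmetric]]) (use m' U X in auto)
  also have "\<dots> = W ((m # U) @ ((m - 1) # X) @ (m # U))" by simp
  also have "\<dots> = W (m # U)" by (rule regular_insert[OF U(1) X(1) U(3) m' far X(2)])
  finally have "W ((U @ [m]) @ ((m - 1) # X) @ (U @ [m])) = W (U @ [m])" using c by simp
  moreover have "(m - 1) # X \<in> letters" using m' X by auto
  moreover have "\<forall>x\<in>set ((m - 1) # X). x + 1 \<in> set (U @ [m])" using X U by auto
  ultimately show ?case by blast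
qed

text \<open>Hence \<open>X U\<^sub>M\<close> is an idempotent which generates the left ideal \<open>A U\<^sub>M\<close>.\<close>

lemma regular:
  assumes "gaps M" "M \<in> letters" "1 \<le> p" "p \<le> n" "p \<notin> set M" "p - 1 \<notin> set M"
  shows "\<exists>X\<in>letters. W (M @ X @ M) = W M \<and> (\<forall>x\<in>set X. p \<le> x \<or> x - 1 \<in> set M \<and> 1 \<le> x)"
  using assms
proof (induction M)
  case Nil then show ?case by (intro bexI[of _ "[]"]) auto
next
  case (Cons m U)
  have U: "U \<in> letters" "gaps U" "m \<in> {1..<n}" "\<forall>i\<in>set U. m + 2 \<le> i" using Cons.prems by auto
  show ?case
  \<comment> \<open>On the right of the uncovered strand \<open>p\<close> a letter is paired with
    its left neighbour, which is at least \<open>p\<close>; on the left of it, with its right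
    neighbour, which is at most \<open>p - 1\<close>. The two choices do not interfere.\<close>
  proof (cases "p + 1 \<le> m")
    case True
    have "\<exists>X\<in>letters. W ((m # U) @ X @ (m # U)) = W (m # U) \<and> (\<forall>x\<in>set X. x + 1 \<in> set (m # U))"
      by (rule regular_above[where p = p]) (use Cons.prems True U in auto)
    moreover have "p \<le> x" if "x + 1 \<in> set (m # U)" for x using that True U(4) by fastforce
    ultimately show ?thesis by blast
  next
    case False
    have "m \<noteq> p" "m \<noteq> p - 1" using Cons.prems by auto
    then have mp: "m + 2 \<le> p" using False by arith
    obtain X where X: "X \<in> letters" "W (U @ X @ U) = W U" "\<forall>x\<in>set X. p \<le> x \<or> x - 1 \<in> set U \<and> 1 \<le> x"
      using Cons by auto
    have far: "\<forall>x\<in>set U \<union> set X. x + 2 \<le> m \<or> m + 2 \<le> x" using U(4) X(3) mp by fastforce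
    have m': "m + 1 \<in> {1..<n}" using mp Cons.prems by auto
    have "W ((m # U) @ ((m + 1) # X) @ (m # U)) = W (m # U)"
      by (rule regular_insert[OF U(1) X(1) U(3) m' _ far X(2)]) simp
    moreover have "(m + 1) # X \<in> letters" using m' X by auto
    moreover have "\<forall>x\<in>set ((m + 1) # X). p \<le> x \<or> x - 1 \<in> set (m # U) \<and> 1 \<le> x" using X by auto
    ultimately show ?thesis by blast
  qed
qed

section \<open>Vanishing of Tor while a strand is uncovered\<close>

lemma aug_cls: "f \<in> carrier FS \<Longrightarrow> TL_aug (cls f) = f []"
  unfolding cls_def by (rule TL_aug_coset[OF a])

sublocale res: resolution R TLA "TL_trivial R"
  by (rule resolution.intro[OF TL_trivial_module(2)[OF is_cring a]]) (rule sc_closed sc_central; assumption)+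

abbreviation (input) ch :: "(nat list \<Rightarrow> 'r) set set \<Rightarrow> nat \<Rightarrow> (((nat list \<Rightarrow> 'r) set, 'r) syz \<Rightarrow> (nat list \<Rightarrow> 'r) set) set" where
  "ch Y \<equiv> chain TLA (TL_trivial R) Y"

abbreviation (input) CY :: "nat list \<Rightarrow> (nat list \<Rightarrow> 'r) set set" where "CY M \<equiv> Sp (Cup_words M)"
abbreviation (input) CS :: "nat \<Rightarrow> nat list \<Rightarrow> (nat list \<Rightarrow> 'r) set set" where "CS k M \<equiv> Sp (Cup_sub_words k M)"

lemma Sp_mono: "X \<subseteq> Y \<Longrightarrow> Sp X \<subseteq> Sp Y"
  unfolding Sp_def by blast

lemma CS_0: "CS 0 M = {\<zero>\<^bsub>TLA\<^esub>}"
proof -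
  have "Cup_sub_words 0 M = {}" unfolding Cup_sub_words_def by auto
  moreover have "x = \<zero>\<^bsub>TLA\<^esub>" if "x \<in> Sp {}" for x using that by (induction rule: Sp_induct) simp_all
  ultimately have "x = \<zero>\<^bsub>TLA\<^esub>" if "x \<in> CS 0 M" for x using that by simp
  then show ?thesis using left_idealD(2)[OF word_ideal(2), of 0 M] by blast
qed

lemma CS_subset: "CS k M \<subseteq> CY M"
proof (rule Sp_mono, rule subsetI)
  fix w assume "w \<in> Cup_sub_words k M"
  then obtain z i where "w = z @ [i] @ M" "z \<in> letters" "i \<in> {1..<n}" unfolding Cup_sub_words_def by blast
  then have "w = (z @ [i]) @ M" "z @ [i] \<in> letters" by auto
  then show "w \<in> Cup_words M" unfolding Cup_words_def by blast
qed

lemma CY_subset: "k \<in> {1..<n} \<Longrightarrow> CY (k # M) \<subseteq> CY M"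
proof (rule Sp_mono, rule subsetI)
  fix w assume k: "k \<in> {1..<n}" and "w \<in> Cup_words (k # M)"
  then obtain z where "w = z @ (k # M)" "z \<in> letters" unfolding Cup_words_def by blast
  then have "w = (z @ [k]) @ M" "z @ [k] \<in> letters" using k by auto
  then show "w \<in> Cup_words M" unfolding Cup_words_def by blast
qed

lemma CS_sum:
  assumes k: "k \<in> {1..<n}"
  shows "ch (CS k M) = res.cx_sum (ch (CY (k # M))) (ch (CS (k - 1) M))"
proof -
  have "Cup_sub_words k M = Cup_words (k # M) \<union> Cup_sub_words (k - 1) M"
  proof (intro Set.set_eqI iffI)
    fix w assume "w \<in> Cup_sub_words k M"
    then obtain z i where z: "w = z @ [i] @ M" "z \<in> letters" "i \<in> {1..<n}" "i \<le> k" unfolding Cup_sub_words_def by blast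
    show "w \<in> Cup_words (k # M) \<union> Cup_sub_words (k - 1) M"
    proof (cases "i = k")
      case True then show ?thesis using z unfolding Cup_words_def by auto
    next
      case False
      then have "i \<le> k - 1" using z by auto
      then show ?thesis using z unfolding Cup_sub_words_def by blast
    qed
  next
    fix w assume w: "w \<in> Cup_words (k # M) \<union> Cup_sub_words (k - 1) M"
    then show "w \<in> Cup_sub_words k M"
    proof
      assume "w \<in> Cup_words (k # M)"
      then obtain z where "w = z @ [k] @ M" "z \<in> letters" unfolding Cup_words_def by auto
      then show ?thesis using k unfolding Cup_sub_words_def by blast
    next
      assume "w \<in> Cup_sub_words (k - 1) M"
      then obtain z i where "w = z @ [i] @ M" "z \<in> letters" "i \<in> {1..<n}" "i \<le> k - 1" unfolding Cup_sub_words_def by blast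
      moreover from this have "i \<le> k" by linarith
      ultimately show ?thesis unfolding Cup_sub_words_def by blast
    qed
  qed
  then show ?thesis using res.chain_sum[OF word_ideal(1) word_ideal(2)] by (simp add: Sp_Un)
qed

text \<open>Words ending in a nonempty \<open>M\<close> are nonempty, so the polynomials they span
  have no constant term.\<close>

lemma CY_kills:
  assumes M: "M \<noteq> []" and y: "y \<in> CY M" and x: "x \<in> carrier (TL_trivial R)"
  shows "y \<odot>\<^bsub>TL_trivial R\<^esub> x = \<zero>\<^bsub>TL_trivial R\<^esub>"
proof -
  obtain f where f: "f \<in> carrier FS" "{w. f w \<noteq> \<zero>} \<subseteq> Cup_words M" "y = cls f" using y unfolding Sp_def by blast
  have "[] \<notin> Cup_words M" using M unfolding Cup_words_def by auto
  then have "TL_aug y = \<zero>" unfolding f(3) aug_cls[OF f(1)] using f(2) by blast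
  then show ?thesis using x by (simp add: TL_trivial_def)
qed

text \<open>The class of \<open>X @ M\<close> is a right identity of A U_M. In degree 0 the ideal
  must also act as zero on the trivial module, which rules out the empty \<open>M\<close>, where the
  ideal is the whole algebra.\<close>

lemma acyclic_base:
  assumes M: "gaps M" "M \<in> letters" "1 \<le> p" "p \<le> n" "p \<notin> set M" "p - 1 \<notin> set M" and t: "t = 0 \<Longrightarrow> M \<noteq> []"
  shows "res.acyclic (ch (CY M)) (ch {\<zero>\<^bsub>TLA\<^esub>}) t"
proof -
  obtain X where X: "X \<in> letters" "W (M @ X @ M) = W M" using regular[OF M] by blast
  have XM: "X @ M \<in> letters" "X @ M \<in> Cup_words M" using X(1) M(2) unfolding Cup_words_def by auto
  show ?thesis
  proof (rule res.acyclic_idempotent[OF word_ideal(1) W_Sp[OF XM]])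
    note e = W_closed[OF XM(1)]
    show "y \<otimes>\<^bsub>TLA\<^esub> W (X @ M) = y" if "y \<in> CY M" for y
      using that
    proof (induction rule: Sp_induct)
      case zero show ?case using e by simp
    next
      case (step y r w)
      obtain z where z: "w = z @ M" "z \<in> letters" using step(4) unfolding Cup_words_def by blast
      have "W w \<otimes>\<^bsub>TLA\<^esub> W (X @ M) = W (z @ (M @ X @ M) @ [])"
        using W_append[OF step(5) XM(1)] z by simp
      also have "\<dots> = W (z @ M @ [])"
        by (rule W_context[OF _ _ _ _ X(2)]) (use z M X in auto)
      finally have w: "W w \<otimes>\<^bsub>TLA\<^esub> W (X @ M) = W w" using z by simp
      note c = sc_closed[OF step(3)] W_closed[OF step(5)]
      show ?case
        using TLA.l_distr[OF step(2) TLA.m_closed[OF c] e] TLA.m_assoc[OF c e] step(1) w by simp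
    qed
    show "y \<odot>\<^bsub>TL_trivial R\<^esub> x = \<zero>\<^bsub>TL_trivial R\<^esub>" if "t = 0" "y \<in> CY M" "x \<in> carrier (TL_trivial R)" for y x
      by (rule CY_kills[OF t[OF that(1)] that(2,3)])
  qed
qed

text \<open>The induction passes from \<open>k\<close> and \<open>M\<close> both to
  \<open>k - 1\<close> and \<open>M\<close> and to \<open>k - 2\<close> and \<open>k # M\<close>.
  The gap condition is guarded by \<open>k > 0\<close> because for k = 1 the index
  \<open>k - 2\<close> truncates to 0 and nothing is left below the new letter. Strand
  \<open>p\<close> stays uncovered as k <= p - 2, and since \<open>k # M\<close> is nonempty the
  second case applies in every degree.\<close>

lemma acyclic_Cup:
  assumes "gaps M" "M \<in> letters" "k > 0 \<Longrightarrow> \<forall>i\<in>set M. k + 2 \<le> i"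
    and "k + 2 \<le> p" "p \<le> n" "p \<notin> set M" "p - 1 \<notin> set M" "t = 0 \<Longrightarrow> M \<noteq> []"
  shows "res.acyclic (ch (CY M)) (ch (CS k M)) t"
  using assms
proof (induction k arbitrary: M t rule: less_induct)
  case (less k)
  show ?case
  proof (cases "k = 0")
    case True
    then show ?thesis unfolding True CS_0 by (intro acyclic_base[of M p]) (use less.prems in auto)
  next
    case False
    have k: "k \<in> {1..<n}" using less.prems False by auto
    have g: "gaps (k # M)" "k # M \<in> letters" using less.prems False k by auto
    show ?thesis unfolding CS_sum[OF k]
    proof (rule res.acyclic_sum)
      show "res.subcomplex (ch (CY (k # M)))" "res.subcomplex (ch (CY M))" "res.subcomplex (ch (CS (k - 1) M))"
        by (rule res.chain_subcomplex[OF word_ideal(1)] res.chain_subcomplex[OF word_ideal(2)])+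
      show "ch (CY (k # M)) j \<subseteq> ch (CY M) j" for j by (rule res.chain_mono[OF CY_subset[OF k]])
      show "ch (CS (k - 1) M) j \<subseteq> ch (CY M) j" for j by (rule res.chain_mono[OF CS_subset])
      show "res.acyclic (ch (CY M)) (ch (CS (k - 1) M)) t"
        by (rule less.IH) (use less.prems False in auto)
      show "res.acyclic (ch (CY (k # M))) (\<lambda>k'. ch (CY (k # M)) k' \<inter> ch (CS (k - 1) M) k') j" for j
        unfolding res.chain_Int Cup_words_Int[OF k g(1) less.prems(2)]
      proof (rule less.IH)
        show "0 < k - 2 \<Longrightarrow> \<forall>i\<in>set (k # M). k - 2 + 2 \<le> i" using less.prems(3) by auto
        show "p \<notin> set (k # M)" "p - 1 \<notin> set (k # M)" using less.prems by auto
      qed (use less.prems False g in auto)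
    qed
  qed
qed

lemma CY_Nil: "CY [] = carrier TLA"
proof
  show "CY [] \<subseteq> carrier TLA" using left_idealD(1)[OF word_ideal(1)] by blast
  have "{w. f w \<noteq> \<zero>} \<subseteq> Cup_words []" if "f \<in> carrier FS" for f
    using free_alg_letters[OF that] unfolding Cup_words_def by auto
  then show "carrier TLA \<subseteq> CY []" unfolding Sp_UNIV[symmetric] Sp_def by blast
qed

section \<open>The degree shift\<close>

text \<open>For even \<open>p\<close> these are the sets M met along the shifts, from the empty one
  at \<open>p = n\<close> to all odd letters at \<open>p = 0\<close>.\<close>

definition odds :: "nat \<Rightarrow> nat list" where "odds p = filter odd [p..<n]"

lemma odds_gaps: "gaps (odds p)"
proof -
  have "gaps (filter odd [p..<m])" for m
    by (induction m) (auto simp: sorted_wrt_append, presburger)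
  then show ?thesis unfolding odds_def .
qed

lemma odds_letters: "odds p \<in> letters"
  unfolding odds_def by (auto simp: One_nat_def Suc_leI odd_pos)

lemma odds_step: "even p \<Longrightarrow> 2 \<le> p \<Longrightarrow> p \<le> n \<Longrightarrow> odds (p - 2) = (p - 1) # odds p"
proof -
  assume p: "even p" "2 \<le> p" "p \<le> n"
  then have "[p - 2..<n] = (p - 2) # (p - 1) # [p..<n]"
    by (simp add: upt_conv_Cons Suc_diff_le numeral_2_eq_2 Suc_diff_Suc)
  then show ?thesis using p unfolding odds_def by simp
qed

text \<open>\<open>connecting_iso\<close> for S_(p-2) and A U_(p-1) U_M, whose sum is S_(p-1).
  Strand \<open>p\<close> is uncovered, because \<open>p\<close> is even and \<open>p - 1\<close> is
  too small to be in M; hence Y/S_(p-2) has no Tor.\<close>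

lemma shift_iso:
  assumes p: "even p" "2 \<le> p" "p \<le> n"
  shows "sub_iso R (res_scal TLA (TL_trivial R) (Suc t))
      (res.rel_cycles (ch (CY (odds p))) (ch (CS (p - 1) (odds p))) (Suc t)) (res.rel_bounds (ch (CY (odds p))) (ch (CS (p - 1) (odds p))) (Suc t))
      (res_scal TLA (TL_trivial R) t)
      (res.rel_cycles (ch (CY (odds (p - 2)))) (ch (CS (p - 2 - 1) (odds (p - 2)))) t)
      (res.rel_bounds (ch (CY (odds (p - 2)))) (ch (CS (p - 2 - 1) (odds (p - 2)))) t)"
proof -
  let ?M = "odds p" and ?k = "p - 1"
  have k: "?k \<in> {1..<n}" using p by auto
  have g: "gaps (?k # ?M)" using odds_gaps[of "p - 2"] odds_step[OF p] by simp
  note M = odds_gaps[of p] odds_letters[of p]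
  have e: "?k - 1 = p - 2" "?k - 2 = p - 2 - 1" by auto
  have ac: "res.acyclic (ch (CY ?M)) (ch (CS (p - 2) ?M)) s" if "s = 0 \<Longrightarrow> ?M \<noteq> []" for s
  proof (rule acyclic_Cup[OF M _ _ p(3) _ _ that])
    show "\<forall>i\<in>set ?M. p - 2 + 2 \<le> i" using p by (auto simp: odds_def)
    show "p \<notin> set ?M" "p - 1 \<notin> set ?M" using p by (auto simp: odds_def)
  qed (use p in auto)
  have sub: "res.subcomplex (ch (CY (?k # ?M)))" "res.subcomplex (ch (CY ?M))" "res.subcomplex (ch (CS (p - 2) ?M))"
    by (rule res.chain_subcomplex[OF word_ideal(1)] res.chain_subcomplex[OF word_ideal(2)])+
  have XY: "ch (CY (?k # ?M)) j \<subseteq> ch (CY ?M) j" for j by (rule res.chain_mono[OF CY_subset[OF k]])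
  have BY: "ch (CS (p - 2) ?M) j \<subseteq> ch (CY ?M) j" for j by (rule res.chain_mono[OF CS_subset])
  have z: "res.rel_cycles (ch (CY (?k # ?M))) (\<lambda>j. ch (CY (?k # ?M)) j \<inter> ch (CS (p - 2) ?M) j) t
      \<subseteq> res.rel_bounds (ch (CY ?M)) (ch (CS (p - 2) ?M)) t"
  proof (cases "t = 0 \<and> ?M = []")
    case False
    have "res.rel_cycles (ch (CY (?k # ?M))) (\<lambda>j. ch (CY (?k # ?M)) j \<inter> ch (CS (p - 2) ?M) j) t
      \<subseteq> res.rel_cycles (ch (CY ?M)) (ch (CS (p - 2) ?M)) t"
      using XY[of t] unfolding res.rel_cycles_def by blast
    then show ?thesis using ac[of t] False unfolding res.acyclic_def by blast
  next
    \<comment> \<open>Now Y is the whole algebra and Y/S_(p-2) has homology in degree 0. Only the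
      weaker requirement of \<open>connecting_iso\<close> is available: the smaller ideal acts as
      zero on the trivial module, so its chains bound in the full resolution.\<close>
    case True
    have "f \<in> res.rel_bounds (ch (carrier TLA)) (ch (CS (p - 2) ?M)) 0"
      if "f \<in> ch (CY (?k # ?M)) 0" for f
      by (rule res.rel_bounds_0[OF that _ word_ideal(2)]) (rule CY_kills[of "?k # ?M"], auto)
    then show ?thesis using True unfolding res.rel_cycles_def by (simp add: CY_Nil) blast
  qed
  have "sub_iso R (res_scal TLA (TL_trivial R) (Suc t))
     (res.rel_cycles (ch (CY ?M)) (res.cx_sum (ch (CY (?k # ?M))) (ch (CS (p - 2) ?M))) (Suc t))
     (res.rel_bounds (ch (CY ?M)) (res.cx_sum (ch (CY (?k # ?M))) (ch (CS (p - 2) ?M))) (Suc t))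
     (res_scal TLA (TL_trivial R) t)
     (res.rel_cycles (ch (CY (?k # ?M))) (\<lambda>j. ch (CY (?k # ?M)) j \<inter> ch (CS (p - 2) ?M) j) t)
     (res.rel_bounds (ch (CY (?k # ?M))) (\<lambda>j. ch (CY (?k # ?M)) j \<inter> ch (CS (p - 2) ?M) j) t)"
    by (rule res.connecting_iso[OF sub XY BY ac z]) simp
  moreover have "(\<lambda>j. ch (CY (?k # ?M)) j \<inter> ch (CS (p - 2) ?M) j) = ch (CS (p - 2 - 1) (?k # ?M))"
    unfolding res.chain_Int Cup_words_Int[OF k g M(2), unfolded e] ..
  moreover have "ch (CS ?k ?M) = res.cx_sum (ch (CY (?k # ?M))) (ch (CS (p - 2) ?M))"
    unfolding CS_sum[OF k, unfolded e] ..
  ultimately show ?thesis unfolding odds_step[OF p] by (simp only:)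
qed

lemma shift_iso_iterate:
  assumes n: "even n" and j: "2 * j \<le> n"
  shows "sub_iso R (res_scal TLA (TL_trivial R) (t + j))
      (res.rel_cycles (ch (CY (odds n))) (ch (CS (n - 1) (odds n))) (t + j)) (res.rel_bounds (ch (CY (odds n))) (ch (CS (n - 1) (odds n))) (t + j))
      (res_scal TLA (TL_trivial R) t)
      (res.rel_cycles (ch (CY (odds (n - 2 * j)))) (ch (CS (n - 2 * j - 1) (odds (n - 2 * j)))) t)
      (res.rel_bounds (ch (CY (odds (n - 2 * j)))) (ch (CS (n - 2 * j - 1) (odds (n - 2 * j)))) t)"
  using j
proof (induction j arbitrary: t)
  case 0 show ?case by (simp, rule sub_isoI[of "\<lambda>x y. x = y \<and> x \<in> res.rel_cycles (ch (CY (odds n))) (ch (CS (n - 1) (odds n))) t"])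
    (auto intro: res.rel_cycles_add[OF res.chain_subcomplex[OF word_ideal(1)] res.chain_subcomplex[OF word_ideal(2)]]
      res.rel_cycles_sm[OF res.chain_subcomplex[OF word_ideal(1)] res.chain_subcomplex[OF word_ideal(2)]])
next
  case (Suc j)
  have e: "n - 2 * j - 2 = n - 2 * Suc j" by simp
  have "even (n - 2 * j)" "2 \<le> n - 2 * j" "n - 2 * j \<le> n" using n Suc.prems by auto
  from shift_iso[OF this, of t, unfolded e] Suc.IH[of "Suc t"] Suc.prems show ?case
    using sub_iso_trans by fastforce
qed

end

section \<open>Principal left ideals as cyclic modules\<close>

context resolution begin

text \<open>Right multiplication by \<open>u\<close> identifies A/An with A u. The lemma links two
  descriptions of one module: \<open>Cup\<close> enters Tor through the annihilator of its
  generator, whereas the shifts end in chains with values in the ideal itself.\<close>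

lemma annihilator_iso:
  assumes u: "u \<in> carrier A"
  defines "An \<equiv> {x \<in> carrier A. x \<otimes>\<^bsub>A\<^esub> u = \<zero>\<^bsub>A\<^esub>}" and "Y \<equiv> {x \<otimes>\<^bsub>A\<^esub> u | x. x \<in> carrier A}"
  shows "sub_iso R (res_scal A L k) (rel_cycles (chain A L (carrier A)) (chain A L An) k) (rel_bounds (chain A L (carrier A)) (chain A L An) k)
    (res_scal A L k) (rel_cycles (chain A L Y) (chain A L {\<zero>\<^bsub>A\<^esub>}) k) (rel_bounds (chain A L Y) (chain A L {\<zero>\<^bsub>A\<^esub>}) k)"
proof -
  let ?m = "\<lambda>f b. f b \<otimes>\<^bsub>A\<^esub> u"
  have ch: "f \<in> chain A L (carrier A) k \<longleftrightarrow> f \<in> carrier (res_mod A L k)" for f k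
    using free_rmodD(1)[of f A] by (auto simp: chain_def)
  have chz: "chain A L {\<zero>\<^bsub>A\<^esub>} k = {\<lambda>b. \<zero>\<^bsub>A\<^esub>}" for k
    by (auto simp: chain_def free_rmod_def)
  have mA: "?m f \<in> carrier (res_mod A L k)" if "f \<in> carrier (res_mod A L k)" for f k
    by (rule free_rmod_smult[OF that u])
  have mY: "?m f \<in> chain A L Y k" if "f \<in> carrier (res_mod A L k)" for f k
    using mA[OF that] free_rmodD(1)[OF that] unfolding chain_def Y_def by blast
  have AnI: "f \<in> chain A L An k \<longleftrightarrow> ?m f = (\<lambda>b. \<zero>\<^bsub>A\<^esub>)" if "f \<in> carrier (res_mod A L k)" for f k
    using that free_rmodD(1)[OF that] unfolding chain_def An_def fun_eq_iff by blast
  have An: "left_ideal A An" unfolding left_ideal_def An_def using u by (auto simp: A.l_distr A.m_assoc)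
  have Y: "left_ideal A Y"
    unfolding left_ideal_def
  proof (intro conjI ballI)
    show "Y \<subseteq> carrier A" unfolding Y_def using u by auto
    show "\<zero>\<^bsub>A\<^esub> \<in> Y" unfolding Y_def using A.l_null[OF u, symmetric] A.zero_closed by blast
    fix y assume "y \<in> Y"
    then obtain b where b: "y = b \<otimes>\<^bsub>A\<^esub> u" "b \<in> carrier A" unfolding Y_def by blast
    show "x \<oplus>\<^bsub>A\<^esub> y \<in> Y" if x: "x \<in> Y" for x
    proof -
      obtain c where c: "x = c \<otimes>\<^bsub>A\<^esub> u" "c \<in> carrier A" using x unfolding Y_def by blast
      show ?thesis unfolding b c A.l_distr[OF c(2) b(2) u, symmetric] Y_def using A.a_closed[OF c(2) b(2)] by blast
    qed
    show "x \<otimes>\<^bsub>A\<^esub> y \<in> Y" if x: "x \<in> carrier A" for x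
      unfolding b A.m_assoc[OF x b(2) u, symmetric] Y_def using A.m_closed[OF x b(2)] by blast
  qed
  have A: "left_ideal A (carrier A)" by (simp add: left_ideal_def)
  have mem: "f \<in> carrier (res_mod A L k)" if "f \<in> rel_cycles (chain A L (carrier A)) (chain A L An) k" for f
    using that unfolding rel_cycles_def ch by simp
  have lift: "\<exists>f\<in>carrier (res_mod A L k). h = ?m f" if h: "h \<in> chain A L Y k" for h k
  proof -
    note D = free_rmodD[OF chainD(1)[OF h]]
    \<comment> \<open>Zero is lifted to zero, which keeps the support of the lift finite.\<close>
    have "\<exists>x\<in>carrier A. h b = x \<otimes>\<^bsub>A\<^esub> u \<and> (h b = \<zero>\<^bsub>A\<^esub> \<longrightarrow> x = \<zero>\<^bsub>A\<^esub>)" for b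
    proof (cases "h b = \<zero>\<^bsub>A\<^esub>")
      case True then show ?thesis using u by (intro bexI[of _ "\<zero>\<^bsub>A\<^esub>"]) auto
    next
      case False then show ?thesis using chainD(2)[OF h, of b] unfolding Y_def by auto
    qed
    then obtain f where f: "\<And>b. f b \<in> carrier A" "\<And>b. h b = f b \<otimes>\<^bsub>A\<^esub> u" "\<And>b. h b = \<zero>\<^bsub>A\<^esub> \<Longrightarrow> f b = \<zero>\<^bsub>A\<^esub>"
      by metis
    have "f \<in> carrier (res_mod A L k)"
    proof (rule free_rmodI[OF f(1) _ D(2,3)])
      show "b \<in> {b. h b \<noteq> \<zero>\<^bsub>A\<^esub>}" if "f b \<noteq> \<zero>\<^bsub>A\<^esub>" for b using f(3) that by blast
    qed
    moreover have "h = ?m f" using f(2) by (rule ext)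
    ultimately show ?thesis by blast
  qed
  have cyc: "?m f \<in> rel_cycles (chain A L Y) (chain A L {\<zero>\<^bsub>A\<^esub>}) k \<longleftrightarrow> f \<in> rel_cycles (chain A L (carrier A)) (chain A L An) k"
    if f: "f \<in> carrier (res_mod A L k)" for f
  proof (cases k)
    case 0 then show ?thesis using f mY[OF f] by (simp add: rel_cycles_def ch)
  next
    case (Suc j)
    note f' = f[unfolded Suc]
    show ?thesis using f mY[OF f] bd_smult[OF f' u] AnI[OF res_bd_closed[OF L f']] Suc
      by (simp add: rel_cycles_def ch chz)
  qed
  have bnd: "?m f \<in> rel_bounds (chain A L Y) (chain A L {\<zero>\<^bsub>A\<^esub>}) k \<longleftrightarrow> f \<in> rel_bounds (chain A L (carrier A)) (chain A L An) k"
    if f: "f \<in> carrier (res_mod A L k)" for f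
  proof
    assume "f \<in> rel_bounds (chain A L (carrier A)) (chain A L An) k"
    then obtain g m where g: "g \<in> carrier (res_mod A L (Suc k))" "m \<in> chain A L An k" "f = res_bd A g \<oplus>\<^bsub>res_scal A L k\<^esub> m"
      unfolding rel_bounds_def ch by blast
    note v = free_rmodD(1)[OF res_bd_closed[OF L g(1)]] free_rmodD(1)[OF chainD(1)[OF g(2)]]
    have "m b \<otimes>\<^bsub>A\<^esub> u = \<zero>\<^bsub>A\<^esub>" for b using chainD(2)[OF g(2), of b] by (simp add: An_def)
    then have "?m f = res_bd A (?m g) \<oplus>\<^bsub>res_scal A L k\<^esub> (\<lambda>b. \<zero>\<^bsub>A\<^esub>)"
      unfolding g(3) bd_smult[OF g(1) u] res_scal_simps using v u by (simp add: A.l_distr)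
    then show "?m f \<in> rel_bounds (chain A L Y) (chain A L {\<zero>\<^bsub>A\<^esub>}) k"
      unfolding rel_bounds_def chz using mY[OF g(1)] by blast
  next
    assume "?m f \<in> rel_bounds (chain A L Y) (chain A L {\<zero>\<^bsub>A\<^esub>}) k"
    then obtain h where h: "h \<in> chain A L Y (Suc k)" "?m f = res_bd A h \<oplus>\<^bsub>res_scal A L k\<^esub> (\<lambda>b. \<zero>\<^bsub>A\<^esub>)"
      unfolding rel_bounds_def chz by blast
    obtain g where g: "g \<in> carrier (res_mod A L (Suc k))" "h = ?m g" using lift[OF h(1)] by blast
    interpret G: abelian_group "res_scal A L k" by (rule res_scal_abelian)
    let ?d = "f \<oplus>\<^bsub>res_scal A L k\<^esub> \<ominus>\<^bsub>res_scal A L k\<^esub> res_bd A g"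
    note gd = res_bd_closed[OF L g(1)]
    have c: "f \<in> carrier (res_scal A L k)" "res_bd A g \<in> carrier (res_scal A L k)" using f gd by (simp_all add: res_scal_simps)
    then have d: "?d \<in> carrier (res_mod A L k)" using G.a_closed[OF c(1) G.a_inv_closed[OF c(2)]] by (simp add: res_scal_simps(1))
    have eq: "f b \<otimes>\<^bsub>A\<^esub> u = res_bd A g b \<otimes>\<^bsub>A\<^esub> u" for b
      using fun_cong[OF h(2), of b] free_rmodD(1)[OF gd, of b] u unfolding g(2) bd_smult[OF g(1) u] res_scal_simps by simp
    have "?m ?d = (\<lambda>b. \<zero>\<^bsub>A\<^esub>)"
      using free_rmodD(1)[OF f] free_rmodD(1)[OF gd] u
      by (simp add: res_scal_simps res_scal_neg[OF gd] A.l_distr A.l_minus A.r_neg eq)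
    then have "?d \<in> chain A L An k" using AnI[OF d] by simp
    moreover have "f = res_bd A g \<oplus>\<^bsub>res_scal A L k\<^esub> ?d" using c by (simp add: G.a_ac G.r_neg1 G.r_neg2 G.r_neg)
    ultimately show "f \<in> rel_bounds (chain A L (carrier A)) (chain A L An) k"
      unfolding rel_bounds_def ch using g(1) by blast
  qed
  note sA = chain_subcomplex[OF A] and sN = chain_subcomplex[OF An]
  show ?thesis
  proof (rule sub_isoI[of "\<lambda>f h. f \<in> rel_cycles (chain A L (carrier A)) (chain A L An) k \<and> h = ?m f"], goal_cases)
    case (2 f h) then show ?case using cyc[OF mem] by blast
  next
    case (3 f h) then show ?case using bnd[OF mem] by blast
  next
    case (4 f h) then show ?case using bnd[OF mem] by blast
  next
    case (6 h)
    then have "h \<in> chain A L Y k" by (simp add: rel_cycles_def)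
    then obtain f where f: "f \<in> carrier (res_mod A L k)" "h = ?m f" using lift by blast
    then show ?case using cyc[OF f(1)] 6 by blast
  next
    case (7 f h f' h')
    then have f: "f \<in> rel_cycles (chain A L (carrier A)) (chain A L An) k"
      "f' \<in> rel_cycles (chain A L (carrier A)) (chain A L An) k" and h: "h = ?m f" "h' = ?m f'" by auto
    have "h \<oplus>\<^bsub>res_scal A L k\<^esub> h' = ?m (f \<oplus>\<^bsub>res_scal A L k\<^esub> f')"
      unfolding h res_scal_simps using free_rmodD(1)[OF mem[OF f(1)]] free_rmodD(1)[OF mem[OF f(2)]] u by (simp add: A.l_distr)
    then show ?case using rel_cycles_add[OF sA sN f] by blast
  next
    case (8 r f h)
    then have f: "f \<in> rel_cycles (chain A L (carrier A)) (chain A L An) k" and h: "h = ?m f" by auto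
    have "r \<odot>\<^bsub>res_scal A L k\<^esub> h = ?m (r \<odot>\<^bsub>res_scal A L k\<^esub> f)"
      unfolding h res_scal_simps using free_rmodD(1)[OF mem[OF f]] u scalar_closed[OF 8(1)] scalar_central[OF 8(1) u]
      by (simp add: A.m_assoc)
    then show ?case using rel_cycles_sm[OF sA sN f 8(1)] by blast
  qed blast+
qed

end

lemma sub_iso_subset: "sub_iso R G Z B G' Z' B' \<Longrightarrow> Z' \<subseteq> B' \<Longrightarrow> Z \<subseteq> B"
  unfolding sub_iso_def using sub_relD(2,3,4) by (metis (no_types, lifting) subset_iff)

section \<open>The Tor groups of the theorem\<close>

context temperley_lieb begin

lemma aug_sc: "r \<in> carrier R \<Longrightarrow> TL_aug (sc r) = r"
  using free_alg_smult_closed[OF _ FS.one_closed] by (simp add: sc_cls aug_cls) (simp add: free_alg_simps)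

lemma triv_simps:
  "carrier (TL_trivial R) = carrier R" "\<zero>\<^bsub>TL_trivial R\<^esub> = \<zero>" "x \<oplus>\<^bsub>TL_trivial R\<^esub> y = x \<oplus> y"
  "X \<odot>\<^bsub>TL_trivial R\<^esub> r = TL_aug X \<otimes> r"
  by (simp_all add: TL_trivial_def)

sublocale triv: cyclic_coefficients R TLA "TL_trivial R" "TL_trivial R" \<one>
proof (unfold cyclic_coefficients_def cyclic_coefficients_axioms_def, intro conjI allI impI)
  show "resolution R TLA (TL_trivial R)" by (rule res.resolution_axioms)
  show "left_module TLA (TL_trivial R)" by (rule TL_trivial_module(1)[OF is_cring a])
  show "\<one> \<in> carrier (TL_trivial R)" by (simp add: triv_simps)
  fix y assume "y \<in> carrier (TL_trivial R)"
  then show "\<exists>x\<in>carrier TLA. y = x \<odot>\<^bsub>TL_trivial R\<^esub> \<one>"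
    by (intro bexI[of _ "sc y"]) (simp_all add: triv_simps aug_sc sc_closed)
qed

lemma TL_aug_closed: "X \<in> carrier TLA \<Longrightarrow> TL_aug X \<in> carrier R"
  using ring_hom_closed[OF TL_aug_hom[OF a]] .

text \<open>Augmentation zero means absence of a constant term, so that every word involved has a
  last letter, at most n - 1. This is the starting point of the shifts, with empty M.\<close>

lemma triv_ann: "triv.ann = CS (n - 1) []"
proof (intro Set.set_eqI iffI)
  fix x assume "x \<in> triv.ann"
  then have x: "x \<in> carrier TLA" "TL_aug x = \<zero>" using TL_aug_closed by (auto simp: triv.ann_def triv_simps)
  obtain f where f: "f \<in> carrier FS" "x = cls f" using x(1) by (rule TLA_cases)
  have "w \<in> Cup_sub_words (n - 1) []" if w: "f w \<noteq> \<zero>" for w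
  proof -
    have "w \<noteq> []" using w x(2) f aug_cls by auto
    then have e: "w = butlast w @ [last w] @ []" by simp
    have "w \<in> letters" by (rule free_alg_letters[OF f(1) w])
    then have "butlast w \<in> letters" "last w \<in> {1..<n}" using \<open>w \<noteq> []\<close> by (auto dest: in_set_butlastD)
    moreover from this have "last w \<le> n - 1" by auto
    ultimately show ?thesis unfolding Cup_sub_words_def using e by blast
  qed
  then show "x \<in> CS (n - 1) []" unfolding Sp_def using f by blast
next
  fix x assume x: "x \<in> CS (n - 1) []"
  then obtain f where f: "f \<in> carrier FS" "{w. f w \<noteq> \<zero>} \<subseteq> Cup_sub_words (n - 1) []" "x = cls f" unfolding Sp_def by blast
  have "[] \<notin> Cup_sub_words (n - 1) []" unfolding Cup_sub_words_def by auto
  then have "f [] = \<zero>" using f(2) by blast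
  then show "x \<in> triv.ann" using f by (simp add: triv.ann_def triv_simps aug_cls)
qed

lemma TL_prod_odds: "TL_prod R n a {i. 1 \<le> i \<and> i < n \<and> odd i} = W (odds 0)"
proof -
  have "{i. 1 \<le> i \<and> i < n \<and> odd i} = set (odds 0)"
    unfolding odds_def by (auto simp: One_nat_def Suc_leI odd_pos)
  moreover have "sorted (odds 0)" "distinct (odds 0)" unfolding odds_def by (simp_all add: sorted_wrt_filter)
  ultimately have "sorted_list_of_set {i. 1 \<le> i \<and> i < n \<and> odd i} = odds 0"
    by (simp add: sorted_list_of_set.idem_if_sorted_distinct)
  moreover have "foldr (\<lambda>i X. TL_gen R n a i \<otimes>\<^bsub>TLA\<^esub> X) xs \<one>\<^bsub>TLA\<^esub> = W xs" if "\<forall>x\<in>set xs. x \<in> {1..<n}" for xs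
    using that
  proof (induction xs)
    case Nil then show ?case by (simp add: W_Nil)
  next
    case (Cons i xs)
    have "TL_gen R n a i = W [i]" by (simp add: TL_gen_def W_def cls_def letter_mon)
    then show ?case using Cons W_append[of "[i]" xs] by (auto simp: in_lists_conv_set)
  qed
  ultimately show ?thesis using odds_letters[of 0] unfolding TL_prod_def by (simp add: in_lists_conv_set)
qed

abbreviation (input) CupM :: "((nat list \<Rightarrow> 'r) set, (nat list \<Rightarrow> 'r) set) module" where
  "CupM \<equiv> Cup R n a {i. 1 \<le> i \<and> i < n \<and> odd i}"

lemma CupM_simps:
  "carrier CupM = {x \<otimes>\<^bsub>TLA\<^esub> W (odds 0) | x. x \<in> carrier TLA}"
  "\<zero>\<^bsub>CupM\<^esub> = \<zero>\<^bsub>TLA\<^esub>" "x \<odot>\<^bsub>CupM\<^esub> y = x \<otimes>\<^bsub>TLA\<^esub> y"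
  unfolding TL_prod_odds[symmetric] by (simp_all add: Cup_def Let_def)

sublocale cup: cyclic_coefficients R TLA "TL_trivial R" CupM "W (odds 0)"
proof (unfold cyclic_coefficients_def cyclic_coefficients_axioms_def, intro conjI allI impI)
  show "resolution R TLA (TL_trivial R)" by (rule res.resolution_axioms)
  show "left_module TLA CupM" by (rule Cup_left_module[OF is_cring a]) auto
  show "W (odds 0) \<in> carrier CupM"
    unfolding CupM_simps using TLA.l_one[OF W_closed[OF odds_letters], symmetric] TLA.one_closed by blast
  fix y assume "y \<in> carrier CupM"
  then show "\<exists>x\<in>carrier TLA. y = x \<odot>\<^bsub>CupM\<^esub> W (odds 0)" unfolding CupM_simps by blast
qed

lemma CY_principal: "M \<in> letters \<Longrightarrow> CY M = {x \<otimes>\<^bsub>TLA\<^esub> W M | x. x \<in> carrier TLA}"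
proof
  assume M: "M \<in> letters"
  have "M = [] @ M" "[] \<in> letters" by simp_all
  then have "M \<in> Cup_words M" unfolding Cup_words_def by blast
  then show "{x \<otimes>\<^bsub>TLA\<^esub> W M | x. x \<in> carrier TLA} \<subseteq> CY M"
    using left_idealD(4)[OF word_ideal(1) _ W_Sp[OF M]] by blast
  show "CY M \<subseteq> {x \<otimes>\<^bsub>TLA\<^esub> W M | x. x \<in> carrier TLA}"
  proof
    fix y assume "y \<in> CY M"
    then show "y \<in> {x \<otimes>\<^bsub>TLA\<^esub> W M | x. x \<in> carrier TLA}"
    proof (induction rule: Sp_induct)
      case zero show ?case using TLA.l_null[OF W_closed[OF M], symmetric] TLA.zero_closed by blast
    next
      case (step y r w)
      obtain x where x: "y = x \<otimes>\<^bsub>TLA\<^esub> W M" "x \<in> carrier TLA" using step(1) by blast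
      obtain z where z: "w = z @ M" "z \<in> letters" using step(4) unfolding Cup_words_def by blast
      note c = sc_closed[OF step(3)] W_closed[OF z(2)] W_closed[OF M]
      have "y \<oplus>\<^bsub>TLA\<^esub> sc r \<otimes>\<^bsub>TLA\<^esub> W w = (x \<oplus>\<^bsub>TLA\<^esub> sc r \<otimes>\<^bsub>TLA\<^esub> W z) \<otimes>\<^bsub>TLA\<^esub> W M"
        unfolding x(1) z(1) W_append[OF z(2) M] using c x(2) by (simp add: TLA.l_distr TLA.m_assoc)
      moreover have "x \<oplus>\<^bsub>TLA\<^esub> sc r \<otimes>\<^bsub>TLA\<^esub> W z \<in> carrier TLA" using c x(2) by simp
      ultimately show ?case by blast
    qed
  qed
qed

lemma cup_ann: "cup.ann = {x \<in> carrier TLA. x \<otimes>\<^bsub>TLA\<^esub> W (odds 0) = \<zero>\<^bsub>TLA\<^esub>}"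
  unfolding cup.ann_def CupM_simps ..

abbreviation (input) TC :: "((nat list \<Rightarrow> 'r) set, 'k) module \<Rightarrow> nat \<Rightarrow> _" where
  "TC N \<equiv> Tor_complex TLA (TL_trivial R) N"
abbreviation (input) TB :: "((nat list \<Rightarrow> 'r) set, 'k) module \<Rightarrow> nat \<Rightarrow> _" where
  "TB N \<equiv> Tor_bd TLA (TL_trivial R) N"

lemma TL_homology_subquot:
  "TL_homology R n a N k = subquot_mod (TC N k) (cycles (TC N) (TB N) k) (boundaries (TC N) (TB N) k)"
  unfolding TL_homology_def Tor_def homology_subquot ..

lemma odds_n: "odds n = []"
  by (simp add: odds_def)

lemma triv_shift:
  assumes "even n" "2 * j \<le> n"
  shows "sub_iso R (TC (TL_trivial R) (t + j)) (cycles (TC (TL_trivial R)) (TB (TL_trivial R)) (t + j))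
      (boundaries (TC (TL_trivial R)) (TB (TL_trivial R)) (t + j))
    (res_scal TLA (TL_trivial R) t)
    (res.rel_cycles (ch (CY (odds (n - 2 * j)))) (ch (CS (n - 2 * j - 1) (odds (n - 2 * j)))) t)
    (res.rel_bounds (ch (CY (odds (n - 2 * j)))) (ch (CS (n - 2 * j - 1) (odds (n - 2 * j)))) t)"
  using sub_iso_trans[OF triv.Tor_rel[of "t + j", unfolded triv_ann] shift_iso_iterate[OF assms, of t, unfolded odds_n CY_Nil]] .

text \<open>After \<open>k\<close> shifts degree \<open>k\<close> has become degree 0, for a
  quotient of A U_M. Here M is nonempty because k > 0, and strand n - 2 k exists and is uncovered
  because k < n/2, so that A U_M has no Tor in degree 0.\<close>

lemma homology_vanishing:
  assumes n: "even n" and k: "0 < k" "k < n div 2"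
  shows "carrier (TL_homology R n a (TL_trivial R) k) = {\<zero>\<^bsub>TL_homology R n a (TL_trivial R) k\<^esub>}"
proof -
  let ?N = "TL_trivial R" and ?p = "n - 2 * k"
  have p: "even ?p" "2 \<le> ?p" "?p < n" using n k by auto
  have "?p + 1 \<in> set (odds ?p)" unfolding odds_def using p n by auto presburger
  then have ne: "odds ?p \<noteq> []" by auto
  have "res.acyclic (ch (CY (odds ?p))) (ch {\<zero>\<^bsub>TLA\<^esub>}) 0"
    by (rule acyclic_base[OF odds_gaps odds_letters, where p = ?p]) (use p ne in \<open>auto simp: odds_def\<close>)
  \<comment> \<open>In degree 0 every chain is a cycle whatever the denominator is, and a larger
    denominator only adds boundaries; vanishing therefore passes to the quotient.\<close>
  moreover have "res.rel_bounds (ch (CY (odds ?p))) (ch {\<zero>\<^bsub>TLA\<^esub>}) 0 \<subseteq> res.rel_bounds (ch (CY (odds ?p))) (ch (CS (?p - 1) (odds ?p))) 0"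
    using res.chain_mono[of "{\<zero>\<^bsub>TLA\<^esub>}" "CS (?p - 1) (odds ?p)" 0] left_idealD(2)[OF word_ideal(2)]
    unfolding res.rel_bounds_def by blast
  ultimately have z: "res.rel_cycles (ch (CY (odds ?p))) (ch (CS (?p - 1) (odds ?p))) 0
      \<subseteq> res.rel_bounds (ch (CY (odds ?p))) (ch (CS (?p - 1) (odds ?p))) 0"
    unfolding res.acyclic_def res.rel_cycles_def by blast
  have "2 * k \<le> n" using k by auto
  from sub_iso_subset[OF triv_shift[OF n this, of 0] z]
  have Z: "cycles (TC ?N) (TB ?N) k \<subseteq> boundaries (TC ?N) (TB ?N) k" by simp
  interpret S: subquotient R "TC ?N k" "cycles (TC ?N) (TB ?N) k" "boundaries (TC ?N) (TB ?N) k"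
    by (rule chain_complex.homology_subquotient[OF triv.Tor_chain_complex])
  have "(\<lambda>x. boundaries (TC ?N) (TB ?N) k +>\<^bsub>TC ?N k\<^esub> x) ` cycles (TC ?N) (TB ?N) k = {boundaries (TC ?N) (TB ?N) k}"
    using S.coset_B Z S.Z0 by (auto simp: image_iff)
  then show ?thesis unfolding TL_homology_subquot by (simp add: subquot_mod_def)
qed

lemma homology_shift:
  assumes n: "even n"
  shows "module_isomorphic R (TL_homology R n a (TL_trivial R) (k + n div 2)) (TL_homology R n a CupM k)"
proof -
  have j: "2 * (n div 2) \<le> n" "n - 2 * (n div 2) = 0" using n by auto
  \<comment> \<open>After n/2 shifts the index truncates to 0 and the denominator S_0 is zero,
    leaving the ideal A U_M itself.\<close>
  have e: "n - 2 * (n div 2) - 1 = 0" using j by simp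
  note 1 = triv_shift[OF n j(1), of k, unfolded e, unfolded j(2) CS_0 CY_principal[OF odds_letters]]
  note 2 = res.annihilator_iso[OF W_closed[OF odds_letters[of 0]], of k, folded cup_ann]
  show ?thesis
    unfolding TL_homology_subquot
  proof (rule subquot_mod_isomorphic)
    show "subquotient R (TC (TL_trivial R) (k + n div 2)) (cycles (TC (TL_trivial R)) (TB (TL_trivial R)) (k + n div 2))
      (boundaries (TC (TL_trivial R)) (TB (TL_trivial R)) (k + n div 2))"
      by (rule chain_complex.homology_subquotient[OF triv.Tor_chain_complex])
    show "subquotient R (TC CupM k) (cycles (TC CupM) (TB CupM) k) (boundaries (TC CupM) (TB CupM) k)"
      by (rule chain_complex.homology_subquotient[OF cup.Tor_chain_complex])
    show "sub_iso R (TC (TL_trivial R) (k + n div 2)) (cycles (TC (TL_trivial R)) (TB (TL_trivial R)) (k + n div 2))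
      (boundaries (TC (TL_trivial R)) (TB (TL_trivial R)) (k + n div 2)) (TC CupM k) (cycles (TC CupM) (TB CupM) k) (boundaries (TC CupM) (TB CupM) k)"
      by (rule sub_iso_trans[OF 1 sub_iso_sym[OF sub_iso_trans[OF cup.Tor_rel 2]]])
  qed
qed

text \<open>The isomorphism is induced by the augmentation of the resolution: by exactness its
  kernel consists of boundaries, and it vanishes on chains with values in the annihilator since
  these act as zero.\<close>

lemma homology_0: "module_isomorphic R (TL_homology R n a (TL_trivial R) 0) (self_module R)"
proof -
  let ?N = "TL_trivial R"
  have s: "carrier (self_module R) = carrier R" "\<zero>\<^bsub>self_module R\<^esub> = \<zero>" "x \<oplus>\<^bsub>self_module R\<^esub> y = x \<oplus> y"
    "x \<odot>\<^bsub>self_module R\<^esub> y = x \<otimes> y" for x y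
    by (simp_all add: self_module_def)
  have ab: "abelian_group (self_module R)"
    by (rule abelian_groupI) (auto simp: s a_ac intro: l_neg)
  have ch: "f \<in> ch (carrier TLA) k \<longleftrightarrow> f \<in> carrier (res_mod TLA ?N k)" for f k
    using free_rmodD(1)[of f TLA] by (auto simp: chain_def)
  have bnd: "f \<in> res.rel_bounds (ch (carrier TLA)) (ch triv.ann) 0 \<longleftrightarrow> res_aug TLA ?N f = \<zero>"
    if f: "f \<in> carrier (res_mod TLA ?N 0)" for f
  proof
    assume "res_aug TLA ?N f = \<zero>"
    then obtain g where g: "g \<in> carrier (res_mod TLA ?N (Suc 0))" "res_bd TLA g = f"
      using res.exact_0[OF f] by (auto simp: triv_simps)
    have "f = res_bd TLA g \<oplus>\<^bsub>res_scal TLA ?N 0\<^esub> \<zero>\<^bsub>res_scal TLA ?N 0\<^esub>"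
      using g free_rmodD(1)[OF f] by (simp add: res_scal_simps)
    then show "f \<in> res.rel_bounds (ch (carrier TLA)) (ch triv.ann) 0"
      unfolding res.rel_bounds_def ch
      using g(1) res.subcomplexD(2)[OF res.chain_subcomplex[OF triv.ann_left_ideal]] by blast
  next
    assume "f \<in> res.rel_bounds (ch (carrier TLA)) (ch triv.ann) 0"
    then obtain g m where g: "g \<in> carrier (res_mod TLA ?N (Suc 0))" "m \<in> ch triv.ann 0"
      "f = res_bd TLA g \<oplus>\<^bsub>res_scal TLA ?N 0\<^esub> m"
      unfolding res.rel_bounds_def ch by blast
    have "res_aug TLA ?N (res_bd TLA g) = \<zero>"
      using res_exact_aug[OF res.L] g(1) by (auto simp: triv_simps)
    moreover have "res_aug TLA ?N m = \<zero>"
    proof (rule res.aug_zero[unfolded triv_simps, OF res.chainD(1)[OF g(2)]])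
      fix b x assume x: "x \<in> carrier R"
      have "m b \<in> carrier TLA" "TL_aug (m b) \<otimes> \<one> = \<zero>"
        using res.chainD(2)[OF g(2), of b] by (simp_all add: triv.ann_def triv_simps)
      then have "TL_aug (m b) = \<zero>" using TL_aug_closed[of "m b"] by simp
      then show "TL_aug (m b) \<otimes> x = \<zero>" using x by simp
    qed
    ultimately show "res_aug TLA ?N f = \<zero>"
      using res.aug_add[OF res_bd_closed[OF res.L g(1)] res.chainD(1)[OF g(2)]] unfolding g(3) res_scal_simps
      by (simp add: triv_simps)
  qed
  have aug: "sub_iso R (res_scal TLA ?N 0) (res.rel_cycles (ch (carrier TLA)) (ch triv.ann) 0) (res.rel_bounds (ch (carrier TLA)) (ch triv.ann) 0)
    (self_module R) (carrier (self_module R)) {\<zero>\<^bsub>self_module R\<^esub>}"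
  proof (rule sub_isoI[of "\<lambda>f x. f \<in> carrier (res_mod TLA ?N 0) \<and> x = res_aug TLA ?N f"], goal_cases)
    case (1 f x) then show ?case by (simp add: res.rel_cycles_def ch)
  next
    case (2 f x) then show ?case using res.aug_closed by (simp add: triv_simps s)
  next
    case (3 f x) then show ?case using bnd by (simp add: s)
  next
    case (4 f x) then show ?case using bnd by (simp add: s)
  next
    case (5 f) then show ?case by (simp add: res.rel_cycles_def ch)
  next
    case (6 x)
    then have "x \<in> carrier ?N" by (simp add: s triv_simps)
    then show ?case using res_aug_surj[OF res.L] by blast
  next
    case (7 f x g y)
    then have f: "f \<in> carrier (res_mod TLA ?N 0)" "g \<in> carrier (res_mod TLA ?N 0)" by auto
    show ?case using 7 res.aug_add[OF f] res.free_rmod_add[OF f] by (simp add: s res_scal_simps triv_simps)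
  next
    case (8 r f x)
    then have f: "f \<in> carrier (res_mod TLA ?N 0)" by auto
    show ?case using 8 res.aug_smult[OF f sc_closed[OF 8(1)]] res.free_rmod_smult[OF f sc_closed[OF 8(1)]]
      by (simp add: s res_scal_simps triv_simps aug_sc)
  qed
  interpret S: subquotient R "TC ?N 0" "cycles (TC ?N) (TB ?N) 0" "boundaries (TC ?N) (TB ?N) 0"
    by (rule chain_complex.homology_subquotient[OF triv.Tor_chain_complex])
  show ?thesis unfolding TL_homology_subquot
    by (rule sub_iso_module_isomorphic[OF S.subquot_mod_abelian ab])
      (rule sub_iso_trans[OF sub_iso_sym[OF S.sub_iso_subquot_mod] sub_iso_trans[OF triv.Tor_rel aug]])
qed

end

theorem theoremB:
  fixes R :: "('r, 'x) ring_scheme" and a :: 'r and n :: nat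
  assumes "cring R" and "a \<in> carrier R" and "even n"
  shows "module_isomorphic R (TL_homology R n a (TL_trivial R) 0) (self_module R) \<and>
    (\<forall>k. 0 < k \<and> k < n div 2 \<longrightarrow>
       carrier (TL_homology R n a (TL_trivial R) k) = {\<zero>\<^bsub>TL_homology R n a (TL_trivial R) k\<^esub>}) \<and>
    (\<forall>k. module_isomorphic R (TL_homology R n a (TL_trivial R) (k + n div 2))
       (TL_homology R n a (Cup R n a {i. 1 \<le> i \<and> i < n \<and> odd i}) k))"
proof -
  interpret temperley_lieb R a n
    using assms by (simp add: temperley_lieb_def temperley_lieb_axioms_def)
  show ?thesis using homology_0 homology_vanishing[OF assms(3)] homology_shift[OF assms(3)] by blast
qed

end
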